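(* For every $r,m,s\in\mathbb{N}$ and every partition regular matrix $A\in\mathcal{M}_{r\times m}(\mathbb{Z})$ there exists a constant $c=c(A,s)>0$ such that \[ \lim_{n\to\infty}\mathbb{P}\big([n]_p\to^{\star}_{s}A\big)=0\quad\text{if } p(n)\le c\,n^{-1/m_1(A)}. \]
   Context: $[n]=\{1,\dots,n\}$; $[n]_p$ is the binomial random subset of $[n]$ containing each element independently with probability $p=p(n)$. For $A\in\mathcal{M}_{r\times m}(\mathbb{Z})$ let $\mathcal{S}(A)=\{\mathbf{x}\in\mathbb{Z}^m:A\mathbf{x}^T=\mathbf{0}\}$ and $\mathcal{S}_0(A)=\{\mathbf{x}\in\mathcal{S}(A):x_i\ne x_j\text{ for }i\ne j\}$. $A$ is irredundant if $\mathcal{S}_0(A)\ne\emptyset$. For a set $T$ of integers and $s\in\mathbb{N}$, $T\to_s A$ means that for every partition $T=T_1\dot\cup\dots\dot\cup T_s$ some $T_i$ satisfies $T_i^m\cap\mathcal{S}_0(A)\ne\emptyset$. $A$ is partition regular if it is irredundant and for every $s\in\mathbb{N}$, $[n]\to_s A$ for all $n$ large enough. For $\mathbf{x}\in\mathcal{S}(A)$, $\mathcal{P}[\mathbf{x}]=\{\{j: x_j=x_i\}:1\le i\le m\}$ is the set partition of $[m]$ recording equal entries. For a set partition $\mathcal{P}=\{T_1,\dots,T_k\}$ of $[m]$ with $\min T_1<\dots<\min T_k$, $A_{\mathcal{P}}$ is the $r\times k$ matrix whose $j$-th column is $\sum_{i\in T_j}\mathbf{c}_i$, where $\mathbf{c}_i$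 is the $i$-th column of $A$. The non-trivial solutions are $\mathcal{S}_1(A)=\{\mathbf{x}\in\mathcal{S}(A):\mathrm{rank}(A_{\mathcal{P}[\mathbf{x}]})=\mathrm{rank}(A)\}$. $T\to^\star_s A$ means that for every partition $T=T_1\dot\cup\dots\dot\cup T_s$ some $T_i$ satisfies $T_i^m\cap\mathcal{S}_1(A)\neq\emptyset$. For $Q\subseteq[m]$, $A^{\bar Q}$ is the submatrix of columns indexed by $[m]\setminus Q$ (empty matrix has rank $0$), $r_Q=\mathrm{rank}(A)-\mathrm{rank}(A^{\bar Q})$, and $m_1(A)=\max_{Q\subseteq[m],|Q|\ge2}\frac{|Q|-1}{|Q|-r_Q-1}$.
   Formalization: Proved for s ≥ 2 and A ≠ 0: for s = 1 the claim fails (e.g. Schur triples at p = c n^{-1/2} appear with probability tending to 1), and for A = 0 it fails if m ≥ 2 (the event is that [n]_p is nonempty) and m_1 is undefined if m = 1. *)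

theory Defs
  imports
    "HOL-Probability.Probability"
    "Jordan_Normal_Form.DL_Rank_Submatrix"
begin

text \<open>
  Columns, and hence the coordinates of solutions, are indexed by \<open>{..<m}\<close> as usual for
  the matrix type, instead of by \<open>{1..m}\<close>.
\<close>

text \<open>The rank of an integer matrix is its rank over the rationals.\<close>

definition int_rank :: "int mat \<Rightarrow> nat" where
  "int_rank A = vec_space.rank (dim_row A) (map_mat rat_of_int A)"

definition solutions :: "int mat \<Rightarrow> int vec set" where
  "solutions A = {x \<in> carrier_vec (dim_col A). A *\<^sub>v x = 0\<^sub>v (dim_row A)}"

definition proper_solutions :: "int mat \<Rightarrow> int vec set" where
  "proper_solutions A = {x \<in> solutions A. inj_on (vec_index x) {..<dim_col A}}"

definition irredundant :: "int mat \<Rightarrow> bool" where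
  "irredundant A \<longleftrightarrow> proper_solutions A \<noteq> {}"

text \<open>
  \<open>arrows T s X\<close>: however \<open>T\<close> is split into \<open>s\<close> pairwise disjoint, possibly empty parts,
  some part contains all entries of a vector in \<open>X\<close>.
\<close>

definition arrows :: "int set \<Rightarrow> nat \<Rightarrow> int vec set \<Rightarrow> bool" where
  "arrows T s X \<longleftrightarrow>
     (\<forall>P :: nat \<Rightarrow> int set.
        disjoint_family_on P {1..s} \<and> (\<Union>i\<in>{1..s}. P i) = T \<longrightarrow>
        (\<exists>i\<in>{1..s}. \<exists>x\<in>X. vec_set x \<subseteq> P i))"

definition partition_regular :: "int mat \<Rightarrow> bool" where
  "partition_regular A \<longleftrightarrow>
     irredundant A \<and>
     (\<forall>s\<ge>1. \<forall>\<^sub>F n in sequentially. arrows {1..int n} s (proper_solutions A))"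

definition entry_partition :: "int vec \<Rightarrow> nat set set" where
  "entry_partition x = (\<lambda>i. {j. j < dim_vec x \<and> x $ j = x $ i}) ` {..<dim_vec x}"

definition contract_columns :: "int mat \<Rightarrow> nat set set \<Rightarrow> int mat" where
  "contract_columns A P =
     mat (dim_row A) (card P)
       (\<lambda>(a, j). \<Sum>i\<in>sorted_key_list_of_set Min P ! j. A $$ (a, i))"

definition nontrivial_solutions :: "int mat \<Rightarrow> int vec set" where
  "nontrivial_solutions A =
     {x \<in> solutions A. int_rank (contract_columns A (entry_partition x)) = int_rank A}"

definition delete_columns :: "int mat \<Rightarrow> nat set \<Rightarrow> int mat" where
  "delete_columns A Q = submatrix A {..<dim_row A} ({..<dim_col A} - Q)"

definition rank_drop :: "int mat \<Rightarrow> nat set \<Rightarrow> int" where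
  "rank_drop A Q = int (int_rank A) - int (int_rank (delete_columns A Q))"

text \<open>
  The maximum is meant for partition regular \<open>A\<close> with at least two columns. Then every
  denominator is positive: otherwise the solutions, projected to the coordinates in \<open>Q\<close>,
  would span at most a line, so two distinct coordinates would have a fixed ratio other than 1,
  and a finite colouring of the positive integers avoids any such ratio.
\<close>

definition max_density :: "int mat \<Rightarrow> real" where
  "max_density A =
     Max ((\<lambda>Q. (real (card Q) - 1) / (real (card Q) - real_of_int (rank_drop A Q) - 1)) `
          {Q. Q \<subseteq> {..<dim_col A} \<and> 2 \<le> card Q})"

definition binomial_subset :: "nat \<Rightarrow> real \<Rightarrow> int set pmf" where
  "binomial_subset n p =
     map_pmf (\<lambda>f. {i \<in> {1..int n}. f i}) (Pi_pmf {1..int n} False (\<lambda>_. bernoulli_pmf p))"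

end

theory Submission
  imports Defs "HOL-Library.Function_Algebras"
begin

text \<open>
  Let \<open>d S\<close> be the dimension of the solution space projected to the coordinates in \<open>S\<close>, so that
  \<open>max_density A\<close> is the maximum \<open>\<mu>\<close> of \<open>(|S| - 1) / (d S - 1)\<close>, and fix a smallest set \<open>Q\<close> attaining
  it. It suffices to 2-colour the random set so that no solution is monochromatic on \<open>Q\<close>. With
  \<open>p = c n\<^sup>-\<^sup>1\<^sup>/\<^sup>\<mu>\<close> the hypergraph of the sets \<open>x ` Q\<close> behaves like a sparse random hypergraph: the
  expected number of edges at a vertex is a small constant, a further edge through two explored
  vertices costs the factor \<open>np\<close>, and any other overlap costs a power of \<open>n\<close> because \<open>Q\<close> is strictly
  balanced. A minimal hypergraph that is not 2-colourable has, for every vertex of every edge, another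
  edge meeting it in that vertex only; following such edges one finds a path with overlaps so costly
  that none occurs with probability tending to 1. Nontrivial solutions with two equal entries in \<open>Q\<close> have bounded
  expected number and are replaced by a strictly balanced subset of their values, so that a second
  overlap is again too costly.
\<close>

text \<open>The obstacle is that \<open>p\<close> sits at the threshold itself: the bound on the
  expected degree is a constant, so long paths, single cycles and single edges of \<open>G\<close>
  cannot be ruled out by expectation. Only structures with two defects can. A cycle has one: its
  closing edge meets two explored vertices, which cancels the factor N = n^(1 - 1/\<mu>), of order
  np, contributed by the first edge. An edge of \<open>G\<close> starts without that factor. The
  second defect supplies the negative power of \<open>n\<close>. Between the defects lie paths of
  any length, so the union bound is a series over lengths. It is geometric for two reasons: a link
  attaches to the newest edge, which leaves at most \<open>q\<close> places, and the constant is so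
  small that the degree also beats the number of subsets of the explored set, which is exponential
  in the length. Partition regularity enters through dimensions of projections: one coordinate has
  dimension 1, and two have dimension 2 because no two coordinates keep a fixed ratio.\<close>

unbundle no vec_syntax
no_notation vector_scalar_mult (infixl \<open>*s\<close> 70)

section \<open>Dimensions of coordinate projections\<close>

context vector_space
begin

text \<open>Columns \<open>c i\<close> may coincide, so a basis is kept as a set of indices on which
  \<open>c\<close> is injective; cardinalities of index sets can then be compared with
  dimensions.\<close>

lemma extend_indexed_basis:
  fixes c :: "'i \<Rightarrow> 'b"
  assumes "finite S" "J0 \<subseteq> S" "inj_on c J0" "independent (c ` J0)"
  obtains J where "J0 \<subseteq> J" "J \<subseteq> S" "inj_on c J" "independent (c ` J)"
    "c ` S \<subseteq> span (c ` J)" "card J = dim (c ` S)"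
proof -
  obtain B where B: "c ` J0 \<subseteq> B" "B \<subseteq> c ` S" "independent B" "c ` S \<subseteq> span B"
    using maximal_independent_subset_extend[of "c ` J0" "c ` S"] assms by blast
  define K where "K = inv_into S c ` (B - c ` J0)"
  have cK: "c (inv_into S c b) = b \<and> inv_into S c b \<in> S" if "b \<in> B" for b
    using that B(2) by (auto intro: f_inv_into_f inv_into_into)
  have imK: "c ` K = B - c ` J0" unfolding K_def image_image using cK by (auto simp: image_iff)
  have injK: "inj_on c K" unfolding K_def using cK by (auto simp: inj_on_def)
  have im: "c ` (J0 \<union> K) = B" unfolding image_Un imK using B(1) by auto
  have inj: "inj_on c (J0 \<union> K)"
    using assms(3) injK imK by (auto simp: inj_on_Un)
  have sub: "J0 \<union> K \<subseteq> S" using assms(2) cK by (auto simp: K_def)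
  have "card (J0 \<union> K) = card B" using card_image[OF inj] im by simp
  also have "\<dots> = dim (c ` S)" using B by (intro basis_card_eq_dim) auto
  finally show ?thesis using that[of "J0 \<union> K"] inj im sub B by auto
qed

text \<open>If \<open>z j\<close> were nonzero, the relation could be solved for \<open>c j\<close>,
  placing it in the span of the other vectors of an independent family. Indices in \<open>K\<close>
  enter only through \<open>v\<close>, so their coefficients stay open.\<close>

lemma coefficients_vanish:
  fixes c :: "'i \<Rightarrow> 'b" and z :: "'i \<Rightarrow> 'a"
  assumes fin: "finite J" and inj: "inj_on c J" and ind: "independent (c ` J)" and "K \<subseteq> J"
    and sum: "(\<Sum>i\<in>J - K. z i *s c i) + v = 0" and v: "v \<in> span (c ` K)"
    and j: "j \<in> J - K"
  shows "z j = 0"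
proof (rule ccontr)
  assume "z j \<noteq> 0"
  let ?R = "span (c ` (J - {j}))"
  have "(\<Sum>i\<in>J - K. z i *s c i) = z j *s c j + (\<Sum>i\<in>J - K - {j}. z i *s c i)"
    using fin j by (intro sum.remove) auto
  then have "z j *s c j = - ((\<Sum>i\<in>J - K - {j}. z i *s c i) + v)"
    unfolding eq_neg_iff_add_eq_0 using sum by (simp add: add.assoc)
  moreover have "(\<Sum>i\<in>J - K - {j}. z i *s c i) \<in> ?R"
    by (intro span_sum span_scale span_base) auto
  moreover have "v \<in> ?R" using v j \<open>K \<subseteq> J\<close> span_mono[of "c ` K" "c ` (J - {j})"] by auto
  ultimately have "z j *s c j \<in> ?R" by (simp only: span_add span_neg)
  then have "inverse (z j) *s (z j *s c j) \<in> ?R" by (rule span_scale)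
  then have "c j \<in> ?R" using \<open>z j \<noteq> 0\<close> by simp
  moreover have "c ` (J - {j}) = c ` J - {c j}"
    using inj j by (auto simp: inj_on_def)
  ultimately have "dependent (c ` J)" using j by (auto simp: dependent_def)
  then show False using ind by simp
qed

text \<open>The dimension of the space of relations between the columns, projected to the
  coordinates in \<open>S\<close>: all relations have dimension |I| minus the total rank, and those
  vanishing on \<open>S\<close> have dimension |I - S| minus the rank of the columns outside
  \<open>S\<close>.\<close>

definition proj_dim :: "'i set \<Rightarrow> ('i \<Rightarrow> 'b) \<Rightarrow> 'i set \<Rightarrow> int" where
  "proj_dim I c S = int (card S) - int (dim (c ` I)) + int (dim (c ` (I - S)))"

text \<open>\<open>D\<close> is a set of free coordinates. A column basis \<open>K\<close> outside
  \<open>Q\<close> extends to a column basis \<open>J\<close> outside \<open>W\<close>; once the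
  coordinates in \<open>W\<close> and \<open>D\<close> are zero, independence of \<open>J\<close>
  forces those in \<open>J - K\<close> to be zero as well.\<close>

lemma proj_dim_determining_set:
  fixes c :: "'i \<Rightarrow> 'b"
  assumes fin: "finite I" and Q: "Q \<subseteq> I" and W: "W \<subseteq> Q"
  obtains D where "D \<subseteq> Q - W" "int (card D) = local.proj_dim I c Q - local.proj_dim I c W"
    "\<forall>z. (\<Sum>i\<in>I. z i *s c i) = 0 \<longrightarrow> (\<forall>i\<in>W \<union> D. z i = 0) \<longrightarrow> (\<forall>i\<in>Q. z i = 0)"
proof -
  obtain K where K: "K \<subseteq> I - Q" "inj_on c K" "independent (c ` K)"
      "c ` (I - Q) \<subseteq> span (c ` K)" "card K = dim (c ` (I - Q))"
    using extend_indexed_basis[of "I - Q" "{}" c] fin independent_empty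
    by (metis empty_subsetI finite_Diff image_empty inj_on_empty)
  obtain J where J: "K \<subseteq> J" "J \<subseteq> I - W" "inj_on c J" "independent (c ` J)"
      "card J = dim (c ` (I - W))"
  proof -
    have "K \<subseteq> I - W" using K(1) W by blast
    then show ?thesis
      using fin K(2,3) that by (elim extend_indexed_basis[of "I - W" K c, rotated]) simp_all
  qed
  have finJ: "finite J" using J(2) fin finite_subset by blast
  have JQ: "J - K \<subseteq> Q - W"
  proof
    fix j assume j: "j \<in> J - K"
    have "j \<in> Q"
    proof (rule ccontr)
      assume "j \<notin> Q"
      then have "c j \<in> span (c ` K)" using j J(2) K(4) by auto
      moreover have "c ` K \<subseteq> c ` J - {c j}" using J(1,3) j by (auto simp: inj_on_def)
      ultimately have "c j \<in> span (c ` J - {c j})" using span_mono by blast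
      then show False using J(4) j by (auto simp: dependent_def)
    qed
    then show "j \<in> Q - W" using j J(2) by auto
  qed
  define D where "D = (Q - W) - (J - K)"
  have finQ: "finite Q" using Q fin finite_subset by blast
  have card_D: "int (card D) = local.proj_dim I c Q - local.proj_dim I c W"
  proof -
    have "card D = card (Q - W) - card (J - K)"
      unfolding D_def using JQ finJ by (intro card_Diff_subset) auto
    moreover have "card (J - K) \<le> card (Q - W)" using JQ finQ by (intro card_mono) auto
    moreover have "card (J - K) = card J - card K" "card K \<le> card J"
      using J(1) finJ finite_subset[OF J(1) finJ] by (auto intro: card_Diff_subset card_mono)
    moreover have "card (Q - W) = card Q - card W" "card W \<le> card Q"
      using W finQ finite_subset[OF W finQ] by (auto intro: card_Diff_subset card_mono)
    ultimately show ?thesis using J(5) K(5) by (simp add: proj_dim_def)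
  qed
  have vanish: "z i = 0"
    if sum: "(\<Sum>i\<in>I. z i *s c i) = 0" and z: "\<And>i. i \<in> W \<union> D \<Longrightarrow> z i = 0" and i: "i \<in> Q" for z i
  proof (cases "i \<in> J - K")
    case True
    define v where "v = (\<Sum>i\<in>I - Q. z i *s c i)"
    have "v \<in> span (c ` K)" unfolding v_def using K(4) by (intro span_sum span_scale) auto
    moreover have "(\<Sum>i\<in>J - K. z i *s c i) + v = 0"
    proof -
      have "(\<Sum>i\<in>I. z i *s c i) = (\<Sum>i\<in>Q. z i *s c i) + v"
        unfolding v_def using sum.subset_diff[OF Q fin, of "\<lambda>i. z i *s c i"] by (simp add: add.commute)
      moreover have "(\<Sum>i\<in>Q. z i *s c i) = (\<Sum>i\<in>J - K. z i *s c i)"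
        using JQ finQ z by (intro sum.mono_neutral_right) (auto simp: D_def)
      ultimately show ?thesis using sum by simp
    qed
    ultimately show ?thesis using coefficients_vanish[OF finJ J(3,4,1)] True by blast
  next
    case False
    then show ?thesis using i z by (auto simp: D_def)
  qed
  have "D \<subseteq> Q - W" by (auto simp: D_def)
  then show thesis using card_D by (rule that) (use vanish in blast)
qed

lemma proj_dim_empty [simp]: "local.proj_dim I c {} = 0"
  by (simp add: proj_dim_def)

lemma proj_dim_mono:
  assumes "finite I" "Q \<subseteq> I" "W \<subseteq> Q"
  shows "local.proj_dim I c W \<le> local.proj_dim I c Q"
  using proj_dim_determining_set[OF assms, of c] by (metis diff_ge_0_iff_ge of_nat_0_le_iff)

lemma dim_le_if_subset_span:
  assumes "finite T" "S \<subseteq> span T"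
  shows "dim S \<le> dim T"
proof -
  obtain A where A: "A \<subseteq> T" "independent A" "T \<subseteq> span A" "card A = dim T"
    using basis_exists by blast
  obtain B where B: "B \<subseteq> S" "independent B" "S \<subseteq> span B" "card B = dim S"
    using basis_exists by blast
  have "span T \<subseteq> span A" using A(3) by (simp add: span_minimal)
  then have "B \<subseteq> span A" using B(1) assms(2) by blast
  then show ?thesis
    using independent_span_bound[OF finite_subset[OF A(1) assms(1)] B(2)] A(4) B(4) by simp
qed

text \<open>Equality of the total ranks makes them cancel. Merged columns of blocks off
  \<open>Q\<close> lie in the span of the columns off \<open>Q\<close>, so the remaining rank does
  not grow, and the dimension drops at least by the number of coordinates lost on
  \<open>Q\<close>.\<close>

lemma proj_dim_merge:
  assumes fin: "finite I" and part: "\<Union>P = I" and Q: "Q \<subseteq> I"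
    and rank: "dim ((\<lambda>T. \<Sum>i\<in>T. c i) ` P) = dim (c ` I)"
  shows "local.proj_dim P (\<lambda>T. \<Sum>i\<in>T. c i) {T \<in> P. T \<inter> Q \<noteq> {}} \<le>
    local.proj_dim I c Q - (int (card Q) - int (card {T \<in> P. T \<inter> Q \<noteq> {}}))"
proof -
  have "(\<lambda>T. \<Sum>i\<in>T. c i) ` (P - {T \<in> P. T \<inter> Q \<noteq> {}}) \<subseteq> span (c ` (I - Q))"
    using part by (intro image_subsetI span_sum span_base imageI) auto
  then have "dim ((\<lambda>T. \<Sum>i\<in>T. c i) ` (P - {T \<in> P. T \<inter> Q \<noteq> {}})) \<le> dim (c ` (I - Q))"
    using fin by (intro dim_le_if_subset_span) auto
  then show ?thesis using rank by (simp add: proj_dim_def)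
qed

end

section \<open>Ranks of integer matrices as dimensions of families of columns\<close>

global_interpretation rat_fun: vector_space "\<lambda>(c::rat) (f::nat \<Rightarrow> rat) i. c * f i"
  by unfold_locales (auto simp: algebra_simps fun_eq_iff)

text \<open>Extension by zero puts the columns of matrices of any height into the single space
  \<open>rat_fun\<close>, where the results on \<open>proj_dim\<close> apply.\<close>

definition column_fun :: "int mat \<Rightarrow> nat \<Rightarrow> nat \<Rightarrow> rat" where
  "column_fun B j = (\<lambda>i. if i < dim_row B then rat_of_int (B $$ (i, j)) else 0)"

definition vec_fun :: "rat vec \<Rightarrow> nat \<Rightarrow> rat" where
  "vec_fun v = (\<lambda>i. if i < dim_vec v then v $ i else 0)"

lemma inj_on_vec_fun: "inj_on vec_fun (carrier_vec r)"
proof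
  fix v w assume vw: "v \<in> carrier_vec r" "w \<in> carrier_vec r" "vec_fun v = vec_fun w"
  show "v = w"
  proof (rule eq_vecI)
    fix i assume "i < dim_vec w"
    then show "v $ i = w $ i" using fun_cong[OF vw(3), of i] vw by (auto simp: vec_fun_def)
  qed (use vw in auto)
qed

lemma sum_fun_apply: "(\<Sum>x\<in>S. f x) i = (\<Sum>x\<in>S. f x i)" for f :: "'a \<Rightarrow> nat \<Rightarrow> rat"
  by (induction S rule: infinite_finite_induct) auto

text \<open>The bridge from the carrier-based vectors of fixed length, on which
  \<open>int_rank\<close> rests, to \<open>rat_fun\<close>.\<close>

lemma lin_dep_vec_fun:
  assumes T: "T \<subseteq> carrier_vec r" "finite T"
  shows "module.lin_dep class_ring (module_vec TYPE(rat) r) T \<longleftrightarrow> rat_fun.dependent (vec_fun ` T)"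
proof -
  interpret vec_space "TYPE(rat)" r .
  have inj: "inj_on vec_fun T" using inj_on_vec_fun T(1) inj_on_subset by blast
  have lc: "lincomb a S = 0\<^sub>v r \<longleftrightarrow> (\<Sum>v\<in>S. (\<lambda>i. a v * vec_fun v i)) = 0" if S: "S \<subseteq> T" for a S
  proof -
    have SC: "S \<subseteq> carrier_vec r" using S T by auto
    have "lincomb a S \<in> carrier_vec r" using SC by (intro lincomb_closed) auto
    then have "lincomb a S = 0\<^sub>v r \<longleftrightarrow> (\<forall>i<r. lincomb a S $ i = 0)"
      by (auto intro!: eq_vecI)
    also have "\<dots> \<longleftrightarrow> (\<forall>i<r. (\<Sum>v\<in>S. a v * v $ i) = 0)"
      using SC by (simp add: lincomb_index)
    also have "\<dots> \<longleftrightarrow> (\<forall>i. (\<Sum>v\<in>S. a v * vec_fun v i) = 0)"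
    proof -
      have "(\<Sum>v\<in>S. a v * vec_fun v i) = (if i < r then (\<Sum>v\<in>S. a v * v $ i) else 0)" for i
        using SC by (auto simp: vec_fun_def subset_iff intro!: sum.cong sum.neutral)
      then show ?thesis by auto
    qed
    finally show ?thesis by (simp add: fun_eq_iff sum_fun_apply)
  qed
  show ?thesis
  proof
    assume "lin_dep T"
    then obtain S a v where S: "finite S" "S \<subseteq> T" "lincomb a S = 0\<^sub>v r" "v \<in> S" "a v \<noteq> 0"
      unfolding lin_dep_def by auto
    define u where "u = a \<circ> the_inv_into T vec_fun"
    have u: "u (vec_fun w) = a w" if "w \<in> S" for w
      using that S(2) inj by (auto simp: u_def the_inv_into_f_f)
    have "(\<Sum>f\<in>vec_fun ` S. (\<lambda>i. u f * f i)) = (\<Sum>w\<in>S. (\<lambda>i. a w * vec_fun w i))"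
      using inj_on_subset[OF inj S(2)] u by (subst sum.reindex) (auto intro!: sum.cong)
    then have "(\<Sum>f\<in>vec_fun ` S. (\<lambda>i. u f * f i)) = 0" using lc[OF S(2)] S(3) by simp
    then show "rat_fun.dependent (vec_fun ` T)"
      unfolding rat_fun.dependent_explicit using S u by (intro exI[of _ "vec_fun ` S"] exI[of _ u]) auto
  next
    assume "rat_fun.dependent (vec_fun ` T)"
    then obtain R u f where R: "finite R" "R \<subseteq> vec_fun ` T" "(\<Sum>f\<in>R. (\<lambda>i. u f * f i)) = 0"
      "f \<in> R" "u f \<noteq> 0"
      unfolding rat_fun.dependent_explicit by blast
    obtain S where S: "S \<subseteq> T" "R = vec_fun ` S" using R(2) by (meson subset_imageE)
    have "(\<Sum>f\<in>R. (\<lambda>i. u f * f i)) = (\<Sum>w\<in>S. (\<lambda>i. u (vec_fun w) * vec_fun w i))"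
      unfolding S(2) using inj_on_subset[OF inj S(1)] by (subst sum.reindex) auto
    then have "lincomb (u \<circ> vec_fun) S = 0\<^sub>v r" using lc[OF S(1), of "u \<circ> vec_fun"] R(3) by simp
    moreover obtain v where "v \<in> S" "u (vec_fun v) \<noteq> 0" using R S by auto
    ultimately show "lin_dep T"
      unfolding lin_dep_def using S(1) T(2) finite_subset
      by (intro exI[of _ S] exI[of _ "u \<circ> vec_fun"] exI[of _ v]) (auto simp: class_ring_simps)
  qed
qed

text \<open>The rank is the size of a maximal independent set of columns; by maximality the image of
  such a set also spans all columns in \<open>rat_fun\<close>.\<close>

lemma int_rank_eq_dim: "int_rank B = rat_fun.dim (column_fun B ` {..<dim_col B})"
proof -
  let ?r = "dim_row B" and ?C = "map_mat rat_of_int B"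
  interpret vec_space "TYPE(rat)" ?r .
  have C: "?C \<in> carrier_mat ?r (dim_col B)" by simp
  have sub: "set (cols ?C) \<subseteq> carrier_vec ?r" using cols_dim[of ?C] by simp
  have img: "vec_fun ` set (cols ?C) = column_fun B ` {..<dim_col B}"
  proof -
    have "vec_fun (col ?C j) = column_fun B j" if "j < dim_col B" for j
      using that by (auto simp: vec_fun_def column_fun_def)
    then show ?thesis by (auto simp: cols_def image_image)
  qed
  have "lin_indpt {}" using lin_dep_vec_fun[of "{}" ?r] rat_fun.independent_empty by simp
  then obtain S where S: "maximal S (\<lambda>T. T \<subseteq> set (cols ?C) \<and> lin_indpt T)"
    using maximal_exists_superset[of "set (cols ?C)" "\<lambda>T. T \<subseteq> set (cols ?C) \<and> lin_indpt T" "{}"]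
    by auto
  have SI: "S \<subseteq> set (cols ?C)" "lin_indpt S" using S by (auto simp: maximal_def)
  have fS: "finite S" using SI finite_subset by blast
  have ind: "\<not> rat_fun.dependent (vec_fun ` S)"
    using SI sub fS lin_dep_vec_fun[of S ?r] by auto
  have "vec_fun v \<in> rat_fun.span (vec_fun ` S)" if v: "v \<in> set (cols ?C)" for v
  proof (rule ccontr)
    assume n: "vec_fun v \<notin> rat_fun.span (vec_fun ` S)"
    then have "\<not> rat_fun.dependent (vec_fun ` insert v S)"
      using ind by (simp add: rat_fun.independent_insertI)
    moreover have "insert v S \<subseteq> carrier_vec ?r" using v SI sub by auto
    ultimately have "lin_indpt (insert v S)" using lin_dep_vec_fun[of "insert v S" ?r] fS by auto
    then have "insert v S = S" using S v SI unfolding maximal_def by (metis insert_subset subset_insertI)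
    then have "v \<in> S" by auto
    then show False using n rat_fun.span_base by blast
  qed
  then have "rat_fun.dim (vec_fun ` set (cols ?C)) = card (vec_fun ` S)"
    using ind SI by (intro rat_fun.dim_unique) auto
  also have "\<dots> = card S"
    using inj_on_subset[OF inj_on_vec_fun, of S ?r] SI sub by (intro card_image) auto
  also have "\<dots> = int_rank B" unfolding int_rank_def using rank_card_indpt[OF C S] by simp
  finally show ?thesis using img by simp
qed

lemma column_fun_delete_columns:
  assumes "j < card ({..<dim_col A} - Q)"
  shows "column_fun (delete_columns A Q) j = column_fun A (pick ({..<dim_col A} - Q) j)"
proof -
  let ?R = "{..<dim_row A}" and ?C = "{..<dim_col A} - Q"
  have dims: "dim_row (delete_columns A Q) = dim_row A"
    "{i. i < dim_row A \<and> i \<in> ?R} = ?R" "{j. j < dim_col A \<and> j \<in> ?C} = ?C"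
    by (auto simp: delete_columns_def dim_submatrix)
  have pick_row: "pick ?R i = i" if "i < dim_row A" for i
  proof -
    have "pick ?R (card {a \<in> ?R. a < i}) = i" using that by (intro pick_card_in_set) auto
    moreover have "{a \<in> ?R. a < i} = {..<i}" using that by auto
    ultimately show ?thesis by simp
  qed
  have "delete_columns A Q $$ (i, j) = A $$ (i, pick ?C j)" if "i < dim_row A" for i
    unfolding delete_columns_def
    using that assms submatrix_index[of i A ?R j ?C] pick_row[OF that] unfolding dims by simp
  then show ?thesis by (auto simp: column_fun_def dims)
qed

lemma int_rank_delete_columns:
  "int_rank (delete_columns A Q) = rat_fun.dim (column_fun A ` ({..<dim_col A} - Q))"
proof -
  let ?C = "{..<dim_col A} - Q"
  have "dim_col (delete_columns A Q) = card ?C"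
    by (auto simp: delete_columns_def dim_submatrix intro!: arg_cong[where f = card])
  moreover have "pick ?C ` {..<card ?C} = ?C"
  proof (rule card_subset_eq)
    have "inj_on (pick ?C) {..<card ?C}" 
    proof (rule inj_onI)
      fix a b assume "a \<in> {..<card ?C}" "b \<in> {..<card ?C}" "pick ?C a = pick ?C b"
      then show "a = b"
        using pick_mono_le[of b ?C a] pick_mono_le[of a ?C b] by (cases a b rule: linorder_cases) auto
    qed
    then show "card (pick ?C ` {..<card ?C}) = card ?C" by (simp add: card_image)
  qed (use pick_in_set_le[of _ ?C] in auto)
  ultimately show ?thesis
    using column_fun_delete_columns[of _ A Q] unfolding int_rank_eq_dim
    by (metis (no_types, lifting) image_cong image_image lessThan_iff)
qed

lemma rank_drop_eq:
  assumes "Q \<subseteq> {..<dim_col A}"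
  shows "real (card Q) - real_of_int (rank_drop A Q) =
    real_of_int (rat_fun.proj_dim {..<dim_col A} (column_fun A) Q)"
  by (simp add: rank_drop_def rat_fun.proj_dim_def int_rank_delete_columns int_rank_eq_dim[of A])

text \<open>The key \<open>Min\<close> is injective on the blocks of a partition but not on all
  sets, so the locale is instantiated with \<open>P\<close> as its domain.\<close>

lemma (in linorder) sorted_key_list_of_set_inj_on:
  assumes "inj_on f P" "finite P"
  shows "set (sorted_key_list_of_set f P) = P" "length (sorted_key_list_of_set f P) = card P"
proof -
  have "folding_insort_key less_eq less P f"
    by (intro folding_insort_key.intro folding_insort_key_axioms.intro linorder_axioms assms)
  then show "set (sorted_key_list_of_set f P) = P" "length (sorted_key_list_of_set f P) = card P"
    by (simp_all only: folding_insort_key.set_sorted_key_list_of_set[OF _ subset_refl]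
      folding_insort_key.length_sorted_key_list_of_set[OF _ subset_refl] assms(2))
qed

text \<open>Neither the order of the blocks nor coincidences between merged columns matter, because
  the rank depends on the set of columns alone.\<close>

lemma int_rank_contract_columns:
  assumes part: "\<Union>P = {..<dim_col A}" "{} \<notin> P" "disjoint P"
  shows "int_rank (contract_columns A P) = rat_fun.dim ((\<lambda>T. \<Sum>i\<in>T. column_fun A i) ` P)"
proof -
  have "P \<subseteq> Pow {..<dim_col A}" using part by auto
  then have finP: "finite P" by (rule finite_subset) simp
  have finT: "finite T" if "T \<in> P" for T
    by (rule finite_subset[of _ "{..<dim_col A}"]) (use that part in auto)
  have inj: "inj_on Min P"
  proof
    fix S T assume ST: "S \<in> P" "T \<in> P" "Min S = Min T"
    have "Min S \<in> S" "Min T \<in> T" using ST finT part by (metis Min_in)+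
    then show "S = T" using ST part(3) by (metis disjointD disjoint_iff)
  qed
  define L where "L = sorted_key_list_of_set Min P"
  have L: "set L = P" "length L = card P" unfolding L_def using sorted_key_list_of_set_inj_on[OF inj finP] by simp_all
  have "column_fun (contract_columns A P) j = (\<Sum>i\<in>L ! j. column_fun A i)" if "j < card P" for j
    using that by (auto simp: column_fun_def contract_columns_def L_def sum_fun_apply fun_eq_iff)
  then have "column_fun (contract_columns A P) ` {..<card P} = (\<lambda>T. \<Sum>i\<in>T. column_fun A i) ` ((!) L ` {..<length L})"
    unfolding image_image using L(2) by (intro image_cong) auto
  also have "(!) L ` {..<length L} = P" using L by (metis list.set_map lessThan_atLeast0 map_nth set_upt)
  finally show ?thesis unfolding int_rank_eq_dim by (simp add: contract_columns_def)
qed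

section \<open>Solutions as relations between columns, and their number\<close>

lemma solution_column_sum:
  fixes x :: "int vec"
  assumes "x \<in> solutions A"
  shows "(\<Sum>i<dim_col A. (\<lambda>k. rat_of_int (x $ i) * column_fun A i k)) = 0"
proof
  fix k
  have x: "dim_vec x = dim_col A" "A *\<^sub>v x = 0\<^sub>v (dim_row A)" using assms by (auto simp: solutions_def)
  show "(\<Sum>i<dim_col A. (\<lambda>k. rat_of_int (x $ i) * column_fun A i k)) k = 0 k"
  proof (cases "k < dim_row A")
    case True
    then have "(A *\<^sub>v x) $ k = 0" using x by simp
    then have "(\<Sum>i<dim_col A. A $$ (k, i) * x $ i) = 0"
      using True x(1) by (simp add: scalar_prod_def lessThan_atLeast0)
    then have "rat_of_int (\<Sum>i<dim_col A. A $$ (k, i) * x $ i) = 0" by simp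
    then have "(\<Sum>i<dim_col A. rat_of_int (x $ i) * rat_of_int (A $$ (k, i))) = 0"
      by (simp add: mult.commute)
    then show ?thesis using True by (simp add: sum_fun_apply column_fun_def)
  qed (simp add: sum_fun_apply column_fun_def)
qed

lemma entry_partition_properties:
  "\<Union>(entry_partition x) = {..<dim_vec x}" "{} \<notin> entry_partition x" "disjoint (entry_partition x)"
  by (auto simp: entry_partition_def disjoint_def)

lemma entry_partition_value:
  fixes x :: "int vec"
  assumes "T \<in> entry_partition x" "i \<in> T"
  shows "x $ i = x $ Min T"
proof -
  have "finite T" "T \<noteq> {}" using assms by (auto simp: entry_partition_def)
  then have "Min T \<in> T" by (rule Min_in)
  then show ?thesis using assms by (auto simp: entry_partition_def)
qed

text \<open>Grouping by blocks turns a solution with repeated entries into a relation between merged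
  columns with distinct coefficients, so one counting argument serves both kinds of
  solutions.\<close>

lemma merged_column_sum:
  fixes x :: "int vec"
  assumes "x \<in> solutions A"
  shows "(\<Sum>T\<in>entry_partition x. (\<lambda>k. rat_of_int (x $ Min T) * (\<Sum>i\<in>T. column_fun A i) k)) = 0"
proof -
  have dim: "dim_vec x = dim_col A" using assms by (auto simp: solutions_def)
  note P = entry_partition_properties[of x]
  have fin: "\<forall>T\<in>entry_partition x. finite T" by (auto simp: entry_partition_def)
  have "(\<Sum>T\<in>entry_partition x. (\<lambda>k. rat_of_int (x $ Min T) * (\<Sum>i\<in>T. column_fun A i) k)) =
      (\<Sum>T\<in>entry_partition x. \<Sum>i\<in>T. (\<lambda>k. rat_of_int (x $ i) * column_fun A i k))"
  proof (intro sum.cong refl ext)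
    fix T k assume T: "T \<in> entry_partition x"
    show "rat_of_int (x $ Min T) * (\<Sum>i\<in>T. column_fun A i) k =
        (\<Sum>i\<in>T. (\<lambda>k. rat_of_int (x $ i) * column_fun A i k)) k"
      by (simp add: sum_fun_apply sum_distrib_left entry_partition_value[OF T] cong: sum.cong)
  qed
  also have "\<dots> = (\<Sum>i\<in>\<Union>(entry_partition x). (\<lambda>k. rat_of_int (x $ i) * column_fun A i k))"
    using fin P(3) by (subst sum.Union_disjoint) (auto simp: disjoint_def)
  also have "\<dots> = 0" using solution_column_sum[OF assms] P(1) dim by simp
  finally show ?thesis .
qed

text \<open>Two members of \<open>X\<close> agree on \<open>W\<close>; if they also agree on the
  determining set \<open>D\<close>, their difference is a relation vanishing on \<open>W\<close> and
  \<open>D\<close>, hence on \<open>Q\<close>. So the values on \<open>D\<close> determine the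
  restriction to \<open>Q\<close>.\<close>

lemma card_restricted_solutions:
  fixes c :: "'i \<Rightarrow> nat \<Rightarrow> rat" and X :: "('i \<Rightarrow> int) set"
  assumes fin: "finite I" and Q: "Q \<subseteq> I" and W: "W \<subseteq> Q" and n: "n \<ge> 1"
    and sol: "\<And>x. x \<in> X \<Longrightarrow> (\<Sum>i\<in>I. (\<lambda>k. rat_of_int (x i) * c i k)) = 0"
    and range: "\<And>x i. x \<in> X \<Longrightarrow> i \<in> Q \<Longrightarrow> x i \<in> {1..int n}"
    and fixed: "\<And>x i. x \<in> X \<Longrightarrow> i \<in> W \<Longrightarrow> x i = g i"
  shows "finite ((\<lambda>x. restrict x Q) ` X) \<and>
    real (card ((\<lambda>x. restrict x Q) ` X)) \<le>
      real n powr real_of_int (rat_fun.proj_dim I c Q - rat_fun.proj_dim I c W)"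
proof -
  obtain D where D: "D \<subseteq> Q - W"
    "int (card D) = rat_fun.proj_dim I c Q - rat_fun.proj_dim I c W"
    "\<forall>z. (\<Sum>i\<in>I. (\<lambda>k. z i * c i k)) = 0 \<longrightarrow> (\<forall>i\<in>W \<union> D. z i = 0) \<longrightarrow> (\<forall>i\<in>Q. z i = 0)"
    by (rule rat_fun.proj_dim_determining_set[OF fin Q W, of c])
  define Y where "Y = (\<lambda>x. restrict x Q) ` X"
  have finD: "finite D" using D(1) Q fin finite_subset by (metis Diff_subset order_trans)
  have "inj_on (\<lambda>y. restrict y D) Y"
  proof
    fix y y' assume yy: "y \<in> Y" "y' \<in> Y" "restrict y D = restrict y' D"
    then obtain x x' where x: "x \<in> X" "y = restrict x Q" "x' \<in> X" "y' = restrict x' Q"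
      unfolding Y_def by blast
    have eqD: "x i = x' i" if "i \<in> D" for i
      using fun_cong[OF yy(3), of i] that D(1) x by auto
    have "\<forall>i\<in>Q. rat_of_int (x i - x' i) = 0"
    proof (rule D(3)[THEN spec, THEN mp, THEN mp])
      have "(\<Sum>i\<in>I. (\<lambda>k. rat_of_int (x i - x' i) * c i k)) =
          (\<Sum>i\<in>I. (\<lambda>k. rat_of_int (x i) * c i k)) - (\<Sum>i\<in>I. (\<lambda>k. rat_of_int (x' i) * c i k))"
        by (rule ext) (simp add: sum_fun_apply sum_subtractf[symmetric] left_diff_distrib)
      then show "(\<Sum>i\<in>I. (\<lambda>k. rat_of_int (x i - x' i) * c i k)) = 0" using sol x by simp
      show "\<forall>i\<in>W \<union> D. rat_of_int (x i - x' i) = 0"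
        using eqD fixed[OF x(1)] fixed[OF x(3)] by auto
    qed
    then show "y = y'" using x by (auto simp: restrict_def)
  qed
  moreover have "(\<lambda>y. restrict y D) ` Y \<subseteq> D \<rightarrow>\<^sub>E {1..int n}"
    using D(1) range by (auto simp: Y_def)
  moreover have "finite (D \<rightarrow>\<^sub>E {1..int n})" using finD by (intro finite_PiE) auto
  moreover have "card (D \<rightarrow>\<^sub>E {1..int n}) = n ^ card D" using finD by (simp add: card_PiE)
  ultimately have "finite Y" "card Y \<le> n ^ card D"
    by (metis inj_on_finite, metis card_inj_on_le)
  then have "finite Y" "real (card Y) \<le> real (n ^ card D)" by (simp_all only: of_nat_le_iff)
  moreover have "real (n ^ card D) = real n powr real_of_int (int (card D))"
    using n by (simp add: powr_realpow)
  ultimately show ?thesis unfolding Y_def D(2) by (simp only: simp_thms)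
qed

section \<open>Hypergraphs that are not 2-colourable\<close>

text \<open>
  Lists of edges record the steps of an exploration, the newest edge first.
\<close>

definition grow :: "('a set list \<Rightarrow> 'a set \<Rightarrow> bool) \<Rightarrow> 'a set list set \<Rightarrow> 'a set list set" where
  "grow R X = {e # es | e es. es \<in> X \<and> R es e}"

definition meets :: "nat set \<Rightarrow> 'a set set \<Rightarrow> 'a set list \<Rightarrow> 'a set \<Rightarrow> bool" where
  "meets I F es e \<longleftrightarrow> e \<in> F \<and> card (e \<inter> \<Union>(set es)) \<in> I"

text \<open>Attaching at \<open>hd es\<close> leaves at most \<open>q\<close> places however long
  the list is; this keeps the cost per link constant.\<close>

definition links :: "'a set set \<Rightarrow> 'a set list \<Rightarrow> 'a set \<Rightarrow> bool" where
  "links F es e \<longleftrightarrow> e \<in> F \<and> card (e \<inter> \<Union>(set es)) = 1 \<and> e \<inter> hd es \<noteq> {}"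

definition touches :: "'a set set \<Rightarrow> 'a set list \<Rightarrow> 'a set \<Rightarrow> bool" where
  "touches G es e \<longleftrightarrow> e \<in> G \<and> e \<inter> \<Union>(set es) \<noteq> {} \<and> \<not> e \<subseteq> \<Union>(set es)"

text \<open>
  In the random setting the elements of \<open>F\<close> are the edges of full size \<open>q\<close>, and those of \<open>G\<close> come
  from solutions with repeated entries. The steps \<open>links\<close> and \<open>meets {1}\<close> are affordable, a step
  \<open>meets {2}\<close> costs as much as the free choice of a first edge in \<open>F\<close> brings, and the steps in
  \<open>ends\<close> cost a further power of \<open>n\<close>. So each of the configurations below is too expensive to appear.
\<close>

definition singles :: "'a set set \<Rightarrow> 'a set list set" where
  "singles F = (\<lambda>e. [e]) ` F"

definition linked :: "'a set set \<Rightarrow> nat \<Rightarrow> 'a set list set \<Rightarrow> 'a set list set" where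
  "linked F a = grow (links F) ^^ a"

definition ends :: "nat \<Rightarrow> 'a set set \<Rightarrow> 'a set set \<Rightarrow> 'a set list set \<Rightarrow> 'a set list set" where
  "ends q F G X = grow (meets {2..<q} F) X \<union> grow (touches G) X"

definition cycles :: "'a set set \<Rightarrow> nat \<Rightarrow> 'a set list set" where
  "cycles F a = grow (meets {2} F) (linked F a (singles F))"

text \<open>Cycles whose two oldest edges share at least two vertices. That overlap is the second
  defect, so nothing has to be appended.\<close>

definition spoiled_cycles :: "nat \<Rightarrow> 'a set set \<Rightarrow> nat \<Rightarrow> 'a set list set" where
  "spoiled_cycles q F a = grow (meets {2} F) (linked F a (grow (meets {2..<q} F) (singles F)))"

text \<open>The chain may leave the explored set anywhere, hence one step \<open>meets {1}\<close>;
  only the later steps must attach to the newest edge.\<close>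

definition extensions :: "nat \<Rightarrow> 'a set set \<Rightarrow> 'a set set \<Rightarrow> nat \<Rightarrow> 'a set list set \<Rightarrow> 'a set list set" where
  "extensions q F G M X =
     ends q F G X \<union> (\<Union>b\<le>M. ends q F G (linked F b (grow (meets {1} F) X)))"

definition configurations :: "nat \<Rightarrow> 'a set set \<Rightarrow> 'a set set \<Rightarrow> nat \<Rightarrow> 'a set list set" where
  "configurations q F G M =
     (\<Union>a\<le>M. spoiled_cycles q F a) \<union> extensions q F G M (singles G) \<union>
     (\<Union>a\<le>M. extensions q F G M (cycles F a))"

lemma growI: "es \<in> X \<Longrightarrow> R es e \<Longrightarrow> e # es \<in> grow R X"
  by (auto simp: grow_def)

lemma growE:
  assumes "ps \<in> grow R X"
  obtains e es where "ps = e # es" "es \<in> X" "R es e"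
  using assms by (auto simp: grow_def)

lemma endsI1:
  assumes "es \<in> X" "e \<in> F" "2 \<le> card (e \<inter> \<Union>(set es))" "card (e \<inter> \<Union>(set es)) < q"
  shows "e # es \<in> ends q F G X"
  unfolding ends_def using assms by (intro UnI1 growI) (simp_all add: meets_def)

lemma endsI2:
  assumes "es \<in> X" "e \<in> G" "e \<inter> \<Union>(set es) \<noteq> {}" "\<not> e \<subseteq> \<Union>(set es)"
  shows "e # es \<in> ends q F G X"
  unfolding ends_def using assms by (intro UnI2 growI) (simp_all add: touches_def)

lemma linked_0 [simp]: "linked F 0 X = X"
  by (simp add: linked_def)

lemma linked_Suc [simp]: "linked F (Suc a) X = grow (links F) (linked F a X)"
  by (simp add: linked_def)

lemma grow_mono: "X \<subseteq> Y \<Longrightarrow> (\<And>es e. R es e \<Longrightarrow> R' es e) \<Longrightarrow> grow R X \<subseteq> grow R' Y"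
  by (fastforce simp: grow_def)

lemma linked_mono: "X \<subseteq> Y \<Longrightarrow> F \<subseteq> F' \<Longrightarrow> linked F a X \<subseteq> linked F' a Y"
proof (induction a)
  case (Suc a)
  then show ?case unfolding linked_Suc by (intro grow_mono) (auto simp: links_def)
qed simp

lemma ends_mono: "X \<subseteq> Y \<Longrightarrow> ends q F G X \<subseteq> ends q F G Y"
  unfolding ends_def by (intro Un_mono grow_mono) auto

lemma extensions_mono: "X \<subseteq> Y \<Longrightarrow> extensions q F G M X \<subseteq> extensions q F G M Y"
  unfolding extensions_def
  by (intro Un_mono UN_mono ends_mono linked_mono grow_mono) auto

text \<open>Separates a chain from its base, so that a segment can be cut out of a path and placed
  on another base.\<close>

fun link_list :: "'a set set \<Rightarrow> 'a set list \<Rightarrow> 'a set list \<Rightarrow> bool" where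
  "link_list F [] base \<longleftrightarrow> True"
| "link_list F (e # ps) base \<longleftrightarrow> links F (ps @ base) e \<and> link_list F ps base"

lemma linkedI: "link_list F ps base \<Longrightarrow> base \<in> X \<Longrightarrow> ps @ base \<in> linked F (length ps) X"
  by (induction ps) (simp_all add: growI)

lemma linkedE:
  assumes "es \<in> linked F a X"
  obtains ps base where "es = ps @ base" "base \<in> X" "link_list F ps base" "length ps = a"
  using assms
proof (induction a arbitrary: es thesis)
  case 0
  then show ?case using 0(1)[of "[]" es] by simp
next
  case (Suc a)
  from Suc.prems(2) obtain e rs where e: "es = e # rs" "rs \<in> linked F a X" "links F rs e"
    by (auto elim: growE)
  obtain ps base where "rs = ps @ base" "base \<in> X" "link_list F ps base" "length ps = a"
    using Suc.IH[OF _ e(2)] by blast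
  then show ?case using Suc.prems(1)[of "e # ps" base] e by simp
qed

lemma link_list_append:
  "link_list F (xs @ ys) base \<longleftrightarrow> link_list F xs (ys @ base) \<and> link_list F ys base"
  by (induction xs) auto

text \<open>Each edge of a chain meets everything older in a single vertex, and that vertex lies in
  its predecessor. The predecessor survives the exchange of the part older than
  \<open>e\<close>.\<close>

lemma link_list_restrict:
  assumes "link_list F xs (e # ys)" "\<And>x. x \<in> set xs \<Longrightarrow> x \<inter> \<Union>(set zs) = {}"
  shows "link_list F xs (e # zs)"
  using assms
proof (induction xs)
  case (Cons x xs)
  have IH: "link_list F xs (e # zs)" using Cons by simp
  have x: "x \<in> F" "card (x \<inter> \<Union>(set (xs @ e # ys))) = 1" "x \<inter> hd (xs @ e # ys) \<noteq> {}"
    using Cons.prems by (auto simp: links_def)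
  obtain z where z: "x \<inter> \<Union>(set (xs @ e # ys)) = {z}" using x(2) card_1_singletonE by blast
  have hd: "hd (xs @ e # ys) = hd (xs @ [e])" "hd (xs @ e # zs) = hd (xs @ [e])"
    by (cases xs; simp)+
  have "hd (xs @ [e]) \<in> set (xs @ [e])" by (intro hd_in_set) simp
  then have "x \<inter> hd (xs @ [e]) \<subseteq> x \<inter> \<Union>(set (xs @ [e]))" by blast
  moreover have "x \<inter> \<Union>(set (xs @ [e])) \<subseteq> {z}" using z by auto
  ultimately have "x \<inter> \<Union>(set (xs @ [e])) = {z}" using x(3) unfolding hd by blast
  moreover have "x \<inter> \<Union>(set zs) = {}" using Cons.prems(2)[of x] by simp
  ultimately have "x \<inter> \<Union>(set (xs @ e # zs)) = {z}" by auto
  then have "links F (xs @ e # zs) x" using x unfolding links_def hd by simp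
  then show ?case using IH by simp
qed simp

section \<open>Critical hypergraphs contain a costly configuration\<close>

locale critical_hypergraph =
  fixes F G :: "'a set set" and q :: nat
  assumes finite_edges: "finite F" "finite G"
    and card_F: "e \<in> F \<Longrightarrow> card e = q"
    and q_ge_3: "q \<ge> 3"
    and card_G: "e \<in> G \<Longrightarrow> finite e \<and> card e \<ge> 2"
    and critical: "e \<in> F \<union> G \<Longrightarrow> v \<in> e \<Longrightarrow> \<exists>f\<in>F \<union> G. e \<inter> f = {v}"
    and connected: "V \<noteq> {} \<Longrightarrow> V \<subset> \<Union>(F \<union> G) \<Longrightarrow> \<exists>e\<in>F \<union> G. e \<inter> V \<noteq> {} \<and> \<not> e \<subseteq> V"
    and not_2_colourable: "\<exists>e\<in>F \<union> G. e \<subseteq> B \<or> e \<inter> B = {}"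
begin

lemma finite_F: "e \<in> F \<Longrightarrow> finite e"
  using card_F q_ge_3 by (metis card.infinite not_numeral_le_zero)

lemma finite_edge: "e \<in> F \<union> G \<Longrightarrow> finite e"
  using finite_F card_G by auto

lemma finite_vertices: "finite (\<Union>(F \<union> G))"
  using finite_edges finite_edge by auto

text \<open>Every link adds a vertex because \<open>q\<close> exceeds 1. This bounds the length of
  chains and makes longest chains available.\<close>

lemma linked_card:
  assumes "ps \<in> linked F b X"
    and "\<And>es. es \<in> X \<Longrightarrow> set es \<subseteq> F \<union> G \<and> n \<le> card (\<Union>(set es))"
  shows "set ps \<subseteq> F \<union> G \<and> n + b \<le> card (\<Union>(set ps))"
  using assms(1)
proof (induction b arbitrary: ps)
  case 0
  then show ?case using assms(2) by auto
next
  case (Suc b)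
  then obtain e es where e: "ps = e # es" "es \<in> linked F b X" "links F es e"
    by (auto elim: growE)
  have IH: "set es \<subseteq> F \<union> G" "n + b \<le> card (\<Union>(set es))" using Suc.IH[OF e(2)] by auto
  have fin: "finite (\<Union>(set es))" using IH finite_edge by auto
  have "e \<in> F" and c: "card (e \<inter> \<Union>(set es)) = 1" using e(3) by (auto simp: links_def)
  have "\<not> e \<subseteq> \<Union>(set es)"
  proof
    assume "e \<subseteq> \<Union>(set es)"
    then have "e \<inter> \<Union>(set es) = e" by auto
    then show False using c card_F[OF \<open>e \<in> F\<close>] q_ge_3 by simp
  qed
  then have "\<Union>(set es) \<subset> e \<union> \<Union>(set es)" by auto
  then have "card (\<Union>(set es)) < card (e \<union> \<Union>(set es))"
    using fin finite_F[OF \<open>e \<in> F\<close>] by (intro psubset_card_mono) auto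
  then show ?case using IH \<open>e \<in> F\<close> e(1) by auto
qed

text \<open>
  Grow a longest chain of links out of the explored set. A new vertex of its last edge \<open>g\<close> lies in an
  edge \<open>f\<close> meeting \<open>g\<close> only there; as the chain is longest, \<open>f\<close> also meets the earlier part.
\<close>

lemma leaving_edge_extension:
  assumes es: "es \<in> X" "set es \<subseteq> F \<union> G"
    and e: "e \<in> F \<union> G" "e \<inter> \<Union>(set es) \<noteq> {}" "\<not> e \<subseteq> \<Union>(set es)"
    and M: "card (\<Union>(F \<union> G)) \<le> M"
  shows "extensions q F G M X \<noteq> {}"
proof -
  have "extensions q F G M {es} \<noteq> {}"
  proof (cases "e \<in> G")
    case True
    then have "e # es \<in> ends q F G {es}"
      using e by (intro endsI2) simp_all
    then show ?thesis by (auto simp: extensions_def)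
  next
    case False
    then have eF: "e \<in> F" using e by auto
    have fe: "finite e" by (rule finite_F[OF eF])
    have lt: "card (e \<inter> \<Union>(set es)) < q"
    proof -
      have "e \<inter> \<Union>(set es) \<subset> e" using e by auto
      then show ?thesis using psubset_card_mono[OF fe] card_F[OF eF] by metis
    qed
    have pos: "card (e \<inter> \<Union>(set es)) > 0" using e fe by (simp add: card_gt_0_iff)
    show ?thesis
    proof (cases "card (e \<inter> \<Union>(set es)) = 1")
      case False
      then have "e # es \<in> ends q F G {es}"
        using eF lt pos by (intro endsI1) simp_all
      then show ?thesis by (auto simp: extensions_def)
    next
      case True
      define Y where "Y b = linked F b (grow (meets {1} F) {es})" for b
      have Y_props: "set ps \<subseteq> F \<union> G \<and> b \<le> M" if "ps \<in> Y b" for ps b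
      proof -
        have "set ps \<subseteq> F \<union> G \<and> 0 + b \<le> card (\<Union>(set ps))"
          by (rule linked_card[OF that[unfolded Y_def]])
             (use es(2) in \<open>auto simp: grow_def meets_def\<close>)
        moreover then have "card (\<Union>(set ps)) \<le> card (\<Union>(F \<union> G))"
          using finite_vertices by (intro card_mono) auto
        ultimately show ?thesis using M by auto
      qed
      have "e # es \<in> Y 0"
        using eF True by (simp add: Y_def meets_def growI)
      then have ex: "\<exists>ps. ps \<in> Y 0" by blast
      define b where "b = (GREATEST b. \<exists>ps. ps \<in> Y b)"
      have b1: "\<exists>ps. ps \<in> Y b"
        unfolding b_def using ex by (rule GreatestI_nat) (use Y_props in blast)
      have b2: "Y (Suc b) = {}"
      proof (rule ccontr)
        assume "Y (Suc b) \<noteq> {}"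
        then have "\<exists>ps. ps \<in> Y (Suc b)" by blast
        then have "Suc b \<le> b"
          unfolding b_def by (rule Greatest_le_nat) (use Y_props in blast)
        then show False by simp
      qed
      obtain ps where ps: "ps \<in> Y b" using b1 by blast
      \<comment> \<open>\<open>rs\<close> is the list before \<open>g\<close> was added. As it is
        \<open>es\<close> or a shorter chain, a final step may also be made from
        \<open>rs\<close>.\<close>
      obtain g rs where g: "ps = g # rs" "g \<in> F" "card (g \<inter> \<Union>(set rs)) = 1"
        and rs: "rs = es \<or> (b > 0 \<and> rs \<in> Y (b - 1))"
        using ps by (cases b) (auto simp: Y_def grow_def meets_def links_def)
      have rsH: "set rs \<subseteq> F \<union> G" using Y_props[OF ps] g by auto
      have ends_rs: "ends q F G {rs} \<subseteq> extensions q F G M {es}"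
        using rs
      proof
        assume "b > 0 \<and> rs \<in> Y (b - 1)"
        then have "ends q F G {rs} \<subseteq> ends q F G (Y (b - 1))" "b - 1 \<le> M"
          using Y_props by (auto intro!: ends_mono)
        then show ?thesis unfolding extensions_def Y_def by auto
      qed (auto simp: extensions_def)
      have ends_ps: "ends q F G {ps} \<subseteq> extensions q F G M {es}"
      proof -
        have "ends q F G {ps} \<subseteq> ends q F G (Y b)" "b \<le> M"
          using Y_props ps by (auto intro!: ends_mono)
        then show ?thesis unfolding extensions_def Y_def by auto
      qed
      have fin_rs: "finite (\<Union>(set rs))" using rsH finite_edge by auto
      have "\<not> g \<subseteq> \<Union>(set rs)"
      proof
        assume "g \<subseteq> \<Union>(set rs)"
        then have "g \<inter> \<Union>(set rs) = g" by auto
        then show False using g card_F q_ge_3 by auto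
      qed
      then obtain v where v: "v \<in> g" "v \<notin> \<Union>(set rs)" by auto
      obtain f where f: "f \<in> F \<union> G" "g \<inter> f = {v}" using critical[of g v] g v by auto
      \<comment> \<open>When \<open>f\<close> has too much contact with \<open>rs\<close>, it is
        appended to \<open>rs\<close> without \<open>g\<close>: there \<open>v\<close> is still
        unexplored, so a full \<open>f\<close> overlaps in fewer than \<open>q\<close> vertices and
        a short \<open>f\<close> is not swallowed.\<close>
      define W where "W = f \<inter> \<Union>(set rs)"
      have finW: "finite W" using fin_rs by (simp add: W_def)
      have fps: "f \<inter> \<Union>(set ps) = insert v W" using f g by (auto simp: W_def)
      have vW: "v \<notin> W" using v by (simp add: W_def)
      have vf: "v \<in> f" using f by auto
      show ?thesis
      proof (cases "f \<in> G")
        case True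
        show ?thesis
        proof (cases "W = {}")
          case True
          have "\<not> f \<subseteq> {v}"
          proof
            assume "f \<subseteq> {v}"
            then have "card f \<le> 1" using card_mono[of "{v}" f] by simp
            then show False using card_G[OF \<open>f \<in> G\<close>] by auto
          qed
          then have "f # ps \<in> ends q F G {ps}"
            using fps \<open>f \<in> G\<close> True by (intro endsI2) (simp, simp, simp, use fps in blast)
          then show ?thesis using ends_ps by blast
        next
          case False
          then have "f # rs \<in> ends q F G {rs}"
            using \<open>f \<in> G\<close> v vf W_def by (intro endsI2) blast+
          then show ?thesis using ends_rs by blast
        qed
      next
        case False
        then have fF: "f \<in> F" using f by auto
        have Wlt: "card W < q"
        proof -
          have "W \<subset> f" using vW vf by (auto simp: W_def)
          then show ?thesis using psubset_card_mono[OF finite_F[OF fF]] card_F[OF fF] by metis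
        qed
        consider "card W = 0" | "card W = 1" | "card W \<ge> 2" by linarith
        then show ?thesis
        proof cases
          case 1
          then have "W = {}" using finW by simp
          then have "f # ps \<in> Y (Suc b)"
            using fps fF f g growI[OF ps, of "links F" f] by (simp add: Y_def links_def Int_commute)
          then show ?thesis using b2 by auto
        next
          case 2
          then have "card (insert v W) = 2" using finW vW by simp
          then have "f # ps \<in> ends q F G {ps}"
            using fps fF q_ge_3 by (intro endsI1) simp_all
          then show ?thesis using ends_ps by blast
        next
          case 3
          then have "f # rs \<in> ends q F G {rs}"
            using fF Wlt unfolding W_def by (intro endsI1) simp_all
          then show ?thesis using ends_rs by blast
        qed
      qed
    qed
  qed
  moreover have "extensions q F G M {es} \<subseteq> extensions q F G M X"
    using es by (intro extensions_mono) auto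
  ultimately show ?thesis by blast
qed

lemma spanning_or_extension:
  assumes es: "es \<in> X" "set es \<subseteq> F \<union> G" "\<Union>(set es) \<noteq> {}"
    and M: "card (\<Union>(F \<union> G)) \<le> M"
    and "extensions q F G M X = {}"
  shows "\<Union>(set es) = \<Union>(F \<union> G)"
proof (rule ccontr)
  assume "\<Union>(set es) \<noteq> \<Union>(F \<union> G)"
  then have "\<Union>(set es) \<subset> \<Union>(F \<union> G)" using es by auto
  then obtain e where "e \<in> F \<union> G" "e \<inter> \<Union>(set es) \<noteq> {}" "\<not> e \<subseteq> \<Union>(set es)"
    using connected[OF es(3)] by metis
  then show False using leaving_edge_extension[OF es(1,2) _ _ _ M] assms(5) by blast
qed

text \<open>A short edge is an admissible start, and criticality yields an edge sharing just one
  vertex with it, which therefore leaves it.\<close>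

lemma short_edge_configuration:
  assumes "G \<noteq> {}" and M: "card (\<Union>(F \<union> G)) \<le> M"
  shows "configurations q F G M \<noteq> {}"
proof -
  obtain e where e: "e \<in> G" using assms by auto
  obtain z where z: "z \<in> e" using card_G[OF e] by fastforce
  obtain f where f: "f \<in> F \<union> G" "e \<inter> f = {z}" using critical e z by blast
  have "card f \<ge> 2" using f card_F card_G q_ge_3 by auto
  have "\<not> f \<subseteq> e"
  proof
    assume "f \<subseteq> e"
    then have "f = {z}" using f by auto
    then show False using \<open>card f \<ge> 2\<close> by simp
  qed
  then have "extensions q F G M (singles G) \<noteq> {}"
    using e f by (intro leaving_edge_extension[of "[e]" _ f, OF _ _ f(1) _ _ M]) (auto simp: singles_def)
  then show ?thesis by (auto simp: configurations_def)
qed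

lemma link_list_card:
  assumes "link_list F xs [e]" "e \<in> F"
  shows "card (\<Union>(set (xs @ [e]))) = q + length xs * (q - 1) \<and> finite (\<Union>(set (xs @ [e])))"
  using assms(1)
proof (induction xs)
  case Nil
  then show ?case using card_F finite_F assms(2) by simp
next
  case (Cons x xs)
  then have IH: "card (\<Union>(set (xs @ [e]))) = q + length xs * (q - 1)" "finite (\<Union>(set (xs @ [e])))"
    and x: "x \<in> F" "card (x \<inter> \<Union>(set (xs @ [e]))) = 1" by (auto simp: links_def)
  have "card x + card (\<Union>(set (xs @ [e]))) = card (x \<union> \<Union>(set (xs @ [e]))) + 1"
    using card_Un_Int[OF finite_F[OF x(1)] IH(2)] x(2) by simp
  then have "card (x \<union> \<Union>(set (xs @ [e]))) = q + Suc (length xs) * (q - 1)"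
    using IH card_F[OF x(1)] q_ge_3 by simp
  moreover have "\<Union>(set ((x # xs) @ [e])) = x \<union> \<Union>(set (xs @ [e]))" by simp
  ultimately show ?case using IH finite_F[OF x(1)] by simp
qed

text \<open>If a cycle missed a vertex, connectedness would provide an edge leaving it, and with it
  an extension.\<close>

lemma
  assumes G: "G = {}" and M: "card (\<Union>F) \<le> M" and none: "configurations q F G M = {}"
  shows cycle_spans: "\<And>es a. es \<in> cycles F a \<Longrightarrow> a \<le> M \<Longrightarrow> \<Union>(set es) = \<Union>F"
    and no_spoiled: "\<And>es a. es \<in> spoiled_cycles q F a \<Longrightarrow> a \<le> M \<Longrightarrow> False"
proof -
  show False if "es \<in> spoiled_cycles q F a" "a \<le> M" for es a
    using none that by (auto simp: configurations_def)
  show "\<Union>(set es) = \<Union>F" if es: "es \<in> cycles F a" "a \<le> M" for es a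
  proof -
    obtain f rs where f: "es = f # rs" "f \<in> F" "rs \<in> linked F a (singles F)"
      using es(1) unfolding cycles_def by (auto elim!: growE simp: meets_def)
    have "set rs \<subseteq> F \<union> G \<and> 0 + a \<le> card (\<Union>(set rs))"
      using f(3) by (rule linked_card) (auto simp: singles_def)
    then have "set es \<subseteq> F \<union> G" using f by auto
    moreover have "f \<noteq> {}" using card_F[OF f(2)] q_ge_3 by auto
    then have "\<Union>(set es) \<noteq> {}" using f by auto
    moreover have "extensions q F G M (cycles F a) = {}"
      using none es(2) by (auto simp: configurations_def)
    ultimately have "\<Union>(set es) = \<Union>(F \<union> G)"
      using es(1) M G by (intro spanning_or_extension) auto
    then show ?thesis using G by simp
  qed
qed

text \<open>
  Take a longest path and two new vertices \<open>v\<close>, \<open>w\<close> of its last edge \<open>g\<close>, and let \<open>f\<close>, \<open>h\<close> be edges meeting \<open>g\<close>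
  only in \<open>v\<close> and \<open>w\<close>. Both close a cycle with a final segment of the path, and each of these cycles must
  cover all vertices. Counting vertices leaves only a hypergraph with \<open>q = 3\<close> on six vertices in which
  two edges share at most one vertex and which contains the Pasch configuration
  \<open>{v, u, t}\<close>, \<open>{w, x, t}\<close>, \<open>{v, w, y}\<close>, \<open>{u, x, y}\<close>; colouring \<open>{t, y}\<close> against the rest then works.
\<close>

lemma full_configuration:
  assumes G: "G = {}" and M: "card (\<Union>F) \<le> M"
  shows "configurations q F G M \<noteq> {}"
proof
  assume none: "configurations q F G M = {}"
  note spans = cycle_spans[OF G M none] and no_spoiled = no_spoiled[OF G M none]
  define Y where "Y b = linked F b (singles F)" for b
  have finV: "finite (\<Union>F)" using finite_vertices G by simp
  have Y_props: "set ps \<subseteq> F \<and> b \<le> M" if "ps \<in> Y b" for ps b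
  proof -
    have "set ps \<subseteq> F \<union> G \<and> 0 + b \<le> card (\<Union>(set ps))"
      by (rule linked_card[OF that[unfolded Y_def]]) (auto simp: singles_def)
    moreover then have "card (\<Union>(set ps)) \<le> card (\<Union>F)"
      using G by (intro card_mono finV) auto
    ultimately show ?thesis using M G by auto
  qed
  obtain e0 where "e0 \<in> F" using not_2_colourable G by auto
  then have ex: "\<exists>ps. ps \<in> Y 0" by (auto simp: Y_def singles_def)
  define b where "b = (GREATEST b. \<exists>ps. ps \<in> Y b)"
  have b1: "\<exists>ps. ps \<in> Y b"
    unfolding b_def using ex by (rule GreatestI_nat) (use Y_props in blast)
  have b2: "Y (Suc b) = {}"
  proof (rule ccontr)
    assume "Y (Suc b) \<noteq> {}"
    then have "\<exists>ps. ps \<in> Y (Suc b)" by blast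
    then have "Suc b \<le> b"
      unfolding b_def by (rule Greatest_le_nat) (use Y_props in blast)
    then show False by simp
  qed
  obtain ps where ps: "ps \<in> Y b" using b1 by blast
  obtain ts e1 where ts: "ps = ts @ [e1]" "link_list F ts [e1]" "length ts = b"
    using ps unfolding Y_def by (auto elim!: linkedE simp: singles_def)
  have "ps \<noteq> []" using ts(1) by simp
  then obtain g rs where g: "ps = g # rs" by (meson neq_Nil_conv)
  have gF: "g \<in> F" and rsF: "set rs \<subseteq> F" using Y_props[OF ps] g by auto
  have card_g: "card (g \<inter> \<Union>(set rs)) \<le> 1"
  proof (cases ts)
    case (Cons t us)
    then show ?thesis using ts g by (auto simp: links_def)
  qed (use ts g in simp)

  have meets_earlier: "f \<inter> \<Union>(set rs) \<noteq> {}"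
    if f: "f \<in> F" "g \<inter> f = {v}" and v: "v \<notin> \<Union>(set rs)" for f v
  proof
    assume "f \<inter> \<Union>(set rs) = {}"
    then have "f \<inter> \<Union>(set ps) = {v}" using f g by auto
    moreover have "f \<inter> hd ps \<noteq> {}" using f g by auto
    ultimately have "f # ps \<in> Y (Suc b)"
      using f growI[OF ps, of "links F" f] by (simp add: links_def Y_def)
    then show False using b2 by simp
  qed

  \<comment> \<open>\<open>e\<close> is the newest edge of the path before \<open>g\<close> that
    \<open>f\<close> meets. With the segment from \<open>e\<close> to \<open>g\<close> the edge
    \<open>f\<close> closes a cycle, which must span.\<close>
  have split: "\<exists>xs e ys. rs = xs @ e # ys \<and> e \<in> F \<and> Suc (length xs) \<le> M \<and>
      card (\<Union>(set (g # xs @ [e]))) = q + Suc (length xs) * (q - 1) \<and>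
      finite (\<Union>(set (g # xs @ [e]))) \<and>
      (\<exists>u\<in>e. u \<noteq> v \<and> f \<inter> \<Union>(set (g # xs @ [e])) = {v, u}) \<and>
      \<Union>F = \<Union>(set (f # g # xs @ [e])) \<and> card (g \<inter> \<Union>(set (xs @ [e]))) = 1"
    if f: "f \<in> F" "g \<inter> f = {v}" and v: "v \<notin> \<Union>(set rs)" for f v
  proof -
    have "\<exists>x\<in>set rs. f \<inter> x \<noteq> {}" using meets_earlier[OF that] by auto
    from split_list_first_prop[OF this]
    obtain xs e ys where "rs = xs @ e # ys \<and> f \<inter> e \<noteq> {} \<and> (\<forall>x\<in>set xs. \<not> f \<inter> x \<noteq> {})"
      by (elim exE)
    then have xs: "rs = xs @ e # ys" "f \<inter> e \<noteq> {}" "\<forall>x\<in>set xs. f \<inter> x = {}" by simp_all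
    have eF: "e \<in> F" using rsF xs by auto
    have len: "Suc (length xs) \<le> b"
    proof -
      have "length ps = Suc b" using ts by simp
      then show ?thesis using g xs by simp
    qed
    then have lenM: "Suc (length xs) \<le> M" using Y_props[OF ps] by simp
    have "link_list F (g # xs) (e # ys)"
    proof (cases ys rule: rev_cases)
      case Nil
      then have "ts = g # xs" "e1 = e" using ts(1) g xs by auto
      then show ?thesis using ts(2) Nil by simp
    next
      case (snoc zs z)
      then have "ts = (g # xs) @ e # zs" "e1 = z" using ts(1) g xs by auto
      then show ?thesis using ts(2) snoc link_list_append[of F "g # xs" "e # zs" "[z]"] by simp
    qed
    then have gl: "link_list F (g # xs) [e]" by (rule link_list_restrict) simp
    \<comment> \<open>The cycle read from its other end: with base \<open>[e, f]\<close> the closing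
      edge is \<open>g\<close>. If \<open>e\<close> and \<open>f\<close> shared two vertices, this
      would be a spoiled cycle.\<close>
    have "link_list F xs (e # [f])"
      by (rule link_list_restrict[of F xs e "[]"]) (use gl xs(3) in auto)
    have vf: "v \<in> f" "v \<in> g" using f by auto
    have vX: "v \<notin> \<Union>(set (xs @ [e]))" using v xs(1) by auto
    have "card (f \<inter> e) < q"
    proof -
      have "f \<inter> e \<subset> f" using vf vX by auto
      then show ?thesis using psubset_card_mono[OF finite_F[OF f(1)]] card_F[OF f(1)] by metis
    qed
    have "card (g \<inter> \<Union>(set (xs @ [e]))) = 1" using gl by (simp add: links_def)
    then obtain y where y: "g \<inter> \<Union>(set (xs @ [e])) = {y}" by (rule card_1_singletonE)
    have one: "card (f \<inter> e) = 1"
    proof (rule ccontr)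
      assume "card (f \<inter> e) \<noteq> 1"
      moreover have "card (f \<inter> e) \<noteq> 0" using xs(2) finite_F[OF f(1)] by simp
      ultimately have "[e, f] \<in> grow (meets {2..<q} F) (singles F)"
        using \<open>card (f \<inter> e) < q\<close> eF f(1)
        by (intro growI) (auto simp: meets_def singles_def Int_commute)
      then have "xs @ [e, f] \<in> linked F (length xs) (grow (meets {2..<q} F) (singles F))"
        using \<open>link_list F xs (e # [f])\<close> by (intro linkedI) auto
      moreover have "g \<inter> \<Union>(set (xs @ [e, f])) = {y, v}" "y \<noteq> v" using y f vX by auto
      then have "meets {2} F (xs @ [e, f]) g" using gF by (simp add: meets_def)
      ultimately have "g # xs @ [e, f] \<in> spoiled_cycles q F (length xs)"
        unfolding spoiled_cycles_def by (rule growI)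
      then show False using no_spoiled lenM by fastforce
    qed
    then obtain u where u: "f \<inter> e = {u}" by (rule card_1_singletonE)
    then have uv: "u \<in> e" "u \<noteq> v" using vX by auto
    have fU: "f \<inter> \<Union>(set (g # xs @ [e])) = {v, u}"
    proof -
      have "f \<inter> \<Union>(set xs) = {}" using xs(3) by auto
      then show ?thesis using u f(2) by auto
    qed
    have "(g # xs) @ [e] \<in> linked F (length (g # xs)) (singles F)"
      using gl eF by (intro linkedI) (auto simp: singles_def)
    moreover have "meets {2} F ((g # xs) @ [e]) f" using fU uv f(1) by (simp add: meets_def)
    ultimately have "f # (g # xs) @ [e] \<in> cycles F (length (g # xs))"
      unfolding cycles_def by (rule growI)
    then have "\<Union>(set (f # (g # xs) @ [e])) = \<Union>F" by (rule spans) (simp add: lenM)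
    then have "\<Union>F = \<Union>(set (f # g # xs @ [e]))" by (simp only: append_Cons)
    moreover have "card (g \<inter> \<Union>(set (xs @ [e]))) = 1" using y by simp
    moreover have "card (\<Union>(set (g # xs @ [e]))) = q + Suc (length xs) * (q - 1)"
        "finite (\<Union>(set (g # xs @ [e])))"
      using link_list_card[OF gl eF] by simp_all
    moreover have "\<exists>u\<in>e. u \<noteq> v \<and> f \<inter> \<Union>(set (g # xs @ [e])) = {v, u}" using uv fU by blast
    ultimately show ?thesis using xs(1) eF lenM by blast
  qed

  have card_add: "card (\<Union>F) = card U + (q - 2) \<and> card (\<Union>F - U) = q - 2"
    if "f \<in> F" "f \<inter> U = {v, u}" "v \<noteq> u" "\<Union>F = f \<union> U" "finite U" for f U and v u
  proof -
    have "card f + card U = card (f \<union> U) + 2"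
      using card_Un_Int[OF finite_F[OF that(1)] that(5)] that(2,3) by simp
    moreover have "card (\<Union>F - U) = card (\<Union>F) - card U"
      using that by (intro card_Diff_subset) auto
    ultimately show ?thesis
      unfolding that(4) using card_F[OF that(1)] q_ge_3 by (intro conjI; arith)
  qed

  have "card (g - \<Union>(set rs)) \<ge> 2"
  proof -
    have "card (g - \<Union>(set rs)) = card g - card (g \<inter> \<Union>(set rs))"
      by (rule card_Diff_subset_Int) (simp add: finite_F[OF gF])
    then show ?thesis using card_g card_F[OF gF] q_ge_3 by simp
  qed
  then obtain v w where vw: "v \<in> g - \<Union>(set rs)" "w \<in> g - \<Union>(set rs)" "v \<noteq> w"
    by (elim obtain_subset_with_card_n) (auto simp: card_2_iff)
  obtain f where f: "f \<in> F" "g \<inter> f = {v}" using critical[of g v] gF vw G by auto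
  obtain h where h: "h \<in> F" "g \<inter> h = {w}" using critical[of g w] gF vw G by auto
  have vn: "v \<notin> \<Union>(set rs)" and wn: "w \<notin> \<Union>(set rs)" using vw by auto
  obtain xs e ys u where f_split: "rs = xs @ e # ys" "e \<in> F" "Suc (length xs) \<le> M"
    "card (\<Union>(set (g # xs @ [e]))) = q + Suc (length xs) * (q - 1)"
    "finite (\<Union>(set (g # xs @ [e])))" "u \<in> e" "u \<noteq> v"
    "f \<inter> \<Union>(set (g # xs @ [e])) = {v, u}" "\<Union>F = \<Union>(set (f # g # xs @ [e]))"
    "card (g \<inter> \<Union>(set (xs @ [e]))) = 1"
    using split[OF f vn] by blast
  obtain xs' e' ys' x where h_split: "rs = xs' @ e' # ys'"
    "card (\<Union>(set (g # xs' @ [e']))) = q + Suc (length xs') * (q - 1)"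
    "finite (\<Union>(set (g # xs' @ [e'])))" "x \<in> e'" "x \<noteq> w"
    "h \<inter> \<Union>(set (g # xs' @ [e'])) = {w, x}" "\<Union>F = \<Union>(set (h # g # xs' @ [e']))"
    using split[OF h wn] by blast
  define U where "U = \<Union>(set (g # xs @ [e]))"
  have cF: "card (\<Union>F) = card U + (q - 2)" "card (\<Union>F - U) = q - 2"
    using card_add[OF f(1) f_split(8)] f_split by (auto simp: U_def)
  have "card (\<Union>F) = card (\<Union>(set (g # xs' @ [e']))) + (q - 2)"
    using card_add[OF h(1) h_split(6)] h_split by auto
  \<comment> \<open>Both cycles cover all vertices, and each closing edge adds \<open>q - 2\<close>
    vertices to its segment. So the segments have equal length and, being taken from the same path,
    coincide.\<close>
  then have "Suc (length xs) * (q - 1) = Suc (length xs') * (q - 1)"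
    using cF(1) f_split(4) h_split(2) by (simp only: U_def)
  moreover have "q - 1 \<noteq> 0" using q_ge_3 by simp
  ultimately have "Suc (length xs) = Suc (length xs')" by (simp only: mult_cancel2 simp_thms)
  then have "length xs = length xs'" by simp
  then have eqs: "xs' = xs" "e' = e" using f_split(1) h_split(1) by auto
  have fU: "f \<inter> U = {v, u}" and hU: "h \<inter> U = {w, x}" and xe: "x \<in> e"
    and FU: "\<Union>F = f \<union> U" "\<Union>F = h \<union> U" and gU: "g \<subseteq> U" and eU: "e \<subseteq> U"
    using f_split h_split eqs by (auto simp: U_def)
  have fh_neq: "w \<notin> f" "v \<notin> h" using f h vw by auto
  have M0: "1 \<le> M" using f_split(3) by simp
  have gfh: "g \<inter> \<Union>(set [h, f]) = {w, v}" using f h by auto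
  \<comment> \<open>Otherwise \<open>f\<close> and \<open>h\<close> start a spoiled cycle that
    \<open>g\<close> closes through \<open>v\<close> and \<open>w\<close>.\<close>
  have le1: "card (f \<inter> h) \<le> 1"
  proof (rule ccontr)
    assume "\<not> card (f \<inter> h) \<le> 1"
    moreover have "card (f \<inter> h) < q"
    proof -
      have "f \<inter> h \<subset> f" using fh_neq f by auto
      then show ?thesis using psubset_card_mono[OF finite_F[OF f(1)]] card_F[OF f(1)] by metis
    qed
    ultimately have "[h, f] \<in> linked F 0 (grow (meets {2..<q} F) (singles F))"
      unfolding linked_0 using f(1) h(1)
      by (intro growI) (auto simp: meets_def singles_def Int_commute)
    moreover have "meets {2} F [h, f] g" using gfh vw(3) gF by (simp add: meets_def)
    ultimately have "[g, h, f] \<in> spoiled_cycles q F 0" unfolding spoiled_cycles_def by (rule growI)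
    then show False using no_spoiled by blast
  qed
  \<comment> \<open>The \<open>q - 2\<close> vertices missing from \<open>U\<close> belong to
    \<open>f\<close> as well as to \<open>h\<close>, which share at most one; this forces
    \<open>q = 3\<close>.\<close>
  have sub: "\<Union>F - U \<subseteq> f \<inter> h" using FU by blast
  then have "card (\<Union>F - U) \<le> card (f \<inter> h)" using finite_F[OF f(1)] by (intro card_mono) auto
  then have q3: "q = 3" using cF(2) le1 q_ge_3 by simp
  then obtain t where t: "\<Union>F - U = {t}" using cF(2) card_1_singletonE[of "\<Union>F - U"] by auto
  then have "t \<in> f \<inter> h" using sub by auto
  then have fh: "f \<inter> h = {t}"
    using le1 finite_F[OF f(1)] by (metis card_1_singletonE card_0_eq empty_iff finite_Int le_neq_implies_less less_one singletonD)
  have "f - U = \<Union>F - U" unfolding FU(1) by blast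
  then have "f = {v, u} \<union> {t}" using fU t Int_Diff_Un[of f U] by simp
  then have feq: "f = {v, u, t}" by auto
  have "h - U = \<Union>F - U" unfolding FU(2) by blast
  then have "h = {w, x} \<union> {t}" using hU t Int_Diff_Un[of h U] by simp
  then have heq: "h = {w, x, t}" by auto
  have tU: "t \<notin> U" using t by auto
  \<comment> \<open>\<open>f\<close>, \<open>h\<close>, \<open>g\<close> form a triangle. It is a
    cycle as well, so it spans, and it has only six vertices.\<close>
  have "[h, f] \<in> linked F 1 (singles F)"
    using fh f(1) h(1) by (auto simp: links_def singles_def Int_commute intro!: growI)
  moreover have "meets {2} F [h, f] g" using gfh vw(3) gF by (simp add: meets_def)
  ultimately have "[g, h, f] \<in> cycles F 1" unfolding cycles_def by (rule growI)
  then have span3: "\<Union>F = g \<union> (h \<union> f)" using spans[OF _ M0] by fastforce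
  have c6: "card (\<Union>F) = 6"
  proof -
    have "card h + card f = card (h \<union> f) + 1"
      using card_Un_Int[OF finite_F[OF h(1)] finite_F[OF f(1)]] fh by (simp add: Int_commute)
    moreover have "card g + card (h \<union> f) = card (g \<union> (h \<union> f)) + 2"
      using card_Un_Int[OF finite_F[OF gF], of "h \<union> f"] finite_F[OF h(1)] finite_F[OF f(1)] gfh vw(3)
      by simp
    ultimately show ?thesis using card_F f(1) h(1) gF q3 span3 by simp
  qed
  \<comment> \<open>A segment with \<open>xs\<close> between \<open>g\<close> and \<open>e\<close>
    closes to a cycle on 6 + 2 * \<open>length xs\<close> vertices.\<close>
  then have "xs = []" using cF(1) f_split(4) q3 by (simp add: U_def)
  then have Ueq: "U = g \<union> e" by (simp add: U_def)
  have "card (g \<inter> e) = 1" using f_split(10) \<open>xs = []\<close> by simp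
  then obtain y where y: "g \<inter> e = {y}" by (rule card_1_singletonE)
  have "v \<notin> e" "w \<notin> e" using vn wn f_split(1) by auto
  then have yvw: "y \<noteq> v" "y \<noteq> w" using y by auto
  have geq: "g = {v, w, y}"
    using card_F[OF gF] q3 yvw vw y by (intro card_seteq[symmetric] finite_F[OF gF]) auto
  have ufU: "u \<in> f \<inter> U" and xhU: "x \<in> h \<inter> U" using fU hU by simp_all
  have "u \<noteq> x"
  proof
    assume "u = x"
    then have "u \<in> f \<inter> h" using ufU xhU by simp
    then show False using fh ufU tU by simp
  qed
  have "y \<in> g" using y by blast
  have "u \<noteq> y"
  proof
    assume "u = y"
    then have "y \<in> g \<inter> f" using ufU \<open>y \<in> g\<close> by simp
    then show False using f(2) yvw by simp
  qed
  have "x \<noteq> y"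
  proof
    assume "x = y"
    then have "y \<in> g \<inter> h" using xhU \<open>y \<in> g\<close> by simp
    then show False using h(2) yvw by simp
  qed
  have "y \<in> e" using y by blast
  have eeq: "e = {u, x, y}"
    using card_F[OF f_split(2)] q3 \<open>u \<noteq> x\<close> \<open>u \<noteq> y\<close> \<open>x \<noteq> y\<close> \<open>y \<in> e\<close> xe f_split(6)
    by (intro card_seteq[symmetric] finite_F[OF f_split(2)]) simp_all
  \<comment> \<open>Two edges with two common vertices are the shortest cycle and would have to
    span, but they have only four vertices.\<close>
  have linear: "card (k \<inter> l) \<le> 1" if kl: "k \<in> F" "l \<in> F" "k \<noteq> l" for k l
  proof (rule ccontr)
    assume "\<not> card (k \<inter> l) \<le> 1"
    moreover have "card (k \<inter> l) < 3"
    proof -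
      have "\<not> k \<subseteq> l"
        using kl card_F q3 card_subset_eq[OF finite_F[OF kl(2)], of k] by auto
      then have "k \<inter> l \<subset> k" by auto
      then show ?thesis using psubset_card_mono[OF finite_F[OF kl(1)]] card_F[OF kl(1)] q3 by metis
    qed
    ultimately have c2: "card (k \<inter> l) = 2" by simp
    have "[k, l] \<in> cycles F 0"
      unfolding cycles_def linked_0 using c2 kl by (intro growI) (auto simp: meets_def singles_def)
    then have "\<Union>F = k \<union> l" using spans by fastforce
    moreover have "card k + card l = card (k \<union> l) + 2"
      using card_Un_Int[OF finite_F[OF kl(1)] finite_F[OF kl(2)]] c2 by simp
    ultimately show False using c6 card_F kl q3 by simp
  qed
  obtain k where k: "k \<in> F" "k \<subseteq> {t, y} \<or> k \<inter> {t, y} = {}"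
    using not_2_colourable[of "{t, y}"] unfolding G Un_empty_right by blast
  have "card k = 3" using card_F k q3 by simp
  have "\<not> k \<subseteq> {t, y}"
  proof
    assume "k \<subseteq> {t, y}"
    then have "card k \<le> card {t, y}" by (intro card_mono) auto
    also have "\<dots> \<le> 2" by (simp add: card_insert_if)
    finally show False using \<open>card k = 3\<close> by simp
  qed
  then have kk: "k \<inter> {t, y} = {}" using k by auto
  have "k \<subseteq> \<Union>F" using k by auto
  then have ksub: "k \<subseteq> {u, v, w, x}" using kk span3 feq heq geq by auto
  have no_pair: "\<not> (a \<in> k \<and> b \<in> k)" if "a \<in> l" "b \<in> l" "a \<noteq> b" "l \<in> F" "k \<noteq> l" for a b l
  proof
    assume "a \<in> k \<and> b \<in> k"
    then have "card {a, b} \<le> card (k \<inter> l)"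
      using that finite_F[OF k(1)] by (intro card_mono) auto
    then show False using linear[OF k(1) that(4,5)] that(3) by simp
  qed
  \<comment> \<open>Each consecutive pair in the cyclic order \<open>u\<close>, \<open>v\<close>,
    \<open>w\<close>, \<open>x\<close> lies in one of \<open>f\<close>, \<open>g\<close>,
    \<open>h\<close>, \<open>e\<close>, so \<open>k\<close> can contain only an opposite
    pair.\<close>
  have "k \<noteq> f" "k \<noteq> h" "k \<noteq> e" "k \<noteq> g" using kk feq heq eeq geq by auto
  then have "\<not> (u \<in> k \<and> v \<in> k)" "\<not> (v \<in> k \<and> w \<in> k)" "\<not> (w \<in> k \<and> x \<in> k)" "\<not> (u \<in> k \<and> x \<in> k)"
    using no_pair[of u f v] no_pair[of v g w] no_pair[of w h x] no_pair[of u e x]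
      f(1) h(1) gF f_split(2,7) h_split(5) vw(3) \<open>u \<noteq> x\<close> feq heq eeq geq by auto
  then have "k \<subseteq> {u, w} \<or> k \<subseteq> {v, x}" using ksub by blast
  then have "card k \<le> 2"
  proof
    assume "k \<subseteq> {u, w}"
    then have "card k \<le> card {u, w}" by (intro card_mono) auto
    also have "\<dots> \<le> 2" by (simp add: card_insert_if)
    finally show ?thesis .
  next
    assume "k \<subseteq> {v, x}"
    then have "card k \<le> card {v, x}" by (intro card_mono) auto
    also have "\<dots> \<le> 2" by (simp add: card_insert_if)
    finally show ?thesis .
  qed
  then show False using \<open>card k = 3\<close> by simp
qed

theorem configuration_exists:
  assumes "card (\<Union>(F \<union> G)) \<le> M"
  shows "configurations q F G M \<noteq> {}"
  using short_edge_configuration[OF _ assms] full_configuration[of M] assms by (cases "G = {}") auto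

end

section \<open>Passing to a minimal hypergraph that is not 2-colourable\<close>

lemma configurations_mono:
  assumes "F \<subseteq> F'" "G \<subseteq> G'"
  shows "configurations q F G M \<subseteq> configurations q F' G' M"
proof -
  have ends: "ends q F G X \<subseteq> ends q F' G' Y" if "X \<subseteq> Y" for X Y
    unfolding ends_def using assms that
    by (intro Un_mono grow_mono) (auto simp: meets_def touches_def)
  have meets: "grow (meets I F) X \<subseteq> grow (meets I F') Y" if "X \<subseteq> Y" for I X Y
    using assms that by (intro grow_mono) (auto simp: meets_def)
  have singles: "singles F \<subseteq> singles F'" "singles G \<subseteq> singles G'"
    using assms by (auto simp: singles_def)
  have ext: "extensions q F G M X \<subseteq> extensions q F' G' M Y" if "X \<subseteq> Y" for X Y
    unfolding extensions_def using assms that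
    by (intro Un_mono UN_mono order_refl ends meets linked_mono)
  show ?thesis
    unfolding configurations_def spoiled_cycles_def cycles_def using assms
    by (intro Un_mono UN_mono order_refl ext meets linked_mono singles)
qed

lemma configuration_if_not_2_colourable:
  assumes fin: "finite F" "finite G"
    and card_F: "\<And>e. e \<in> F \<Longrightarrow> card e = q" and q: "q \<ge> 3"
    and card_G: "\<And>e. e \<in> G \<Longrightarrow> finite e \<and> card e \<ge> 2"
    and not_col: "\<And>B. \<exists>e\<in>F \<union> G. e \<subseteq> B \<or> e \<inter> B = {}"
    and M: "card (\<Union>(F \<union> G)) \<le> M"
  shows "configurations q F G M \<noteq> {}"
proof -
  define bad where "bad H \<longleftrightarrow> (\<forall>B. \<exists>e\<in>H. e \<subseteq> B \<or> e \<inter> B = {})" for H :: "'a set set"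
  have fe: "finite e" if "e \<in> F \<union> G" for e
    using that card_F card_G q by (metis UnE card.infinite not_numeral_le_zero)
  have card2: "card e \<ge> 2" if "e \<in> F \<union> G" for e
    using that card_F card_G q by fastforce
  have "\<exists>H\<in>{H. H \<subseteq> F \<union> G \<and> bad H}. \<forall>H'\<in>{H. H \<subseteq> F \<union> G \<and> bad H}. H' \<le> H \<longrightarrow> H = H'"
    by (rule finite_has_minimal) (use fin not_col in \<open>auto simp: bad_def\<close>)
  then obtain H where H: "H \<subseteq> F \<union> G" "bad H"
    and minimal: "\<And>H'. H' \<subset> H \<Longrightarrow> \<not> bad H'" by (auto simp: psubset_eq) (metis order_trans)
  have H_eq: "F \<inter> H \<union> G \<inter> H = H" using H(1) by auto
  interpret critical_hypergraph "F \<inter> H" "G \<inter> H" q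
  proof (unfold_locales, unfold H_eq)
    show "finite (F \<inter> H)" "finite (G \<inter> H)" using fin by auto
    show "card e = q" if "e \<in> F \<inter> H" for e using that card_F by auto
    show "3 \<le> q" by fact
    show "finite e \<and> 2 \<le> card e" if "e \<in> G \<inter> H" for e using that card_G by auto
    show "\<exists>e\<in>H. e \<subseteq> B \<or> e \<inter> B = {}" for B using H(2) by (auto simp: bad_def)
    show "\<exists>f\<in>H. e \<inter> f = {v}" if e: "e \<in> H" "v \<in> e" for e v
    proof -
      obtain B where B: "\<And>f. f \<in> H - {e} \<Longrightarrow> \<not> f \<subseteq> B \<and> f \<inter> B \<noteq> {}"
        using minimal[of "H - {e}"] e by (auto simp: bad_def)
      have ne: "e \<noteq> {v}" using card2[of e] e H(1) by auto
      \<comment> \<open>Colour \<open>H - {e}\<close> properly; then \<open>e\<close> is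
        monochromatic, say inside \<open>B\<close>. Moving \<open>v\<close> out of \<open>B\<close>
        repairs \<open>e\<close>, so it must spoil another edge, and that edge meets
        \<open>B\<close> in \<open>v\<close> only.\<close>
      have main: "\<exists>f\<in>H. e \<inter> f = {v}"
        if B: "\<And>f. f \<in> H - {e} \<Longrightarrow> \<not> f \<subseteq> B \<and> f \<inter> B \<noteq> {}" and "e \<subseteq> B" for B
      proof -
        obtain f where f: "f \<in> H" "f \<subseteq> B - {v} \<or> f \<inter> (B - {v}) = {}"
          using H(2) unfolding bad_def by metis
        have "f \<noteq> e" using f(2) e ne \<open>e \<subseteq> B\<close> by blast
        then have "\<not> f \<subseteq> B" "f \<inter> B \<noteq> {}" using B[of f] f by auto
        then have "f \<inter> B = {v}" using f(2) by blast
        then have "e \<inter> f = {v}" using e \<open>e \<subseteq> B\<close> by blast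
        then show ?thesis using f by blast
      qed
      obtain f where "f \<in> H" "f \<subseteq> B \<or> f \<inter> B = {}" using H(2) unfolding bad_def by metis
      then have "e \<subseteq> B \<or> e \<inter> B = {}" using B[of f] by auto
      then show ?thesis
      proof
        assume "e \<inter> B = {}"
        then show ?thesis using B by (intro main[of "- B"]) auto
      qed (use main B in blast)
    qed
    show "\<exists>e\<in>H. e \<inter> V \<noteq> {} \<and> \<not> e \<subseteq> V" if V: "V \<noteq> {}" "V \<subset> \<Union>H" for V
    proof (rule ccontr)
      assume "\<not> ?thesis"
      \<comment> \<open>If no edge crosses \<open>V\<close>, proper colourings of the edges inside
        and outside \<open>V\<close> exist by minimality and can be glued.\<close>
      then have split: "\<And>e. e \<in> H \<Longrightarrow> e \<inter> V = {} \<or> e \<subseteq> V" by auto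
      obtain v w where vw: "v \<in> V" "w \<in> \<Union>H" "w \<notin> V" using V by blast
      obtain e where e: "e \<in> H" "v \<in> e" using vw V by auto
      obtain g where g: "g \<in> H" "w \<in> g" using vw V by auto
      have "{e \<in> H. e \<subseteq> V} \<subset> H" "{e \<in> H. e \<inter> V = {}} \<subset> H" using e g vw by auto
      note proper = this
      have not_bad: "\<exists>B. \<forall>f\<in>S. \<not> f \<subseteq> B \<and> f \<inter> B \<noteq> {}" if "\<not> bad S" for S
        using that by (auto simp: bad_def)
      obtain B1 where B1: "\<forall>f\<in>{e \<in> H. e \<subseteq> V}. \<not> f \<subseteq> B1 \<and> f \<inter> B1 \<noteq> {}"
        using not_bad[OF minimal[OF proper(1)]] by blast
      obtain B2 where B2: "\<forall>f\<in>{e \<in> H. e \<inter> V = {}}. \<not> f \<subseteq> B2 \<and> f \<inter> B2 \<noteq> {}"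
        using not_bad[OF minimal[OF proper(2)]] by blast
      obtain f where f: "f \<in> H"
        "f \<subseteq> (B1 \<inter> V) \<union> (B2 - V) \<or> f \<inter> ((B1 \<inter> V) \<union> (B2 - V)) = {}"
        using H(2) unfolding bad_def by metis
      show False
      proof (cases "f \<subseteq> V")
        case True
        then have "\<not> f \<subseteq> B1" "f \<inter> B1 \<noteq> {}" using B1 f(1) by auto
        then show False using f(2) True by blast
      next
        case False
        then have "f \<inter> V = {}" using split[OF f(1)] by auto
        moreover then have "\<not> f \<subseteq> B2" "f \<inter> B2 \<noteq> {}" using B2 f(1) by auto
        ultimately show False using f(2) by blast
      qed
    qed
  qed
  have "card (\<Union>H) \<le> card (\<Union>(F \<union> G))"
    using fin fe H(1) by (intro card_mono) auto
  then have "configurations q (F \<inter> H) (G \<inter> H) M \<noteq> {}"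
    using M by (intro configuration_exists) (simp add: H_eq)
  then show ?thesis using configurations_mono[of "F \<inter> H" F "G \<inter> H" G q M] by auto
qed

section \<open>Expected numbers of lists of edges\<close>

lemma sum_UN_le:
  fixes f :: "'a \<Rightarrow> real"
  assumes "finite I" "\<And>i. i \<in> I \<Longrightarrow> finite (A i)" "\<And>x. f x \<ge> 0"
  shows "sum f (\<Union>i\<in>I. A i) \<le> (\<Sum>i\<in>I. sum f (A i))"
  using assms(1,2)
proof (induction I)
  case (insert i I)
  have "sum f (A i \<union> (\<Union>i\<in>I. A i)) \<le> sum f (A i) + sum f (\<Union>i\<in>I. A i)"
    using sum.union_inter[of "A i" "\<Union>i\<in>I. A i" f] sum_nonneg[of "A i \<inter> (\<Union>i\<in>I. A i)" f] insert assms(3)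
    by simp
  then show ?case using insert by fastforce
qed simp

text \<open>If vertices survive independently with probability \<open>p\<close>, this is the
  expected number of lists in \<open>X\<close> all of whose vertices survive.\<close>

definition weight :: "real \<Rightarrow> 'a set list set \<Rightarrow> real" where
  "weight p X = (\<Sum>es\<in>X. p ^ card (\<Union>(set es)))"

lemma weight_nonneg: "p \<ge> 0 \<Longrightarrow> weight p X \<ge> 0"
  by (simp add: weight_def sum_nonneg)

lemma weight_Un:
  assumes "p \<ge> 0" "finite X" "finite Y"
  shows "weight p (X \<union> Y) \<le> weight p X + weight p Y"
  using sum.union_inter[OF assms(2,3), of "\<lambda>es. p ^ card (\<Union>(set es))"] weight_nonneg[OF assms(1), of "X \<inter> Y"]
  by (simp add: weight_def)

lemma weight_UN:
  assumes "p \<ge> 0" "finite I" "\<And>i. i \<in> I \<Longrightarrow> finite (X i)"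
  shows "weight p (\<Union>i\<in>I. X i) \<le> (\<Sum>i\<in>I. weight p (X i))"
  unfolding weight_def using assms by (intro sum_UN_le) auto

text \<open>Only vertices not yet explored cost a factor \<open>p\<close>, so a step multiplies the
  weight by at most the conditional expected number of choices for the new edge.\<close>

lemma weight_grow:
  assumes p: "p \<ge> 0" and X: "finite X" "\<And>es. es \<in> X \<Longrightarrow> finite (\<Union>(set es))"
    and R: "\<And>es. es \<in> X \<Longrightarrow> finite {e. R es e}"
      "\<And>es e. es \<in> X \<Longrightarrow> R es e \<Longrightarrow> finite e"
      "\<And>es. es \<in> X \<Longrightarrow> (\<Sum>e | R es e. p ^ card (e - \<Union>(set es))) \<le> \<kappa>"
  shows "finite (grow R X) \<and> weight p (grow R X) \<le> \<kappa> * weight p X"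
proof
  have eq: "grow R X = (\<lambda>(es, e). e # es) ` (SIGMA es:X. {e. R es e})"
    by (auto simp: grow_def)
  have finS: "finite (SIGMA es:X. {e. R es e})" using X R by auto
  then show "finite (grow R X)" unfolding eq by blast
  have "weight p (grow R X) = (\<Sum>(es, e)\<in>(SIGMA es:X. {e. R es e}). p ^ card (e \<union> \<Union>(set es)))"
    unfolding weight_def eq by (subst sum.reindex) (auto simp: inj_on_def case_prod_unfold)
  also have "\<dots> = (\<Sum>es\<in>X. \<Sum>e | R es e. p ^ card (e \<union> \<Union>(set es)))"
    using X R by (subst sum.Sigma) auto
  also have "\<dots> = (\<Sum>es\<in>X. (\<Sum>e | R es e. p ^ card (e - \<Union>(set es))) * p ^ card (\<Union>(set es)))"
  proof (intro sum.cong refl)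
    fix es assume es: "es \<in> X"
    have "card (e \<union> \<Union>(set es)) = card (e - \<Union>(set es)) + card (\<Union>(set es))" if "R es e" for e
      using card_Un_disjoint[of "e - \<Union>(set es)" "\<Union>(set es)"] X(2)[OF es] R(2)[OF es that]
      by auto
    then show "(\<Sum>e | R es e. p ^ card (e \<union> \<Union>(set es))) =
        (\<Sum>e | R es e. p ^ card (e - \<Union>(set es))) * p ^ card (\<Union>(set es))"
      by (simp add: sum_distrib_right power_add)
  qed
  also have "\<dots> \<le> (\<Sum>es\<in>X. \<kappa> * p ^ card (\<Union>(set es)))"
    using R(3) p by (intro sum_mono mult_right_mono) auto
  finally show "weight p (grow R X) \<le> \<kappa> * weight p X"
    by (simp add: weight_def sum_distrib_left)
qed

text \<open>Grouping the edges by their trace \<open>S\<close> on the explored set \<open>U\<close>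
  reduces one step to bounds on the edges through a fixed \<open>S\<close>, at the price of the
  number of traces.\<close>

lemma sum_by_trace:
  fixes p :: real
  assumes p: "p \<ge> 0" and A: "finite A" "\<And>e. e \<in> A \<Longrightarrow> finite e"
    and T: "finite T" "\<And>e. e \<in> A \<Longrightarrow> e \<inter> U \<in> T"
    and \<kappa>: "\<And>S. S \<in> T \<Longrightarrow> (\<Sum>e | e \<in> A \<and> S \<subseteq> e. p ^ (card e - card S)) \<le> \<kappa>"
  shows "(\<Sum>e\<in>A. p ^ card (e - U)) \<le> real (card T) * \<kappa>"
proof -
  have "(\<Sum>e\<in>A. p ^ card (e - U)) = (\<Sum>S\<in>T. \<Sum>e | e \<in> A \<and> e \<inter> U = S. p ^ card (e - U))"
    by (rule sum.group[symmetric]) (use A T in auto)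
  also have "\<dots> \<le> (\<Sum>S\<in>T. \<kappa>)"
  proof (intro sum_mono)
    fix S assume S: "S \<in> T"
    have "(\<Sum>e | e \<in> A \<and> e \<inter> U = S. p ^ card (e - U)) =
        (\<Sum>e | e \<in> A \<and> e \<inter> U = S. p ^ (card e - card S))"
      by (intro sum.cong refl) (use A in \<open>auto simp: card_Diff_subset_Int\<close>)
    also have "\<dots> \<le> (\<Sum>e | e \<in> A \<and> S \<subseteq> e. p ^ (card e - card S))"
      using A p by (intro sum_mono2) auto
    also have "\<dots> \<le> \<kappa>" by (rule \<kappa>[OF S])
    finally show "(\<Sum>e | e \<in> A \<and> e \<inter> U = S. p ^ card (e - U)) \<le> \<kappa>" .
  qed
  finally show ?thesis by simp
qed

section \<open>Sparse random hypergraphs\<close>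

text \<open>In the application \<open>N\<close> is n^(1 - 1/\<mu>), \<epsilon> is a negative power
  of \<open>n\<close>, and \<open>C\<close> does not depend on \<open>n\<close>. The exponent 3 in
  \<open>\<theta>_small\<close> is the growth rate of the trace counts: closing a cycle of
  \<open>a\<close> links contributes about M^a, and the two unrestricted steps of an extension
  contribute M^(2a).\<close>

locale sparse_hypergraph =
  fixes F G :: "'a set set" and q :: nat and p C N \<epsilon> \<theta> :: real
  assumes finite_edges: "finite F" "finite G"
    and card_F: "e \<in> F \<Longrightarrow> card e = q"
    and q_ge_3: "q \<ge> 3"
    and card_G: "e \<in> G \<Longrightarrow> finite e \<and> 2 \<le> card e \<and> card e \<le> q"
    and nonneg: "p \<ge> 0" "C \<ge> 1" "N > 0" "\<epsilon> \<ge> 0" "\<theta> \<ge> 0"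
    and total_F: "(\<Sum>e\<in>F. p ^ card e) \<le> C * N"
    and degree_F: "(\<Sum>e | e \<in> F \<and> v \<in> e. p ^ (card e - 1)) \<le> \<theta>"
    and codegree_F: "card S = 2 \<Longrightarrow> (\<Sum>e | e \<in> F \<and> S \<subseteq> e. p ^ (card e - 2)) \<le> C / N"
    and higher_F: "2 \<le> card S \<Longrightarrow> card S < q \<Longrightarrow>
      (\<Sum>e | e \<in> F \<and> S \<subseteq> e. p ^ (card e - card S)) \<le> C * \<epsilon>"
    and total_G: "(\<Sum>e\<in>G. p ^ card e) \<le> C"
    and degree_G: "S \<noteq> {} \<Longrightarrow> (\<Sum>e | e \<in> G \<and> S \<subset> e. p ^ (card e - card S)) \<le> C * \<epsilon>"
    and \<theta>_small: "real q * \<theta> * (2 ^ q) ^ 3 \<le> 1 / 2"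
begin

abbreviation M :: real where "M \<equiv> 2 ^ q"

text \<open>The length \<open>k\<close> is recorded because it bounds the number of possible traces
  of a new edge by 2^(qk).\<close>

definition bounded :: "nat \<Rightarrow> 'a set list set \<Rightarrow> real \<Rightarrow> bool" where
  "bounded k X w \<longleftrightarrow> finite X \<and> weight p X \<le> w \<and>
     (\<forall>es\<in>X. length es = k \<and> set es \<subseteq> F \<union> G)"

lemma finite_edge: "e \<in> F \<union> G \<Longrightarrow> finite e"
  using card_F card_G q_ge_3 by (metis UnE card.infinite not_numeral_le_zero)

lemma card_edge: "e \<in> F \<union> G \<Longrightarrow> card e \<le> q"
  using card_F card_G by auto

lemma card_list:
  assumes "set es \<subseteq> F \<union> G"
  shows "finite (\<Union>(set es)) \<and> card (\<Union>(set es)) \<le> q * length es"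
  using assms
proof (induction es)
  case (Cons e es)
  then have "card (e \<union> \<Union>(set es)) \<le> card e + card (\<Union>(set es))" by (intro card_Un_le)
  then show ?case using Cons card_edge[of e] finite_edge[of e] by auto
qed simp

lemma bounded_grow:
  assumes X: "bounded k X w"
    and R: "\<And>es e. R es e \<Longrightarrow> e \<in> F \<union> G"
    and \<kappa>: "\<kappa> \<ge> 0" "\<And>es. es \<in> X \<Longrightarrow> (\<Sum>e | R es e. p ^ card (e - \<Union>(set es))) \<le> \<kappa>"
  shows "bounded (Suc k) (grow R X) (\<kappa> * w)"
proof -
  have "finite {e. R es e}" for es
    by (rule finite_subset[of _ "F \<union> G"]) (use R finite_edges in auto)
  then have "finite (grow R X) \<and> weight p (grow R X) \<le> \<kappa> * weight p X"
    using X card_list R finite_edge nonneg \<kappa>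
    by (intro weight_grow) (auto simp: bounded_def)
  moreover have "\<kappa> * weight p X \<le> \<kappa> * w"
    using X \<kappa> by (intro mult_left_mono) (auto simp: bounded_def)
  moreover have "length ps = Suc k \<and> set ps \<subseteq> F \<union> G" if ps: "ps \<in> grow R X" for ps
  proof -
    obtain e es where "ps = e # es" "es \<in> X" "R es e" using ps by (rule growE)
    then show ?thesis using X R[of es e] by (simp add: bounded_def)
  qed
  ultimately show ?thesis by (auto simp: bounded_def)
qed

lemma card_Pow_le:
  assumes "bounded k X w" "es \<in> X" "T \<subseteq> Pow (\<Union>(set es))"
  shows "finite T \<and> real (card T) \<le> M ^ k"
proof -
  have U: "finite (\<Union>(set es))" "card (\<Union>(set es)) \<le> q * k"
    using assms card_list[of es] by (auto simp: bounded_def)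
  have "card T \<le> card (Pow (\<Union>(set es)))" using U assms by (intro card_mono) auto
  also have "\<dots> = 2 ^ card (\<Union>(set es))" using U by (simp add: card_Pow)
  also have "\<dots> \<le> 2 ^ (q * k)" using U by (intro power_increasing) auto
  finally have "real (card T) \<le> real (2 ^ (q * k))" by (simp only: of_nat_le_iff)
  then show ?thesis using assms U finite_subset by (auto simp: power_mult)
qed

lemma bounded_meets:
  assumes X: "bounded k X w" and \<kappa>: "\<kappa> \<ge> 0"
    "\<And>S. finite S \<Longrightarrow> card S \<in> I \<Longrightarrow> (\<Sum>e | e \<in> F \<and> S \<subseteq> e. p ^ (card e - card S)) \<le> \<kappa>"
  shows "bounded (Suc k) (grow (meets I F) X) (M ^ k * \<kappa> * w)"
proof (rule bounded_grow[OF X])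
  fix es assume es: "es \<in> X"
  define T where "T = {S. S \<subseteq> \<Union>(set es) \<and> card S \<in> I}"
  have T: "finite T \<and> real (card T) \<le> M ^ k"
    using X es by (rule card_Pow_le) (auto simp: T_def)
  have fU: "finite (\<Union>(set es))" using X es card_list by (auto simp: bounded_def)
  have "(\<Sum>e | meets I F es e. p ^ card (e - \<Union>(set es))) \<le> real (card T) * \<kappa>"
  proof (rule sum_by_trace)
    show "finite {e. meets I F es e}"
      by (rule finite_subset[of _ F]) (use finite_edges in \<open>auto simp: meets_def\<close>)
    show "e \<in> {e. meets I F es e} \<Longrightarrow> finite e" for e using finite_edge by (auto simp: meets_def)
    show "e \<in> {e. meets I F es e} \<Longrightarrow> e \<inter> \<Union>(set es) \<in> T" for e by (auto simp: meets_def T_def)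
    fix S assume S: "S \<in> T"
    have "(\<Sum>e | e \<in> {e. meets I F es e} \<and> S \<subseteq> e. p ^ (card e - card S)) \<le>
        (\<Sum>e | e \<in> F \<and> S \<subseteq> e. p ^ (card e - card S))"
      using nonneg finite_edges by (intro sum_mono2) (auto simp: meets_def)
    also have "\<dots> \<le> \<kappa>"
      using S fU finite_subset by (intro \<kappa>(2)) (auto simp: T_def)
    finally show "(\<Sum>e | e \<in> {e. meets I F es e} \<and> S \<subseteq> e. p ^ (card e - card S)) \<le> \<kappa>" .
  qed (use nonneg T in auto)
  also have "\<dots> \<le> M ^ k * \<kappa>" using T \<kappa> by (intro mult_right_mono) auto
  finally show "(\<Sum>e | meets I F es e. p ^ card (e - \<Union>(set es))) \<le> M ^ k * \<kappa>" .
qed (use \<kappa> in \<open>auto simp: meets_def\<close>)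

lemma bounded_touches:
  assumes X: "bounded k X w"
  shows "bounded (Suc k) (grow (touches G) X) (M ^ k * (C * \<epsilon>) * w)"
proof (rule bounded_grow[OF X])
  fix es assume es: "es \<in> X"
  define T where "T = {S. S \<subseteq> \<Union>(set es) \<and> S \<noteq> {}}"
  have T: "finite T \<and> real (card T) \<le> M ^ k"
    using X es by (rule card_Pow_le) (auto simp: T_def)
  have "(\<Sum>e | touches G es e. p ^ card (e - \<Union>(set es))) \<le> real (card T) * (C * \<epsilon>)"
  proof (rule sum_by_trace)
    show "finite {e. touches G es e}"
      by (rule finite_subset[of _ G]) (use finite_edges in \<open>auto simp: touches_def\<close>)
    show "e \<in> {e. touches G es e} \<Longrightarrow> finite e" for e using finite_edge by (auto simp: touches_def)
    show "e \<in> {e. touches G es e} \<Longrightarrow> e \<inter> \<Union>(set es) \<in> T" for e by (auto simp: touches_def T_def)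
    fix S assume S: "S \<in> T"
    have "(\<Sum>e | e \<in> {e. touches G es e} \<and> S \<subseteq> e. p ^ (card e - card S)) \<le>
        (\<Sum>e | e \<in> G \<and> S \<subset> e. p ^ (card e - card S))"
      using nonneg finite_edges S by (intro sum_mono2) (auto simp: touches_def T_def)
    also have "\<dots> \<le> C * \<epsilon>" using S by (intro degree_G) (auto simp: T_def)
    finally show "(\<Sum>e | e \<in> {e. touches G es e} \<and> S \<subseteq> e. p ^ (card e - card S)) \<le> C * \<epsilon>" .
  qed (use nonneg T in auto)
  also have "\<dots> \<le> M ^ k * (C * \<epsilon>)" using T nonneg by (intro mult_right_mono) auto
  finally show "(\<Sum>e | touches G es e. p ^ card (e - \<Union>(set es))) \<le> M ^ k * (C * \<epsilon>)" .
qed (use nonneg in \<open>auto simp: touches_def\<close>)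

text \<open>The trace is a single vertex of the newest edge, so the factor does not involve
  \<open>k\<close>; \<open>k > 0\<close> ensures that \<open>hd es\<close> is an edge.\<close>

lemma bounded_links:
  assumes X: "bounded k X w" and k: "k > 0"
  shows "bounded (Suc k) (grow (links F) X) (real q * \<theta> * w)"
proof (rule bounded_grow[OF X])
  fix es assume es: "es \<in> X"
  then have "es \<noteq> []" "set es \<subseteq> F \<union> G" using X k by (auto simp: bounded_def)
  then have hd: "hd es \<in> F \<union> G" "hd es \<in> set es" by (auto simp: subset_iff)
  define T where "T = (\<lambda>v. {v}) ` hd es"
  have "card T = card (hd es)" unfolding T_def by (intro card_image) (auto simp: inj_on_def)
  then have T: "finite T" "card T \<le> q" using finite_edge[OF hd(1)] card_edge[OF hd(1)] by (auto simp: T_def)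
  have "(\<Sum>e | links F es e. p ^ card (e - \<Union>(set es))) \<le> real (card T) * \<theta>"
  proof (rule sum_by_trace)
    show "finite {e. links F es e}"
      by (rule finite_subset[of _ F]) (use finite_edges in \<open>auto simp: links_def\<close>)
    show "e \<in> {e. links F es e} \<Longrightarrow> finite e" for e using finite_edge by (auto simp: links_def)
    show "e \<inter> \<Union>(set es) \<in> T" if "e \<in> {e. links F es e}" for e
    proof -
      have "card (e \<inter> \<Union>(set es)) = 1" "e \<inter> hd es \<noteq> {}" using that by (auto simp: links_def)
      from this(1) obtain v where v: "e \<inter> \<Union>(set es) = {v}" by (rule card_1_singletonE)
      have "e \<inter> hd es \<subseteq> e \<inter> \<Union>(set es)" using hd by auto
      then have "e \<inter> hd es = {v}" using \<open>e \<inter> hd es \<noteq> {}\<close> unfolding v by (simp add: subset_singleton_iff)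
      then have "v \<in> hd es" by auto
      then show ?thesis using v by (auto simp: T_def)
    qed
    fix S assume "S \<in> T"
    then obtain v where v: "S = {v}" by (auto simp: T_def)
    have "(\<Sum>e | e \<in> {e. links F es e} \<and> S \<subseteq> e. p ^ (card e - card S)) \<le>
        (\<Sum>e | e \<in> F \<and> v \<in> e. p ^ (card e - 1))"
      using nonneg finite_edges v by (auto simp: links_def intro!: sum_mono2)
    also have "\<dots> \<le> \<theta>" by (rule degree_F)
    finally show "(\<Sum>e | e \<in> {e. links F es e} \<and> S \<subseteq> e. p ^ (card e - card S)) \<le> \<theta>" .
  qed (use nonneg T in auto)
  also have "\<dots> \<le> real q * \<theta>" using T nonneg by (intro mult_right_mono) auto
  finally show "(\<Sum>e | links F es e. p ^ card (e - \<Union>(set es))) \<le> real q * \<theta>" .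
qed (use nonneg in \<open>auto simp: links_def\<close>)

lemma bounded_linked:
  assumes "bounded k X w" and "k > 0"
  shows "bounded (k + a) (linked F a X) ((real q * \<theta>) ^ a * w)"
proof (induction a)
  case (Suc a)
  then show ?case using bounded_links[OF Suc] assms(2) by (simp add: mult.assoc)
qed (use assms in simp)

lemma weight_singles: "weight p (singles A) = (\<Sum>e\<in>A. p ^ card e)"
  unfolding weight_def singles_def by (subst sum.reindex) (auto simp: inj_on_def)

lemma bounded_singles: "bounded 1 (singles F) (C * N)" "bounded 1 (singles G) C"
  using total_F total_G finite_edges
  by (auto simp: bounded_def weight_singles) (auto simp: singles_def)

lemma bounded_meets_1:
  assumes "bounded k X w"
  shows "bounded (Suc k) (grow (meets {1} F) X) (M ^ k * \<theta> * w)"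
proof (rule bounded_meets[OF assms])
  fix S :: "'a set" assume "card S \<in> {1}"
  then have "card S = 1" by simp
  then obtain v where "S = {v}" by (rule card_1_singletonE)
  then show "(\<Sum>e | e \<in> F \<and> S \<subseteq> e. p ^ (card e - card S)) \<le> \<theta>" using degree_F[of v] by simp
qed (use nonneg in auto)

lemma bounded_meets_2:
  assumes "bounded k X w"
  shows "bounded (Suc k) (grow (meets {2} F) X) (M ^ k * (C / N) * w)"
  by (rule bounded_meets[OF assms]) (use nonneg codegree_F in auto)

lemma bounded_meets_higher:
  assumes "bounded k X w"
  shows "bounded (Suc k) (grow (meets {2..<q} F) X) (M ^ k * (C * \<epsilon>) * w)"
  by (rule bounded_meets[OF assms]) (use nonneg higher_F in auto)

abbreviation \<rho> :: real where "\<rho> \<equiv> real q * \<theta> * M ^ 3"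

lemma sum_ratio_le: "(\<Sum>a\<le>L. \<rho> ^ a) \<le> 2"
proof -
  have \<rho>: "0 \<le> \<rho>" "\<rho> \<le> 1/2" using nonneg \<theta>_small by auto
  have "(\<Sum>a\<le>L. \<rho> ^ a) \<le> (\<Sum>a\<le>L. (1/2) ^ a)" using \<rho> by (intro sum_mono power_mono) auto
  also have "\<dots> \<le> (\<Sum>a. (1/2::real) ^ a)"
    by (intro sum_le_suminf) (auto intro!: summable_geometric)
  also have "\<dots> = 2" by (subst suminf_geometric) auto
  finally show ?thesis .
qed

lemma M_ge_1: "M ^ j \<ge> 1"
  by (simp add: one_le_power)

lemma power_le_ratio: "(real q * \<theta> * M ^ j) ^ a \<le> \<rho> ^ a" if "j \<le> 3"
  using that nonneg by (intro power_mono mult_left_mono power_increasing) auto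

lemma \<theta>_le_1: "\<theta> \<le> 1"
proof -
  have "1 \<le> real q" using q_ge_3 by simp
  then have "1 * \<theta> * 1 \<le> \<rho>" using nonneg M_ge_1[of 3] by (intro mult_mono) auto
  then show ?thesis using \<theta>_small by simp
qed

lemma weight_ends:
  assumes "bounded k X w"
  shows "finite (ends q F G X) \<and> weight p (ends q F G X) \<le> 2 * M ^ k * C * \<epsilon> * w"
  using bounded_meets_higher[OF assms] bounded_touches[OF assms]
    weight_Un[OF nonneg(1), of "grow (meets {2..<q} F) X" "grow (touches G) X"]
  by (auto simp: bounded_def ends_def algebra_simps)

text \<open>Each edge of the chain multiplies the trace count of the final step by \<open>M\<close>,
  which \<rho> absorbs. The 6 is 2, for the two kinds of final step, times 1 + 2, for ending at once
  and for the geometric series.\<close>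

lemma weight_extensions:
  assumes X: "bounded k X w" and k: "k > 0" and w: "w \<ge> 0"
  shows "finite (extensions q F G L X) \<and>
    weight p (extensions q F G L X) \<le> 6 * C * \<epsilon> * M ^ (2 * k + 1) * w"
proof -
  define Y where "Y b = ends q F G (linked F b (grow (meets {1} F) X))" for b
  define K where "K = 2 * C * \<epsilon> * M ^ (2 * k + 1) * w"
  have K0: "K \<ge> 0" using nonneg w by (auto simp: K_def)
  have Y: "finite (Y b) \<and> weight p (Y b) \<le> K * \<rho> ^ b" for b
  proof -
    have "bounded (Suc k + b) (linked F b (grow (meets {1} F) X)) ((real q * \<theta>) ^ b * (M ^ k * \<theta> * w))"
      by (intro bounded_linked bounded_meets_1 X) simp
    from weight_ends[OF this]
    have "finite (Y b) \<and> weight p (Y b) \<le> 2 * M ^ (Suc k + b) * C * \<epsilon> * ((real q * \<theta>) ^ b * (M ^ k * \<theta> * w))"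
      unfolding Y_def .
    moreover have "2 * M ^ (Suc k + b) * C * \<epsilon> * ((real q * \<theta>) ^ b * (M ^ k * \<theta> * w)) =
        K * (real q * \<theta> * M ^ 1) ^ b * \<theta>"
    proof -
      have "2 * P * C * \<epsilon> * (T * (R * \<theta> * w)) = 2 * C * \<epsilon> * (P * R * T) * w * \<theta>" for P R T
        by (simp add: mult_ac)
      moreover have "M ^ (Suc k + b) * M ^ k * (real q * \<theta>) ^ b =
          M ^ (2 * k + 1) * (real q * \<theta> * M ^ 1) ^ b"
      proof -
        have "M ^ (Suc k + b) * M ^ k = M ^ (Suc k + b + k)" by (simp only: power_add)
        also have "Suc k + b + k = 2 * k + 1 + b" by simp
        also have "M ^ (2 * k + 1 + b) = M ^ (2 * k + 1) * M ^ b" by (rule power_add)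
        finally show ?thesis by (simp only: power_mult_distrib power_one_right mult_ac)
      qed
      ultimately have "2 * M ^ (Suc k + b) * C * \<epsilon> * ((real q * \<theta>) ^ b * (M ^ k * \<theta> * w)) =
          2 * C * \<epsilon> * (M ^ (2 * k + 1) * (real q * \<theta> * M ^ 1) ^ b) * w * \<theta>"
        by presburger
      then show ?thesis by (simp only: K_def mult_ac)
    qed
    moreover have "K * (real q * \<theta> * M ^ 1) ^ b * \<theta> \<le> K * \<rho> ^ b * 1"
      using K0 nonneg \<theta>_le_1 power_le_ratio[of 1 b] by (intro mult_mono mult_left_mono) auto
    ultimately show ?thesis unfolding mult_1_right by linarith
  qed
  have UN: "weight p (\<Union>b\<le>L. Y b) \<le> 2 * K"
  proof -
    have "weight p (\<Union>b\<le>L. Y b) \<le> (\<Sum>b\<le>L. weight p (Y b))"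
      using Y nonneg by (intro weight_UN) auto
    also have "\<dots> \<le> (\<Sum>b\<le>L. K * \<rho> ^ b)" using Y by (intro sum_mono) auto
    also have "\<dots> \<le> K * 2" unfolding sum_distrib_left[symmetric]
      using sum_ratio_le K0 by (intro mult_left_mono)
    finally show ?thesis by simp
  qed
  have E: "finite (ends q F G X)" "weight p (ends q F G X) \<le> K"
  proof -
    have "M ^ k \<le> M ^ (2 * k + 1)" by (intro power_increasing) (auto simp: one_le_power)
    then have "(2 * C * \<epsilon> * w) * M ^ k \<le> (2 * C * \<epsilon> * w) * M ^ (2 * k + 1)"
      using nonneg w by (intro mult_left_mono) auto
    then show "finite (ends q F G X)" "weight p (ends q F G X) \<le> K"
      using weight_ends[OF X] by (auto simp: K_def algebra_simps)
  qed
  have "weight p (extensions q F G L X) \<le> weight p (ends q F G X) + weight p (\<Union>b\<le>L. Y b)"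
    unfolding extensions_def Y_def[symmetric] using E Y nonneg by (intro weight_Un) auto
  then show ?thesis using UN E Y by (auto simp: K_def extensions_def Y_def)
qed

text \<open>The factor \<open>N\<close> of a first full edge cancels against 1/\<open>N\<close> of
  the edge closing the cycle, and the second defect leaves \<epsilon>. The bound is uniform in
  \<open>L\<close>, so chains may be as long as the vertex set allows.\<close>

lemma weight_configurations:
  "finite (configurations q F G L) \<and>
   weight p (configurations q F G L) \<le> 20 * C ^ 3 * (2 ^ q) ^ 6 * \<epsilon>"
proof -
  define K where "K = C ^ 3 * M ^ 6 * \<epsilon>"
  have K0: "K \<ge> 0" using nonneg by (auto simp: K_def)
  have C2: "C ^ 2 \<le> C ^ 3" using nonneg by (intro power_increasing) auto
  have M36: "M ^ 3 \<le> M ^ 6" by (intro power_increasing) (auto simp: one_le_power)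
  have N0: "N \<noteq> 0" using nonneg by simp
  have sp: "finite (spoiled_cycles q F a) \<and> weight p (spoiled_cycles q F a) \<le> K * \<rho> ^ a" for a
  proof -
    have "bounded (Suc (Suc 1 + a)) (spoiled_cycles q F a)
        (M ^ (Suc 1 + a) * (C / N) * ((real q * \<theta>) ^ a * (M ^ 1 * (C * \<epsilon>) * (C * N))))"
      unfolding spoiled_cycles_def
      by (intro bounded_meets_2 bounded_linked bounded_meets_higher bounded_singles) simp
    then have "finite (spoiled_cycles q F a) \<and> weight p (spoiled_cycles q F a) \<le>
        M ^ (Suc 1 + a) * (C / N) * ((real q * \<theta>) ^ a * (M ^ 1 * (C * \<epsilon>) * (C * N)))"
      by (simp add: bounded_def)
    moreover have "M ^ (Suc 1 + a) * (C / N) * ((real q * \<theta>) ^ a * (M ^ 1 * (C * \<epsilon>) * (C * N))) =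
        (C ^ 3 * \<epsilon>) * (M ^ 3 * (real q * \<theta> * M ^ 1) ^ a)"
    proof -
      have "P * (C / N) * (T * (M ^ 1 * (C * \<epsilon>) * (C * N))) = (C ^ 3 * \<epsilon>) * (P * M * T)" for P T
        using N0 by (simp add: power3_eq_cube)
      moreover have "M ^ (Suc 1 + a) * M * (real q * \<theta>) ^ a = M ^ 3 * (real q * \<theta> * M ^ 1) ^ a"
        by (simp add: power_add power_mult_distrib power3_eq_cube)
      ultimately show ?thesis by presburger
    qed
    moreover have "(C ^ 3 * \<epsilon>) * (M ^ 3 * (real q * \<theta> * M ^ 1) ^ a) \<le> (C ^ 3 * \<epsilon>) * (M ^ 6 * \<rho> ^ a)"
      using M36 power_le_ratio[of 1 a] nonneg by (intro mult_left_mono mult_mono) auto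
    moreover have "(C ^ 3 * \<epsilon>) * (M ^ 6 * \<rho> ^ a) = K * \<rho> ^ a" by (simp only: K_def mult_ac)
    ultimately show ?thesis by linarith
  qed
  have cy: "finite (extensions q F G L (cycles F a)) \<and>
      weight p (extensions q F G L (cycles F a)) \<le> 6 * K * \<rho> ^ a" for a
  proof -
    have "bounded (Suc (1 + a)) (cycles F a) (M ^ (1 + a) * (C / N) * ((real q * \<theta>) ^ a * (C * N)))"
      unfolding cycles_def by (intro bounded_meets_2 bounded_linked bounded_singles) simp
    from weight_extensions[OF this, of L] have
      "finite (extensions q F G L (cycles F a)) \<and> weight p (extensions q F G L (cycles F a)) \<le>
        6 * C * \<epsilon> * M ^ (2 * Suc (1 + a) + 1) * (M ^ (1 + a) * (C / N) * ((real q * \<theta>) ^ a * (C * N)))"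
      using nonneg by auto
    moreover have "6 * C * \<epsilon> * M ^ (2 * Suc (1 + a) + 1) * (M ^ (1 + a) * (C / N) * ((real q * \<theta>) ^ a * (C * N))) =
        6 * C ^ 3 * \<epsilon> * (M ^ (2 * Suc (1 + a) + 1 + (1 + a)) * (real q * \<theta>) ^ a)"
    proof -
      have "6 * C * \<epsilon> * P * (R * (C / N) * (T * (C * N))) = 6 * C ^ 3 * \<epsilon> * (P * R * T)" for P R T
        using N0 by (simp add: power3_eq_cube)
      then show ?thesis unfolding power_add[of M "2 * Suc (1 + a) + 1"] by blast
    qed
    moreover have "M ^ (2 * Suc (1 + a) + 1 + (1 + a)) * (real q * \<theta>) ^ a = M ^ 6 * \<rho> ^ a"
    proof -
      \<comment> \<open>The first part comes from extending a list of \<open>a + 2\<close> edges,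
        the last \<open>1 + a\<close> from the traces of the closing edge.\<close>
      have "2 * Suc (1 + a) + 1 + (1 + a) = 6 + 3 * a" by simp
      then have "M ^ (2 * Suc (1 + a) + 1 + (1 + a)) = M ^ 6 * (M ^ 3) ^ a"
        by (simp only: power_add power_mult)
      then show ?thesis by (simp only: power_mult_distrib mult_ac)
    qed
    moreover have "6 * C ^ 3 * \<epsilon> * (M ^ 6 * \<rho> ^ a) = 6 * K * \<rho> ^ a" by (simp only: K_def mult_ac)
    ultimately show ?thesis by (simp only:)
  qed
  have sg: "finite (extensions q F G L (singles G)) \<and> weight p (extensions q F G L (singles G)) \<le> 6 * K"
  proof -
    have "finite (extensions q F G L (singles G)) \<and>
        weight p (extensions q F G L (singles G)) \<le> 6 * C * \<epsilon> * M ^ (2 * 1 + 1) * C"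
      using nonneg by (intro weight_extensions bounded_singles) auto
    moreover have "6 * C * \<epsilon> * M ^ (2 * 1 + 1) * C = 6 * \<epsilon> * (C ^ 2 * M ^ 3)"
      by (simp add: power2_eq_square eval_nat_numeral)
    moreover have "6 * \<epsilon> * (C ^ 2 * M ^ 3) \<le> 6 * \<epsilon> * (C ^ 3 * M ^ 6)"
      using C2 M36 nonneg by (intro mult_left_mono mult_mono) auto
    moreover have "6 * \<epsilon> * (C ^ 3 * M ^ 6) = 6 * K" by (simp only: K_def mult_ac)
    ultimately show ?thesis by linarith
  qed
  have union: "weight p (\<Union>a\<le>L. Z a) \<le> c * 2"
    if "\<And>a. finite (Z a) \<and> weight p (Z a) \<le> c * \<rho> ^ a" "c \<ge> 0" for Z c
  proof -
    have "weight p (\<Union>a\<le>L. Z a) \<le> (\<Sum>a\<le>L. weight p (Z a))"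
      using that nonneg by (intro weight_UN) auto
    also have "\<dots> \<le> (\<Sum>a\<le>L. c * \<rho> ^ a)" using that by (intro sum_mono) auto
    also have "\<dots> \<le> c * 2" unfolding sum_distrib_left[symmetric]
      using sum_ratio_le that(2) by (intro mult_left_mono)
    finally show ?thesis .
  qed
  have "weight p (configurations q F G L) \<le>
      weight p (\<Union>a\<le>L. spoiled_cycles q F a) + weight p (extensions q F G L (singles G)) +
      weight p (\<Union>a\<le>L. extensions q F G L (cycles F a))"
    unfolding configurations_def using sp cy sg nonneg
    by (intro order_trans[OF weight_Un] add_right_mono weight_Un) auto
  \<comment> \<open>Spoiled cycles contribute 2, extended short edges 6 and extended cycles 12;
    hence 20.\<close>
  also have "\<dots> \<le> K * 2 + 6 * K + 6 * K * 2"
    using sg union[OF sp K0] union[OF cy] K0 by (intro add_mono) auto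
  finally show ?thesis using sp cy sg by (auto simp: K_def configurations_def algebra_simps)
qed

end

section \<open>Counting the edges through a given set\<close>

lemma card_edges_containing:
  fixes c :: "'i \<Rightarrow> nat \<Rightarrow> rat" and X :: "('i \<Rightarrow> int) set"
  assumes fin: "finite I" and Q: "Q \<subseteq> I" and n: "n \<ge> 1"
    and sol: "\<And>x. x \<in> X \<Longrightarrow> (\<Sum>i\<in>I. (\<lambda>k. rat_of_int (x i) * c i k)) = 0"
    and range: "\<And>x i. x \<in> X \<Longrightarrow> i \<in> Q \<Longrightarrow> x i \<in> {1..int n}"
    and inj: "\<And>x. x \<in> X \<Longrightarrow> inj_on x Q"
    and S: "finite S"
    and \<beta>: "\<And>W. W \<subseteq> Q \<Longrightarrow> card W = card S \<Longrightarrow>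
      real_of_int (rat_fun.proj_dim I c Q - rat_fun.proj_dim I c W) \<le> \<beta>"
  shows "finite {e \<in> (\<lambda>x. x ` Q) ` X. S \<subseteq> e} \<and>
    real (card {e \<in> (\<lambda>x. x ` Q) ` X. S \<subseteq> e}) \<le>
      2 ^ card Q * (real (card Q) + 1) ^ card Q * real n powr \<beta>"
proof -
  define E where "E = {e \<in> (\<lambda>x. x ` Q) ` X. S \<subseteq> e}"
  define Z where "Z W g = (\<lambda>x. restrict x Q) ` {x \<in> X. \<forall>i\<in>W. x i = g i}" for W g
  define Ws where "Ws = {W. W \<subseteq> Q \<and> card W = card S}"
  define T where "T = (SIGMA W:Ws. W \<rightarrow>\<^sub>E S)"
  have finQ: "finite Q" using Q fin finite_subset by blast
  have finWs: "finite Ws" unfolding Ws_def using finQ by auto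
  have finW: "finite W" if "W \<in> Ws" for W using that finQ finite_subset by (auto simp: Ws_def)
  have finT: "finite T" unfolding T_def using finWs finW S by (intro finite_SigmaI finite_PiE) auto
  have Z: "finite (Z W g) \<and> real (card (Z W g)) \<le> real n powr \<beta>" if W: "W \<in> Ws" for W g
  proof -
    have "finite (Z W g) \<and> real (card (Z W g)) \<le>
        real n powr real_of_int (rat_fun.proj_dim I c Q - rat_fun.proj_dim I c W)"
      unfolding Z_def using W sol range
      by (intro card_restricted_solutions[OF fin Q _ n, where g = g]) (auto simp: Ws_def)
    moreover have "real n powr real_of_int (rat_fun.proj_dim I c Q - rat_fun.proj_dim I c W) \<le> real n powr \<beta>"
      using W n by (intro powr_mono \<beta>) (auto simp: Ws_def)
    ultimately show ?thesis by linarith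
  qed
  \<comment> \<open>An edge through \<open>S\<close> is described by the set \<open>W\<close> of
    coordinates taking values in \<open>S\<close>, by these values, and by a solution with the
    values on \<open>W\<close> prescribed.\<close>
  have cover: "E \<subseteq> (\<Union>(W, g)\<in>T. (\<lambda>y. y ` Q) ` Z W g)"
  proof
    fix e assume "e \<in> E"
    then obtain x where x: "x \<in> X" "e = x ` Q" "S \<subseteq> x ` Q" by (auto simp: E_def)
    define W where "W = {i \<in> Q. x i \<in> S}"
    have imW: "x ` W = S" using x(3) by (auto simp: W_def)
    have "card W = card S"
      using card_image[OF inj_on_subset[OF inj[OF x(1)], of W]] imW by (auto simp: W_def)
    then have "W \<in> Ws" by (auto simp: Ws_def W_def)
    moreover have "restrict x W \<in> W \<rightarrow>\<^sub>E S" using imW by auto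
    ultimately have "(W, restrict x W) \<in> T" by (auto simp: T_def)
    moreover have "restrict x Q \<in> Z W (restrict x W)" using x(1) by (auto simp: Z_def)
    moreover have "e = (\<lambda>y. y ` Q) (restrict x Q)" using x(2) by auto
    ultimately show "e \<in> (\<Union>(W, g)\<in>T. (\<lambda>y. y ` Q) ` Z W g)" by blast
  qed
  have fin_img: "finite ((\<lambda>y. y ` Q) ` Z W g)" if "(W, g) \<in> T" for W g
    using Z that by (auto simp: T_def)
  have finU: "finite (\<Union>(W, g)\<in>T. (\<lambda>y. y ` Q) ` Z W g)" using finT fin_img by auto
  then have finE: "finite E" using cover finite_subset by blast
  have "card E \<le> card (\<Union>(W, g)\<in>T. (\<lambda>y. y ` Q) ` Z W g)" using cover finU by (rule card_mono[rotated])
  also have "\<dots> \<le> (\<Sum>t\<in>T. card ((\<lambda>(W, g). (\<lambda>y. y ` Q) ` Z W g) t))"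
    using card_UN_le[OF finT, of "\<lambda>(W, g). (\<lambda>y. y ` Q) ` Z W g"] by simp
  finally have "real (card E) \<le> (\<Sum>t\<in>T. real (card ((\<lambda>(W, g). (\<lambda>y. y ` Q) ` Z W g) t)))"
    by (metis of_nat_le_iff of_nat_sum)
  also have "\<dots> \<le> (\<Sum>t\<in>T. real n powr \<beta>)"
  proof (intro sum_mono)
    fix t assume t: "t \<in> T"
    obtain W g where Wg: "t = (W, g)" by (cases t)
    then have "W \<in> Ws" using t by (auto simp: T_def)
    then have "card ((\<lambda>y. y ` Q) ` Z W g) \<le> card (Z W g)" using Z by (intro card_image_le) auto
    then show "real (card ((\<lambda>(W, g). (\<lambda>y. y ` Q) ` Z W g) t)) \<le> real n powr \<beta>"
      using Z[OF \<open>W \<in> Ws\<close>, of g] Wg by simp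
  qed
  also have "\<dots> = real (card T) * real n powr \<beta>" by simp
  \<comment> \<open>The first factor counts the choices of \<open>W\<close>, the second the
    assignments of values on it. Adding 1 keeps the base positive, so the exponent may be raised to
    \<open>card Q\<close>.\<close>
  also have "\<dots> \<le> (2 ^ card Q * (real (card Q) + 1) ^ card Q) * real n powr \<beta>"
  proof (rule mult_right_mono)
    have "card T = (\<Sum>W\<in>Ws. card (W \<rightarrow>\<^sub>E S))"
      unfolding T_def using finWs finW S by (intro card_SigmaI) (auto intro: finite_PiE)
    also have "\<dots> \<le> (\<Sum>W\<in>Ws. (card Q + 1) ^ card Q)"
    proof (intro sum_mono)
      fix W assume W: "W \<in> Ws"
      then have "card S \<le> card Q" using finQ by (auto simp: Ws_def intro: card_mono dest!: sym[of _ "card S"])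
      have "card (W \<rightarrow>\<^sub>E S) = card S ^ card S"
        using W finW[OF W] by (simp add: card_PiE Ws_def)
      also have "\<dots> \<le> (card Q + 1) ^ card S" using \<open>card S \<le> card Q\<close> by (intro power_mono) auto
      also have "\<dots> \<le> (card Q + 1) ^ card Q" using \<open>card S \<le> card Q\<close> by (intro power_increasing) auto
      finally show "card (W \<rightarrow>\<^sub>E S) \<le> (card Q + 1) ^ card Q" .
    qed
    also have "\<dots> = card Ws * (card Q + 1) ^ card Q" by simp
    also have "\<dots> \<le> 2 ^ card Q * (card Q + 1) ^ card Q"
    proof (rule mult_right_mono)
      have "card Ws \<le> card (Pow Q)" using finQ by (intro card_mono) (auto simp: Ws_def)
      then show "card Ws \<le> 2 ^ card Q" using finQ by (simp add: card_Pow)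
    qed simp
    finally have "real (card T) \<le> real (2 ^ card Q * (card Q + 1) ^ card Q)" by (simp only: of_nat_le_iff)
    then show "real (card T) \<le> 2 ^ card Q * (real (card Q) + 1) ^ card Q" by (simp add: add.commute)
  qed simp
  finally show ?thesis using finE by (simp add: E_def)
qed

lemma edge_weight_containing:
  fixes c :: "'i \<Rightarrow> nat \<Rightarrow> rat" and X :: "('i \<Rightarrow> int) set"
  assumes fin: "finite I" and Q: "Q \<subseteq> I" and n: "n \<ge> 1"
    and sol: "\<And>x. x \<in> X \<Longrightarrow> (\<Sum>i\<in>I. (\<lambda>k. rat_of_int (x i) * c i k)) = 0"
    and range: "\<And>x i. x \<in> X \<Longrightarrow> i \<in> Q \<Longrightarrow> x i \<in> {1..int n}"
    and inj: "\<And>x. x \<in> X \<Longrightarrow> inj_on x Q"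
    and S: "finite S"
    and p: "0 \<le> p" "p \<le> a * real n powr (- 1 / \<mu>)" "0 \<le> a"
    and \<gamma>: "\<And>W. W \<subseteq> Q \<Longrightarrow> card W = card S \<Longrightarrow>
      real_of_int (rat_fun.proj_dim I c Q) - real (card Q) / \<mu> -
        (real_of_int (rat_fun.proj_dim I c W) - real (card W) / \<mu>) \<le> \<gamma>"
  shows "(\<Sum>e | e \<in> (\<lambda>x. x ` Q) ` X \<and> S \<subseteq> e. p ^ (card e - card S)) \<le>
    2 ^ card Q * (real (card Q) + 1) ^ card Q * a ^ (card Q - card S) * real n powr \<gamma>"
proof (cases "card S \<le> card Q")
  case True
  define E where "E = {e \<in> (\<lambda>x. x ` Q) ` X. S \<subseteq> e}"
  define k where "k = card Q - card S"
  \<comment> \<open>About n^\<beta> edges contain \<open>S\<close>, each with weight p^k of order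
    a^k n^(-k/\<mu>); the product has exponent \<gamma>.\<close>
  define \<beta> where "\<beta> = \<gamma> + real k / \<mu>"
  define K where "K = 2 ^ card Q * (real (card Q) + 1) ^ card Q"
  have card_e: "card e = card Q" if "e \<in> E" for e
    using that inj by (auto simp: E_def card_image)
  have "finite E \<and> real (card E) \<le> K * real n powr \<beta>"
    unfolding E_def K_def
  proof (rule card_edges_containing[where X = X and c = c and I = I and n = n])
    fix W assume "W \<subseteq> Q" "card W = card S"
    then show "real_of_int (rat_fun.proj_dim I c Q - rat_fun.proj_dim I c W) \<le> \<beta>"
      using \<gamma>[of W] True by (simp add: \<beta>_def k_def of_nat_diff diff_divide_distrib)
  qed (fact fin Q n sol range inj S)+
  then have "real (card E) * p ^ k \<le> (K * real n powr \<beta>) * (a * real n powr (- 1 / \<mu>)) ^ k"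
    using p by (intro mult_mono power_mono) (auto simp: K_def)
  also have "\<dots> = K * a ^ k * (real n powr \<beta> * real n powr (real k * (- 1 / \<mu>)))"
    using n by (simp add: power_mult_distrib powr_power mult_ac)
  also have "real n powr \<beta> * real n powr (real k * (- 1 / \<mu>)) = real n powr \<gamma>"
    by (simp add: powr_add[symmetric] \<beta>_def)
  finally have "real (card E) * p ^ k \<le> K * a ^ k * real n powr \<gamma>" .
  moreover have "(\<Sum>e\<in>E. p ^ (card e - card S)) = real (card E) * p ^ k"
    using card_e by (simp add: k_def)
  ultimately show ?thesis by (simp add: E_def K_def k_def)
next
  case False
  have "\<not> S \<subseteq> x ` Q" if "x \<in> X" for x
  proof
    assume "S \<subseteq> x ` Q"
    moreover have "finite (x ` Q)" using Q fin finite_subset by blast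
    ultimately have "card S \<le> card (x ` Q)" by (rule card_mono[rotated])
    then show False using False inj[OF that] by (simp add: card_image)
  qed
  then have "{e. e \<in> (\<lambda>x. x ` Q) ` X \<and> S \<subseteq> e} = {}" by auto
  then show ?thesis using p by (simp only: sum.empty) simp
qed

section \<open>The binomial random subset and the union bound\<close>

lemma prob_superset_le:
  assumes p: "0 \<le> p" "p \<le> 1"
  shows "measure_pmf.prob (binomial_subset n p) {T. U \<subseteq> T} \<le> p ^ card U"
proof (cases "U \<subseteq> {1..int n}")
  case True
  have "measure_pmf.prob (binomial_subset n p) {T. U \<subseteq> T} =
      measure_pmf.prob (Pi_pmf {1..int n} False (\<lambda>_. bernoulli_pmf p)) (Pi {1..int n} (\<lambda>i. if i \<in> U then {True} else UNIV))"
    unfolding binomial_subset_def measure_map_pmf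
    using True by (intro arg_cong2[where f = measure_pmf.prob]) (auto simp: Pi_def split: if_splits)
  also have "\<dots> = (\<Prod>i\<in>{1..int n}. if i \<in> U then p else 1)"
    using p by (subst measure_Pi_pmf_Pi) (auto intro!: prod.cong simp: measure_pmf_single)
  also have "\<dots> = (\<Prod>i\<in>U. p)"
    using True by (subst prod.If_cases) (auto simp: Int_absorb1)
  finally show ?thesis by simp
next
  case False
  have "measure_pmf.prob (binomial_subset n p) {T. U \<subseteq> T} = 0"
    unfolding measure_pmf_zero_iff binomial_subset_def using False by auto
  then show ?thesis using p by simp
qed

lemma prob_contains_list_le:
  assumes p: "0 \<le> p" "p \<le> 1" and "finite X"
  shows "measure_pmf.prob (binomial_subset n p) {T. \<exists>es\<in>X. \<Union>(set es) \<subseteq> T} \<le> weight p X"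
proof -
  have "{T. \<exists>es\<in>X. \<Union>(set es) \<subseteq> T} = (\<Union>es\<in>X. {T. \<Union>(set es) \<subseteq> T})" by auto
  then have "measure_pmf.prob (binomial_subset n p) {T. \<exists>es\<in>X. \<Union>(set es) \<subseteq> T} \<le>
      (\<Sum>es\<in>X. measure_pmf.prob (binomial_subset n p) {T. \<Union>(set es) \<subseteq> T})"
    using measure_pmf.finite_measure_subadditive_finite[OF assms(3)] by auto
  also have "\<dots> \<le> weight p X"
    unfolding weight_def using p by (intro sum_mono prob_superset_le)
  finally show ?thesis .
qed

lemma grow_lists:
  assumes "X \<subseteq> lists H" "\<And>es e. R es e \<Longrightarrow> e \<in> H"
  shows "grow R X \<subseteq> lists H"
proof
  fix ps assume "ps \<in> grow R X"
  then obtain e es where "ps = e # es" "es \<in> X" "R es e" by (rule growE)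
  then show "ps \<in> lists H" using assms by (simp add: subset_iff)
qed

lemma linked_lists: "X \<subseteq> lists H \<Longrightarrow> F \<subseteq> H \<Longrightarrow> linked F a X \<subseteq> lists H"
proof (induction a)
  case (Suc a)
  then show ?case unfolding linked_Suc by (intro grow_lists) (auto simp: links_def)
qed simp

lemma extensions_lists: "X \<subseteq> lists H \<Longrightarrow> F \<subseteq> H \<Longrightarrow> G \<subseteq> H \<Longrightarrow> extensions q F G M X \<subseteq> lists H"
  unfolding extensions_def ends_def
  by (intro Un_least UN_least grow_lists linked_lists) (auto simp: meets_def touches_def)

text \<open>Applied to the edges inside a set, this shows that the whole configuration lies in that
  set.\<close>

lemma configurations_lists: "configurations q F G M \<subseteq> lists (F \<union> G)"
proof -
  have F: "singles F \<subseteq> lists (F \<union> G)" and G: "singles G \<subseteq> lists (F \<union> G)"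
    by (auto simp: singles_def)
  have grow: "grow (meets I F) X \<subseteq> lists (F \<union> G)" if "X \<subseteq> lists (F \<union> G)" for I X
    using that by (intro grow_lists) (auto simp: meets_def)
  show ?thesis
    unfolding configurations_def spoiled_cycles_def cycles_def
    by (intro Un_least UN_least extensions_lists grow linked_lists F G) auto
qed

lemma set_pmf_binomial_subset:
  assumes "T \<in> set_pmf (binomial_subset n p)"
  shows "T \<subseteq> {1..int n}"
  using assms by (auto simp: binomial_subset_def)

text \<open>A configuration is found among the edges inside \<open>T\<close>. By monotonicity it
  belongs to the family built from all edges, which does not depend on \<open>T\<close>, so the
  union bound applies. Chain lengths are limited by the \<open>n\<close> available vertices.\<close>

lemma prob_not_2_colourable_le:
  assumes sparse: "sparse_hypergraph F G q p C N \<epsilon> \<theta>" and "p \<le> 1"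
  shows "measure_pmf.prob (binomial_subset n p)
      {T. \<forall>B. \<exists>e\<in>F \<union> G. e \<subseteq> T \<and> (e \<subseteq> B \<or> e \<inter> B = {})} \<le> 20 * C ^ 3 * (2 ^ q) ^ 6 * \<epsilon>"
proof -
  interpret sparse_hypergraph F G q p C N \<epsilon> \<theta> by (rule sparse)
  let ?conf = "configurations q F G n"
  have conf: "\<exists>es\<in>?conf. \<Union>(set es) \<subseteq> T"
    if T: "T \<subseteq> {1..int n}" and bad: "\<forall>B. \<exists>e\<in>F \<union> G. e \<subseteq> T \<and> (e \<subseteq> B \<or> e \<inter> B = {})" for T
  proof -
    let ?F = "{e \<in> F. e \<subseteq> T}" and ?G = "{e \<in> G. e \<subseteq> T}"
    have "finite T" using T finite_subset by blast
    have "card (\<Union>(?F \<union> ?G)) \<le> card {1..int n}" using T by (intro card_mono) auto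
    then have "configurations q ?F ?G n \<noteq> {}"
      using finite_edges card_F q_ge_3 card_G bad
      by (intro configuration_if_not_2_colourable) (simp_all, blast)
    then obtain es where es: "es \<in> configurations q ?F ?G n" by blast
    then have "set es \<subseteq> ?F \<union> ?G" using configurations_lists[of q ?F ?G n] by auto
    moreover have "es \<in> ?conf" using es configurations_mono[of ?F F ?G G q n] by auto
    ultimately show ?thesis by blast
  qed
  have "measure_pmf.prob (binomial_subset n p)
      {T. \<forall>B. \<exists>e\<in>F \<union> G. e \<subseteq> T \<and> (e \<subseteq> B \<or> e \<inter> B = {})} \<le>
      measure_pmf.prob (binomial_subset n p) {T. \<exists>es\<in>?conf. \<Union>(set es) \<subseteq> T}"
    using conf set_pmf_binomial_subset
    by (intro measure_pmf.finite_measure_mono_AE AE_pmfI) auto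
  also have "\<dots> \<le> weight p ?conf"
    using nonneg assms(2) weight_configurations by (intro prob_contains_list_le) auto
  also have "\<dots> \<le> 20 * C ^ 3 * (2 ^ q) ^ 6 * \<epsilon>" using weight_configurations by blast
  finally show ?thesis .
qed

section \<open>The hypergraphs of solutions\<close>

locale partition_regular_matrix =
  fixes A :: "int mat"
  assumes regular: "partition_regular A"
    and nonzero: "\<exists>i<dim_row A. \<exists>j<dim_col A. A $$ (i, j) \<noteq> 0"
begin

abbreviation I :: "nat set" where "I \<equiv> {..<dim_col A}"

abbreviation c :: "nat \<Rightarrow> nat \<Rightarrow> rat" where "c \<equiv> column_fun A"

definition d :: "nat set \<Rightarrow> int" where "d S = rat_fun.proj_dim I c S"

abbreviation \<mu> :: real where "\<mu> \<equiv> max_density A"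

lemma positive_solution:
  obtains x where "x \<in> solutions A" "inj_on (vec_index x) I" "\<And>i. i \<in> I \<Longrightarrow> x $ i \<ge> 1"
proof -
  have "\<forall>\<^sub>F n in sequentially. arrows {1..int n} 1 (proper_solutions A)"
    using regular unfolding partition_regular_def by blast
  then obtain n where n: "arrows {1..int n} 1 (proper_solutions A)"
    by (auto simp: eventually_sequentially)
  then obtain x where x: "x \<in> proper_solutions A" "vec_set x \<subseteq> {1..int n}"
    unfolding arrows_def by (auto dest!: spec[of _ "\<lambda>_. {1..int n}"] simp: disjoint_family_on_def)
  have "x $ i \<ge> 1" if "i \<in> I" for i
    using x that by (auto simp: proper_solutions_def solutions_def intro!: vec_setI dest!: subsetD[of _ _ "x $ i"])
  then show ?thesis using that x by (auto simp: proper_solutions_def)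
qed

lemma d_mono: "Q \<subseteq> I \<Longrightarrow> W \<subseteq> Q \<Longrightarrow> d W \<le> d Q"
  unfolding d_def by (rule rat_fun.proj_dim_mono) auto

lemma d_singleton: "i \<in> I \<Longrightarrow> d {i} = 1"
proof -
  assume i: "i \<in> I"
  obtain x where x: "x \<in> solutions A" "\<And>i. i \<in> I \<Longrightarrow> x $ i \<ge> 1" using positive_solution by blast
  obtain D where D: "D \<subseteq> {i} - {}"
    "int (card D) = rat_fun.proj_dim I c {i} - rat_fun.proj_dim I c {}"
    "\<forall>z. (\<Sum>i\<in>I. (\<lambda>k. z i * c i k)) = 0 \<longrightarrow> (\<forall>i\<in>{} \<union> D. z i = 0) \<longrightarrow> (\<forall>i\<in>{i}. z i = 0)"
    by (rule rat_fun.proj_dim_determining_set[of I "{i}" "{}" c]) (use i in auto)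
  have "D \<noteq> {}"
  proof
    assume "D = {}"
    then have "rat_of_int (x $ i) = 0"
      using D(3)[THEN spec, of "\<lambda>i. rat_of_int (x $ i)"] solution_column_sum[OF x(1)] by simp
    then show False using x(2)[OF i] by simp
  qed
  then have "D = {i}" using D(1) by auto
  then show ?thesis using D(2) by (simp add: d_def)
qed

text \<open>If coordinate \<open>a\<close> determines coordinate \<open>b\<close>, their ratio is
  constant over all solutions, and it is not 1 because some solution has distinct entries. A
  2-colouring that separates numbers in this ratio contradicts regularity.\<close>

lemma no_fixed_ratio:
  assumes ab: "a \<in> I" "b \<in> I" "a \<noteq> b"
    and det: "\<And>z. (\<Sum>i\<in>I. (\<lambda>k. z i * c i k)) = 0 \<Longrightarrow> z a = 0 \<Longrightarrow> z b = 0"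
  shows False
proof -
  obtain y where y: "y \<in> solutions A" "inj_on (vec_index y) I" "\<And>i. i \<in> I \<Longrightarrow> y $ i \<ge> 1"
    using positive_solution by blast
  define \<rho> where "\<rho> = real_of_int (y $ b) / real_of_int (y $ a)"
  have ya: "y $ a \<ge> 1" "y $ b \<ge> 1" using y(3) ab by auto
  have "y $ a \<noteq> y $ b" using y(2) ab by (auto simp: inj_on_def)
  then have \<rho>: "\<rho> > 0" "\<rho> \<noteq> 1" using ya by (auto simp: \<rho>_def field_simps)
  have ratio: "real_of_int (x $ b) = \<rho> * real_of_int (x $ a)" if x: "x \<in> solutions A" for x
  proof -
    \<comment> \<open>The combination of \<open>x\<close> and \<open>y\<close> that vanishes at
      \<open>a\<close>.\<close>
    define z where "z i = rat_of_int (y $ a * x $ i - x $ a * y $ i)" for i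
    have "(\<Sum>i\<in>I. (\<lambda>k. z i * c i k)) =
        (\<lambda>k. rat_of_int (y $ a) * (\<Sum>i\<in>I. (\<lambda>k. rat_of_int (x $ i) * c i k)) k -
          rat_of_int (x $ a) * (\<Sum>i\<in>I. (\<lambda>k. rat_of_int (y $ i) * c i k)) k)"
      by (rule ext) (simp add: z_def sum_fun_apply sum_distrib_left sum_subtractf[symmetric] algebra_simps)
    then have "(\<Sum>i\<in>I. (\<lambda>k. z i * c i k)) = 0"
      unfolding solution_column_sum[OF x] solution_column_sum[OF y(1)] by (simp add: fun_eq_iff)
    moreover have "z a = 0" by (simp add: z_def)
    ultimately have "z b = 0" by (rule det)
    then have "y $ a * x $ b = x $ a * y $ b" unfolding z_def of_int_eq_0_iff by simp
    then have "real_of_int (y $ a) * real_of_int (x $ b) = real_of_int (x $ a) * real_of_int (y $ b)"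
      by (metis of_int_mult)
    then show ?thesis using ya by (simp add: \<rho>_def field_simps)
  qed
  \<comment> \<open>Multiplication by \<rho> shifts this logarithmic level by exactly one, also for
    \<rho> below 1, and so changes its parity.\<close>
  define f where "f t = \<lfloor>ln (real_of_int t) / ln \<rho>\<rfloor>" for t :: int
  have "\<forall>\<^sub>F n in sequentially. arrows {1..int n} 2 (proper_solutions A)"
    using regular unfolding partition_regular_def by auto
  then obtain n where n: "arrows {1..int n} 2 (proper_solutions A)"
    by (auto simp: eventually_sequentially)
  define P where "P k = {t \<in> {1..int n}. even (f t) \<longleftrightarrow> k = 1}" for k :: nat
  have two: "{1..2::nat} = {1, 2}" by auto
  have "disjoint_family_on P {1..2} \<and> (\<Union>i\<in>{1..2}. P i) = {1..int n}"
    unfolding two by (auto simp: P_def disjoint_family_on_def)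
  from n[unfolded arrows_def, THEN spec, THEN mp, OF this]
  obtain k x where x: "x \<in> proper_solutions A" "vec_set x \<subseteq> P k" by blast
  have xs: "x \<in> solutions A" "dim_vec x = dim_col A" using x by (auto simp: proper_solutions_def solutions_def)
  have xP: "x $ a \<in> P k" "x $ b \<in> P k" using x(2) ab xs(2) by (auto intro!: vec_setI subsetD[OF x(2)])
  have pos: "real_of_int (x $ a) > 0" using xP by (auto simp: P_def)
  have "ln (real_of_int (x $ b)) = ln \<rho> + ln (real_of_int (x $ a))"
    unfolding ratio[OF xs(1)] using \<rho> pos by (simp add: ln_mult)
  moreover have "ln \<rho> \<noteq> 0" using \<rho> by simp
  ultimately have "ln (real_of_int (x $ b)) / ln \<rho> = ln (real_of_int (x $ a)) / ln \<rho> + 1"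
    by (simp add: field_simps)
  then have "f (x $ b) = f (x $ a) + 1" by (simp add: f_def)
  then show False using xP by (auto simp: P_def)
qed

text \<open>By \<open>no_fixed_ratio\<close> neither coordinate determines the other, so a
  determining set contains both.\<close>

lemma d_pair:
  assumes "a \<in> I" "b \<in> I" "a \<noteq> b"
  shows "d {a, b} = 2"
proof -
  obtain D where D: "D \<subseteq> {a, b} - {}"
    "int (card D) = rat_fun.proj_dim I c {a, b} - rat_fun.proj_dim I c {}"
    "\<forall>z. (\<Sum>i\<in>I. (\<lambda>k. z i * c i k)) = 0 \<longrightarrow> (\<forall>i\<in>{} \<union> D. z i = 0) \<longrightarrow> (\<forall>i\<in>{a, b}. z i = 0)"
    by (rule rat_fun.proj_dim_determining_set[of I "{a, b}" "{}" c]) (use assms in auto)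
  have "\<not> D \<subseteq> {a}" using no_fixed_ratio[OF assms] D(3) by blast
  moreover have "\<not> D \<subseteq> {b}" using no_fixed_ratio[of b a] assms D(3) by blast
  ultimately have "D = {a, b}" using D(1) by auto
  then show ?thesis using D(2) assms by (simp add: d_def)
qed

lemma d_ge_2:
  assumes "S \<subseteq> I" "card S \<ge> 2"
  shows "d S \<ge> 2"
proof -
  obtain T where "T \<subseteq> S" "card T = 2" using obtain_subset_with_card_n assms(2) by metis
  then obtain a b where ab: "{a, b} \<subseteq> S" "a \<noteq> b" by (auto simp: card_2_iff)
  then have "a \<in> I" "b \<in> I" using assms(1) by blast+
  then show ?thesis using d_pair[of a b] d_mono[OF assms(1) ab(1)] ab(2) by simp
qed

text \<open>A nonzero entry gives positive rank, so the solution space is proper; this is what lifts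
  \<mu> above 1.\<close>

lemma d_I: "d I < int (card I)"
proof -
  have "rat_fun.dim (c ` I) \<noteq> 0"
  proof
    assume dim: "rat_fun.dim (c ` I) = 0"
    obtain J where J: "J \<subseteq> I" "c ` I \<subseteq> rat_fun.span (c ` J)" "card J = rat_fun.dim (c ` I)"
      by (rule rat_fun.extend_indexed_basis[of I "{}" c]) (use rat_fun.independent_empty in auto)
    have "finite J" using J(1) finite_subset by blast
    then have "J = {}" using J(3) dim by simp
    then have zero: "c j = 0" if "j \<in> I" for j using J(2) that by auto
    obtain i j where "i < dim_row A" "j < dim_col A" "A $$ (i, j) \<noteq> 0" using nonzero by blast
    then show False using fun_cong[OF zero[of j], of i] by (simp add: column_fun_def)
  qed
  moreover have "rat_fun.dim (c ` (I - I)) = 0" 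
    using rat_fun.dim_unique[of "{}" "{}" 0] rat_fun.independent_empty by simp
  ultimately show ?thesis unfolding d_def rat_fun.proj_dim_def by simp
qed

lemma card_I: "card I \<ge> 2"
proof -
  obtain j where "j \<in> I" using nonzero by auto
  then have "1 \<le> d I" using d_singleton[of j] d_mono[of I "{j}"] by auto
  then show ?thesis using d_I by simp
qed

definition density :: "nat set \<Rightarrow> real" where
  "density S = (real (card S) - 1) / (real_of_int (d S) - 1)"

lemma \<mu>_eq: "\<mu> = Max (density ` {Q. Q \<subseteq> I \<and> 2 \<le> card Q})"
  unfolding max_density_def density_def d_def
  by (intro arg_cong[where f = Max] image_cong) (auto simp: rank_drop_eq)

lemma finite_candidates: "finite {Q. Q \<subseteq> I \<and> 2 \<le> card Q}"
  by (rule finite_subset[of _ "Pow I"]) auto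

lemma density_le: "S \<subseteq> I \<Longrightarrow> 2 \<le> card S \<Longrightarrow> density S \<le> \<mu>"
  unfolding \<mu>_eq using finite_candidates by (intro Max_ge) auto

lemma \<mu>_gt_1: "\<mu> > 1"
proof -
  have "real_of_int (d I) \<ge> 2" "real_of_int (d I) < real (card I)"
    using d_ge_2[OF order_refl card_I] d_I by linarith+
  then have "density I > 1" unfolding density_def by (simp add: less_divide_eq)
  then show ?thesis using density_le[OF order_refl card_I] by simp
qed

text \<open>With p = n^(-1/\<mu>), the quantity n^(d S) p^|S|, which bounds the expected number of
  surviving projections of solutions to \<open>S\<close>, is n^(1 - 1/\<mu>) n^(\<phi> S). So \<phi>
  vanishes exactly at maximal density.\<close>

definition \<phi> :: "nat set \<Rightarrow> real" where
  "\<phi> S = real_of_int (d S) - 1 - (real (card S) - 1) / \<mu>"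

lemma \<phi>_nonneg: "S \<subseteq> I \<Longrightarrow> 2 \<le> card S \<Longrightarrow> \<phi> S \<ge> 0"
  and \<phi>_eq_0_iff: "S \<subseteq> I \<Longrightarrow> 2 \<le> card S \<Longrightarrow> \<phi> S = 0 \<longleftrightarrow> density S = \<mu>"
proof -
  assume S: "S \<subseteq> I" "2 \<le> card S"
  have 1: "real_of_int (d S) - 1 > 0" using d_ge_2[OF S] by linarith
  show "\<phi> S \<ge> 0" "\<phi> S = 0 \<longleftrightarrow> density S = \<mu>"
    using density_le[OF S] 1 \<mu>_gt_1 by (auto simp: \<phi>_def density_def field_simps)
qed

text \<open>A set of least size attaining the maximal density is strictly balanced.\<close>

lemma strictly_balanced_set:
  obtains Q where "Q \<subseteq> I" "card Q \<ge> 3" "\<phi> Q = 0"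
    "\<And>W. W \<subset> Q \<Longrightarrow> 2 \<le> card W \<Longrightarrow> \<phi> W > 0"
proof -
  define \<Q> where "\<Q> = {Q. Q \<subseteq> I \<and> 2 \<le> card Q \<and> density Q = \<mu>}"
  have "\<mu> \<in> density ` {Q. Q \<subseteq> I \<and> 2 \<le> card Q}"
    unfolding \<mu>_eq using finite_candidates card_I by (intro Max_in) auto
  then have "\<exists>Q. Q \<in> \<Q>" by (auto simp: \<Q>_def)
  then obtain Q where Q: "Q \<in> \<Q>" "\<And>W. W \<in> \<Q> \<Longrightarrow> card Q \<le> card W"
    using ex_has_least_nat[of "\<lambda>Q. Q \<in> \<Q>" _ card] by blast
  have QI: "Q \<subseteq> I" "2 \<le> card Q" "density Q = \<mu>" using Q(1) by (auto simp: \<Q>_def)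
  have "card Q \<noteq> 2"
  proof
    assume "card Q = 2"
    then obtain a b where "Q = {a, b}" "a \<noteq> b" by (auto simp: card_2_iff)
    then have "density Q = 1" using d_pair[of a b] QI(1) by (simp add: density_def)
    then show False using QI(3) \<mu>_gt_1 by simp
  qed
  then have "card Q \<ge> 3" using QI(2) by simp
  moreover have "\<phi> W > 0" if W: "W \<subset> Q" "2 \<le> card W" for W
  proof -
    have "W \<subseteq> I" using W QI by auto
    have "card W < card Q" using W QI(1) finite_subset by (intro psubset_card_mono) auto
    then have "W \<notin> \<Q>" using Q(2)[of W] by auto
    then show ?thesis
      using \<phi>_nonneg[OF \<open>W \<subseteq> I\<close> W(2)] \<phi>_eq_0_iff[OF \<open>W \<subseteq> I\<close> W(2)] \<open>W \<subseteq> I\<close> W(2) by (auto simp: \<Q>_def)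
  qed
  ultimately show thesis using QI \<phi>_eq_0_iff[OF QI(1,2)] by (intro that[of Q]) auto
qed

end

section \<open>Full and short edges over a strictly balanced set\<close>

locale strictly_balanced = partition_regular_matrix +
  fixes Q :: "nat set"
  assumes Q: "Q \<subseteq> I" "card Q \<ge> 3" "\<phi> Q = 0"
    and \<phi>_pos: "W \<subset> Q \<Longrightarrow> 2 \<le> card W \<Longrightarrow> \<phi> W > 0"
begin

text \<open>Distinctness is required on \<open>Q\<close> alone, since an edge records nothing but
  the values there.\<close>

definition full_vectors :: "nat \<Rightarrow> (nat \<Rightarrow> int) set" where
  "full_vectors n = {vec_index x |x. x \<in> solutions A \<and> vec_set x \<subseteq> {1..int n} \<and> inj_on (vec_index x) Q}"

definition full_edges :: "nat \<Rightarrow> int set set" where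
  "full_edges n = (\<lambda>x. x ` Q) ` full_vectors n"

text \<open>No upper bound is put on the entries, so the set of patterns does not vary with
  \<open>n\<close>.\<close>

definition patterns :: "nat set set set" where
  "patterns = {entry_partition x |x. x \<in> nontrivial_solutions A \<and> (\<forall>i\<in>I. x $ i \<ge> 1) \<and>
    \<not> inj_on (vec_index x) Q}"

definition merged :: "nat set \<Rightarrow> nat \<Rightarrow> rat" where
  "merged T = (\<Sum>i\<in>T. c i)"

text \<open>The exponent of \<open>n\<close> in the expected number of value sets on the blocks in
  \<open>S\<close> that survive, for p = n^(-1/\<mu>).\<close>

definition \<Psi> :: "nat set set \<Rightarrow> nat set set \<Rightarrow> real" where
  "\<Psi> P S = real_of_int (rat_fun.proj_dim P merged S) - real (card S) / \<mu>"

text \<open>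
  A nontrivial solution with repeated entries on \<open>Q\<close> determines, through its pattern \<open>P\<close>, a
  subset of the blocks for which the expected number of copies is bounded, and which is strictly
  balanced because it is minimal.
\<close>

definition is_core :: "nat set set \<Rightarrow> nat set set \<Rightarrow> bool" where
  "is_core P K \<longleftrightarrow> K \<subseteq> P \<and> 2 \<le> card K \<and> card K \<le> card Q \<and> \<Psi> P K \<le> 0 \<and>
    (\<forall>W. W \<subset> K \<longrightarrow> W \<noteq> {} \<longrightarrow> \<Psi> P W > 0)"

definition core :: "nat set set \<Rightarrow> nat set set" where
  "core P = (SOME K. is_core P K)"

definition short_vectors :: "nat \<Rightarrow> nat set set \<Rightarrow> (nat set \<Rightarrow> int) set" where
  "short_vectors n P =
    {\<lambda>T. x $ Min T |x. x \<in> solutions A \<and> entry_partition x = P \<and> vec_set x \<subseteq> {1..int n}}"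

definition short_edges_of :: "nat \<Rightarrow> nat set set \<Rightarrow> int set set" where
  "short_edges_of n P = (\<lambda>y. y ` core P) ` short_vectors n P"

definition short_edges :: "nat \<Rightarrow> int set set" where
  "short_edges n = (\<Union>P\<in>patterns. short_edges_of n P)"

lemma finite_Q: "finite Q"
  using Q(1) finite_subset by blast

lemma Q_nonempty: "Q \<noteq> {}"
  using Q(2) by auto

lemma solution_dim: "x \<in> solutions A \<Longrightarrow> dim_vec x = dim_col A"
  by (auto simp: solutions_def)

lemma value_in_vec_set: "x \<in> solutions A \<Longrightarrow> i \<in> I \<Longrightarrow> x $ i \<in> vec_set x"
  using solution_dim by (auto intro!: vec_setI)

lemma block_min:
  assumes "x \<in> solutions A" "T \<in> entry_partition x"
  shows "Min T \<in> I" "T = {j. j < dim_vec x \<and> x $ j = x $ Min T}"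
proof -
  have T: "finite T" "T \<noteq> {}" "T \<subseteq> I" using assms solution_dim by (auto simp: entry_partition_def)
  then have min: "Min T \<in> T" by (intro Min_in)
  then show "Min T \<in> I" using T by blast
  obtain i where i: "T = {j. j < dim_vec x \<and> x $ j = x $ i}"
    using assms(2) by (auto simp: entry_partition_def)
  have "x $ Min T = x $ i" using min unfolding i by blast
  then show "T = {j. j < dim_vec x \<and> x $ j = x $ Min T}" using i by simp
qed

lemma inj_on_block_value: "x \<in> solutions A \<Longrightarrow> inj_on (\<lambda>T. x $ Min T) (entry_partition x)"
proof (rule inj_onI)
  fix S T assume x: "x \<in> solutions A" and ST: "S \<in> entry_partition x" "T \<in> entry_partition x"
    and eq: "x $ Min S = x $ Min T"
  have "S = {j. j < dim_vec x \<and> x $ j = x $ Min S}" by (rule block_min(2)[OF x ST(1)])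
  also have "\<dots> = {j. j < dim_vec x \<and> x $ j = x $ Min T}" unfolding eq ..
  also have "\<dots> = T" by (rule block_min(2)[OF x ST(2), symmetric])
  finally show "S = T" .
qed

lemma finite_entry_partition: "finite (entry_partition x)"
  by (simp add: entry_partition_def)

lemma finite_patterns: "finite patterns"
proof (rule finite_subset)
  show "patterns \<subseteq> Pow (Pow I)"
    by (auto simp: patterns_def nontrivial_solutions_def entry_partition_def solution_dim)
qed simp

lemma proj_dim_block_pos:
  assumes x: "x \<in> solutions A" "\<forall>i\<in>I. x $ i \<ge> 1" and T: "T \<in> entry_partition x"
  shows "rat_fun.proj_dim (entry_partition x) merged {T} \<ge> 1"
proof -
  let ?P = "entry_partition x"
  obtain D where D: "D \<subseteq> {T} - {}"
    "int (card D) = rat_fun.proj_dim ?P merged {T} - rat_fun.proj_dim ?P merged {}"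
    "\<forall>z. (\<Sum>i\<in>?P. (\<lambda>k. z i * merged i k)) = 0 \<longrightarrow> (\<forall>i\<in>{} \<union> D. z i = 0) \<longrightarrow> (\<forall>i\<in>{T}. z i = 0)"
    by (rule rat_fun.proj_dim_determining_set[of ?P "{T}" "{}" merged])
      (use T finite_entry_partition in auto)
  have "D \<noteq> {}"
  proof
    assume "D = {}"
    then have "rat_of_int (x $ Min T) = 0"
      using D(3)[THEN spec, of "\<lambda>T. rat_of_int (x $ Min T)"] merged_column_sum[OF x(1)]
      by (simp add: merged_def)
    moreover have "x $ Min T \<ge> 1" using x(2) block_min(1)[OF x(1) T] by blast
    ultimately show False by simp
  qed
  then have "D = {T}" using D(1) by auto
  then show ?thesis using D(2) by simp
qed

text \<open>\<open>R\<close> has one block for each value that \<open>x\<close> takes on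
  \<open>Q\<close>. Having fewer blocks than \<open>Q\<close> has elements pushes its exponent to at
  most 0, and a minimal nonempty subset with that property is a core.\<close>

lemma core_exists:
  assumes "P \<in> patterns"
  shows "\<exists>K. is_core P K"
proof -
  obtain x where x: "x \<in> nontrivial_solutions A" "\<forall>i\<in>I. x $ i \<ge> 1"
    "\<not> inj_on (vec_index x) Q" "P = entry_partition x"
    using assms by (auto simp: patterns_def)
  have xs: "x \<in> solutions A" using x(1) by (simp add: nontrivial_solutions_def)
  have P: "\<Union>P = I" "{} \<notin> P" "disjoint P"
    using entry_partition_properties[of x] solution_dim[OF xs] x(4) by auto
  have finP: "finite P" using x(4) finite_entry_partition by simp
  define R where "R = {T \<in> P. T \<inter> Q \<noteq> {}}"
  have finR: "finite R" using finP by (simp add: R_def)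
  have R_eq: "R = (\<lambda>i. {j. j < dim_vec x \<and> x $ j = x $ i}) ` Q"
  proof
    show "R \<subseteq> (\<lambda>i. {j. j < dim_vec x \<and> x $ j = x $ i}) ` Q"
    proof
      fix T assume "T \<in> R"
      then obtain k i where T: "T = {j. j < dim_vec x \<and> x $ j = x $ k}" and i: "i \<in> T" "i \<in> Q"
        by (auto simp: R_def x(4) entry_partition_def)
      have "x $ i = x $ k" using i(1) unfolding T by simp
      then have "T = {j. j < dim_vec x \<and> x $ j = x $ i}" using T by simp
      then show "T \<in> (\<lambda>i. {j. j < dim_vec x \<and> x $ j = x $ i}) ` Q" using i(2) by (rule image_eqI)
    qed
    show "(\<lambda>i. {j. j < dim_vec x \<and> x $ j = x $ i}) ` Q \<subseteq> R"
    proof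
      fix T assume "T \<in> (\<lambda>i. {j. j < dim_vec x \<and> x $ j = x $ i}) ` Q"
      then obtain i where T: "T = {j. j < dim_vec x \<and> x $ j = x $ i}" and i: "i \<in> Q" by (rule imageE)
      have "i < dim_vec x" using i Q(1) solution_dim[OF xs] by auto
      then have "T \<in> P" "i \<in> T" unfolding x(4) entry_partition_def T by auto
      then show "T \<in> R" using i by (auto simp: R_def)
    qed
  qed
  have "card R < card Q"
  proof -
    have "card R \<le> card Q" unfolding R_eq by (intro card_image_le finite_Q)
    moreover have "card R \<noteq> card Q"
    proof
      assume "card R = card Q"
      then have inj: "inj_on (\<lambda>i. {j. j < dim_vec x \<and> x $ j = x $ i}) Q"
        unfolding R_eq by (rule eq_card_imp_inj_on[OF finite_Q])
      have "inj_on (vec_index x) Q" by (rule inj_onI) (rule inj_onD[OF inj], simp_all)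
      then show False using x(3) by simp
    qed
    ultimately show ?thesis by simp
  qed
  have rank: "rat_fun.dim ((\<lambda>T. \<Sum>i\<in>T. c i) ` P) = rat_fun.dim (c ` I)"
    using x(1,4) int_rank_contract_columns[OF P] int_rank_eq_dim[of A]
    by (simp add: nontrivial_solutions_def)
  have "rat_fun.proj_dim P merged R \<le> d Q - (int (card Q) - int (card R))"
    using rat_fun.proj_dim_merge[OF _ P(1) Q(1) rank] unfolding R_def d_def merged_def[abs_def] by simp
  then have "\<Psi> P R \<le> real_of_int (d Q) - (real (card Q) - real (card R)) - real (card R) / \<mu>"
    unfolding \<Psi>_def by linarith
  \<comment> \<open>As \<phi> Q = 0, the exponent of \<open>Q\<close> itself is 1 - 1/\<mu>, and
    every lost value lowers it by that same amount. One lost value is enough.\<close>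
  also have "\<dots> = (1 - (real (card Q) - real (card R))) * (1 - 1 / \<mu>)"
    using Q(3) \<mu>_gt_1 by (simp add: \<phi>_def field_simps)
  also have "\<dots> \<le> 0"
    using \<open>card R < card Q\<close> \<mu>_gt_1 by (intro mult_nonpos_nonneg) (auto simp: field_simps)
  finally have \<Psi>R: "\<Psi> P R \<le> 0" .
  have "R \<noteq> {}" using R_eq Q_nonempty by auto
  define \<K> where "\<K> = {K. K \<subseteq> R \<and> K \<noteq> {} \<and> \<Psi> P K \<le> 0}"
  have "finite \<K>" by (rule finite_subset[of _ "Pow R"]) (use finR in \<open>auto simp: \<K>_def\<close>)
  moreover have "\<K> \<noteq> {}" using \<Psi>R \<open>R \<noteq> {}\<close> by (auto simp: \<K>_def)
  ultimately obtain K where K: "K \<in> \<K>" "\<forall>W\<in>\<K>. W \<le> K \<longrightarrow> K = W"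
    using finite_has_minimal[of \<K>] by metis
  have KR: "K \<subseteq> R" "K \<noteq> {}" "\<Psi> P K \<le> 0" using K(1) by (auto simp: \<K>_def)
  have min: "\<Psi> P W > 0" if W: "W \<subset> K" "W \<noteq> {}" for W
  proof (rule ccontr)
    assume "\<not> \<Psi> P W > 0"
    then have "W \<in> \<K>" using W KR by (auto simp: \<K>_def)
    then show False using K(2) W by auto
  qed
  \<comment> \<open>A single block takes nonzero values, so its dimension is at least 1 and its
    exponent at least 1 - 1/\<mu>, which is positive.\<close>
  have "card K \<noteq> 1"
  proof
    assume "card K = 1"
    then obtain T where T: "K = {T}" by (rule card_1_singletonE)
    then have "T \<in> entry_partition x" using KR x(4) by (auto simp: R_def)
    then have "rat_fun.proj_dim P merged {T} \<ge> 1" using proj_dim_block_pos[OF xs x(2)] x(4) by simp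
    then have "real_of_int (rat_fun.proj_dim P merged {T}) \<ge> 1" by linarith
    moreover have "1 / \<mu> < 1" using \<mu>_gt_1 by simp
    moreover have "real_of_int (rat_fun.proj_dim P merged {T}) - 1 / \<mu> \<le> 0"
      using KR(3) T by (simp add: \<Psi>_def)
    ultimately show False by linarith
  qed
  moreover have "card K \<noteq> 0" using KR(2) finite_subset[OF KR(1) finR] by simp
  ultimately have "card K \<ge> 2" by simp
  moreover have "card K \<le> card Q"
    using card_mono[OF finR KR(1)] \<open>card R < card Q\<close> by simp
  moreover have "K \<subseteq> P" using KR(1) by (auto simp: R_def)
  ultimately show ?thesis unfolding is_core_def using KR(3) min by blast
qed

lemma is_core: "P \<in> patterns \<Longrightarrow> is_core P (core P)"
  unfolding core_def by (rule someI_ex) (rule core_exists)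

text \<open>Hence a colouring without monochromatic edges has no monochromatic nontrivial solution
  either.\<close>

lemma edge_in_vec_set:
  assumes x: "x \<in> nontrivial_solutions A" "vec_set x \<subseteq> {1..int n}"
  shows "\<exists>e\<in>full_edges n \<union> short_edges n. e \<subseteq> vec_set x"
proof -
  have xs: "x \<in> solutions A" using x(1) by (simp add: nontrivial_solutions_def)
  show ?thesis
  proof (cases "inj_on (vec_index x) Q")
    case True
    then have "vec_index x ` Q \<in> full_edges n" using xs x(2) by (auto simp: full_edges_def full_vectors_def)
    moreover have "vec_index x ` Q \<subseteq> vec_set x" using value_in_vec_set[OF xs] Q(1) by auto
    ultimately show ?thesis by blast
  next
    case False
    let ?P = "entry_partition x"
    have "\<forall>i\<in>I. x $ i \<ge> 1" using value_in_vec_set[OF xs] x(2) by fastforce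
    then have P: "?P \<in> patterns" using x(1) False by (auto simp: patterns_def)
    have "(\<lambda>T. x $ Min T) \<in> short_vectors n ?P" using xs x(2) by (auto simp: short_vectors_def)
    then have "(\<lambda>T. x $ Min T) ` core ?P \<in> short_edges n"
      using P by (auto simp: short_edges_def short_edges_of_def)
    moreover have "core ?P \<subseteq> ?P" using is_core[OF P] by (simp add: is_core_def)
    then have "(\<lambda>T. x $ Min T) ` core ?P \<subseteq> vec_set x"
      using block_min(1)[OF xs] value_in_vec_set[OF xs] by blast
    ultimately show ?thesis by blast
  qed
qed

lemma full_vectors_props:
  assumes "x \<in> full_vectors n"
  shows "(\<Sum>i\<in>I. (\<lambda>k. rat_of_int (x i) * c i k)) = 0" "inj_on x Q"
    "\<And>i. i \<in> Q \<Longrightarrow> x i \<in> {1..int n}"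
proof -
  obtain v where v: "x = vec_index v" "v \<in> solutions A" "vec_set v \<subseteq> {1..int n}" "inj_on x Q"
    using assms by (auto simp: full_vectors_def)
  show "(\<Sum>i\<in>I. (\<lambda>k. rat_of_int (x i) * c i k)) = 0" using solution_column_sum[OF v(2)] v(1) by simp
  show "inj_on x Q" by (rule v)
  show "x i \<in> {1..int n}" if "i \<in> Q" for i
  proof -
    have "v $ i \<in> vec_set v" using that Q(1) by (intro value_in_vec_set[OF v(2)]) blast
    then show ?thesis using v(1,3) by blast
  qed
qed

lemma short_vectors_props:
  assumes "y \<in> short_vectors n P" "P \<in> patterns"
  shows "(\<Sum>T\<in>P. (\<lambda>k. rat_of_int (y T) * merged T k)) = 0" "inj_on y (core P)"
    "\<And>T. T \<in> core P \<Longrightarrow> y T \<in> {1..int n}"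
proof -
  obtain x where x: "y = (\<lambda>T. x $ Min T)" "x \<in> solutions A" "P = entry_partition x"
    "vec_set x \<subseteq> {1..int n}"
    using assms(1) by (auto simp: short_vectors_def)
  have core: "core P \<subseteq> P" using is_core[OF assms(2)] by (simp add: is_core_def)
  show "(\<Sum>T\<in>P. (\<lambda>k. rat_of_int (y T) * merged T k)) = 0"
    using merged_column_sum[OF x(2)] x(1,3) by (simp add: merged_def)
  show "inj_on y (core P)"
    using inj_on_subset[OF inj_on_block_value[OF x(2)]] core x(1,3) by simp
  show "y T \<in> {1..int n}" if "T \<in> core P" for T
  proof -
    have "T \<in> entry_partition x" using that core x(3) by blast
    then have "x $ Min T \<in> vec_set x" by (intro value_in_vec_set[OF x(2)] block_min(1)[OF x(2)])
    then show ?thesis using x(1,4) by blast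
  qed
qed

lemma full_edges_props: "e \<in> full_edges n \<Longrightarrow> card e = card Q \<and> e \<subseteq> {1..int n}"
  using full_vectors_props by (auto simp: full_edges_def card_image)

lemma short_edges_of_props:
  "P \<in> patterns \<Longrightarrow> e \<in> short_edges_of n P \<Longrightarrow> card e = card (core P) \<and> e \<subseteq> {1..int n}"
  using short_vectors_props by (auto simp: short_edges_of_def card_image)

lemma short_edges_props:
  "e \<in> short_edges n \<Longrightarrow> finite e \<and> 2 \<le> card e \<and> card e \<le> card Q \<and> e \<subseteq> {1..int n}"
  using short_edges_of_props[of _ e n] is_core finite_subset[of e "{1..int n}"]
  by (fastforce simp: short_edges_def is_core_def)

lemma finite_full_edges: "finite (full_edges n)"
  by (rule finite_subset[of _ "Pow {1..int n}"]) (use full_edges_props in auto)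

lemma finite_short_edges: "finite (short_edges n)"
  by (rule finite_subset[of _ "Pow {1..int n}"]) (use short_edges_props in auto)

section \<open>Degree and weight bounds for the two kinds of edges\<close>

definition K\<^sub>0 :: real where
  "K\<^sub>0 = 2 ^ card Q * (real (card Q) + 1) ^ card Q"

lemma full_edges_weight:
  assumes n: "n \<ge> 1" and S: "finite S"
    and p: "0 \<le> p" "p \<le> a * real n powr (- 1 / \<mu>)" "0 \<le> a"
    and \<gamma>: "\<And>W. W \<subseteq> Q \<Longrightarrow> card W = card S \<Longrightarrow> 1 - 1 / \<mu> - (real_of_int (d W) - real (card W) / \<mu>) \<le> \<gamma>"
  shows "(\<Sum>e | e \<in> full_edges n \<and> S \<subseteq> e. p ^ (card e - card S)) \<le>
    K\<^sub>0 * a ^ (card Q - card S) * real n powr \<gamma>"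
  unfolding full_edges_def K\<^sub>0_def
proof (rule edge_weight_containing[where I = I and c = c and \<mu> = \<mu>])
  fix W assume W: "W \<subseteq> Q" "card W = card S"
  have "real_of_int (d Q) - real (card Q) / \<mu> = 1 - 1 / \<mu>"
    using Q(3) \<mu>_gt_1 by (simp add: \<phi>_def field_simps)
  then show "real_of_int (rat_fun.proj_dim I c Q) - real (card Q) / \<mu> -
      (real_of_int (rat_fun.proj_dim I c W) - real (card W) / \<mu>) \<le> \<gamma>"
    using \<gamma>[OF W] unfolding d_def by linarith
qed (use n S p Q full_vectors_props in auto)

lemma short_edges_of_weight:
  assumes P: "P \<in> patterns" and n: "n \<ge> 1" and S: "finite S"
    and p: "0 \<le> p" "p \<le> a * real n powr (- 1 / \<mu>)" "0 \<le> a" "a \<le> 1"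
    and \<gamma>: "\<And>W. W \<subseteq> core P \<Longrightarrow> card W = card S \<Longrightarrow> - \<Psi> P W \<le> \<gamma>"
  shows "(\<Sum>e | e \<in> short_edges_of n P \<and> S \<subseteq> e. p ^ (card e - card S)) \<le> K\<^sub>0 * real n powr \<gamma>"
proof -
  have core: "core P \<subseteq> P" "card (core P) \<le> card Q" "\<Psi> P (core P) \<le> 0"
    using is_core[OF P] by (auto simp: is_core_def)
  have finP: "finite P" using P finite_entry_partition by (auto simp: patterns_def)
  let ?k = "card (core P)"
  have "(\<Sum>e | e \<in> short_edges_of n P \<and> S \<subseteq> e. p ^ (card e - card S)) \<le>
      2 ^ ?k * (real ?k + 1) ^ ?k * a ^ (?k - card S) * real n powr \<gamma>"
    unfolding short_edges_of_def
  proof (rule edge_weight_containing[where I = P and c = merged and \<mu> = \<mu>])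
    fix W assume W: "W \<subseteq> core P" "card W = card S"
    show "real_of_int (rat_fun.proj_dim P merged (core P)) - real ?k / \<mu> -
      (real_of_int (rat_fun.proj_dim P merged W) - real (card W) / \<mu>) \<le> \<gamma>"
      using \<gamma>[OF W] core(3) unfolding \<Psi>_def by linarith
  qed (use n S p P core finP short_vectors_props in auto)
  also have "\<dots> \<le> K\<^sub>0 * 1 * real n powr \<gamma>"
    unfolding K\<^sub>0_def
  proof (intro mult_right_mono mult_mono)
    show "(real ?k + 1) ^ ?k \<le> (real (card Q) + 1) ^ card Q"
      using core(2) by (intro order_trans[OF power_mono power_increasing]) auto
  qed (use core(2) p in \<open>auto intro!: power_le_one power_increasing\<close>)
  finally show ?thesis by simp
qed

text \<open>Strict balance gives positive exponents only one at a time; as there are finitely many,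
  independently of \<open>n\<close>, they have a common positive lower bound.\<close>

lemma gap:
  obtains \<delta> where "\<delta> > 0" "\<And>W. W \<subset> Q \<Longrightarrow> 2 \<le> card W \<Longrightarrow> \<delta> \<le> \<phi> W"
    "\<And>P W. P \<in> patterns \<Longrightarrow> W \<subset> core P \<Longrightarrow> W \<noteq> {} \<Longrightarrow> \<delta> \<le> \<Psi> P W"
proof -
  define B1 where "B1 = \<phi> ` {W. W \<subset> Q \<and> 2 \<le> card W}"
  define B2 where "B2 = (\<Union>P\<in>patterns. \<Psi> P ` {W. W \<subset> core P \<and> W \<noteq> {}})"
  \<comment> \<open>The 1 keeps the set nonempty, so that \<open>Min\<close> is meaningful.\<close>
  define B where "B = insert 1 (B1 \<union> B2)"
  have "finite B1" unfolding B1_def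
    by (rule finite_imageI, rule finite_subset[of _ "Pow Q"]) (use finite_Q in auto)
  moreover have "finite B2" unfolding B2_def
  proof (intro finite_UN_I finite_patterns finite_imageI)
    fix P assume "P \<in> patterns"
    then have "card (core P) \<ge> 2" using is_core by (auto simp: is_core_def)
    then have fin: "finite (core P)" by (metis card.infinite not_numeral_le_zero)
    show "finite {W. W \<subset> core P \<and> W \<noteq> {}}"
      by (rule finite_subset[of _ "Pow (core P)"]) (use fin in auto)
  qed
  ultimately have finB: "finite B" by (simp add: B_def)
  have "\<forall>b\<in>B. b > 0" using \<phi>_pos is_core by (auto simp: B_def B1_def B2_def is_core_def)
  then have "Min B > 0" using finB by (subst Min_gr_iff) (auto simp: B_def)
  moreover have "Min B \<le> b" if "b \<in> B" for b using finB that by simp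
  ultimately show thesis by (intro that[of "Min B"]) (auto simp: B_def B1_def B2_def)
qed

text \<open>For full edges through one, two or more given vertices the exponents of \<open>n\<close>
  are 0, -(1 - 1/\<mu>) and at most -\<delta>. For short edges they are at most 0 in total and at
  most -\<delta> through a nonempty proper subset.\<close>

lemma sparse_edges:
  obtains C \<delta> :: real where "C \<ge> 1" "\<delta> > 0"
    "\<And>n p a \<theta>. n \<ge> 1 \<Longrightarrow> 0 \<le> p \<Longrightarrow> p \<le> a * real n powr (- 1 / \<mu>) \<Longrightarrow> 0 < a \<Longrightarrow> a \<le> 1 \<Longrightarrow>
      C * a \<le> \<theta> \<Longrightarrow> real (card Q) * \<theta> * (2 ^ card Q) ^ 3 \<le> 1 / 2 \<Longrightarrow>
      sparse_hypergraph (full_edges n) (short_edges n) (card Q) p C (real n powr (1 - 1 / \<mu>))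
        (real n powr - \<delta>) \<theta>"
proof -
  obtain \<delta> where \<delta>: "\<delta> > 0" "\<And>W. W \<subset> Q \<Longrightarrow> 2 \<le> card W \<Longrightarrow> \<delta> \<le> \<phi> W"
    "\<And>P W. P \<in> patterns \<Longrightarrow> W \<subset> core P \<Longrightarrow> W \<noteq> {} \<Longrightarrow> \<delta> \<le> \<Psi> P W"
    using gap by blast
  \<comment> \<open>Large enough for the full edges, which need \<open>K\<^sub>0\<close>, and for
    the union of the short edges over all patterns.\<close>
  define C where "C = K\<^sub>0 * (real (card patterns) + 1)"
  have K0: "K\<^sub>0 \<ge> 1"
  proof -
    have "1 * 1 \<le> K\<^sub>0" unfolding K\<^sub>0_def by (intro mult_mono one_le_power) auto
    then show ?thesis by simp
  qed
  have KC: "K\<^sub>0 \<le> C" unfolding C_def using K0 mult_left_mono[of 1 "real (card patterns) + 1" K\<^sub>0] by simp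
  have patC: "real (card patterns) * K\<^sub>0 \<le> C" unfolding C_def using K0 by (simp add: algebra_simps)
  have C1: "C \<ge> 1" using K0 KC by simp
  have "sparse_hypergraph (full_edges n) (short_edges n) (card Q) p C (real n powr (1 - 1 / \<mu>))
        (real n powr - \<delta>) \<theta>"
    if n: "n \<ge> 1" and p: "0 \<le> p" "p \<le> a * real n powr (- 1 / \<mu>)" and a: "0 < a" "a \<le> 1"
      and \<theta>: "C * a \<le> \<theta>" "real (card Q) * \<theta> * (2 ^ card Q) ^ 3 \<le> 1 / 2" for n p a \<theta>
  proof
    have weaken: "K\<^sub>0 * a ^ k * real n powr \<gamma> \<le> C * real n powr \<gamma>" for k \<gamma>
    proof -
      have "K\<^sub>0 * a ^ k \<le> C * 1" using KC a K0 C1 by (intro mult_mono power_le_one) auto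
      then show ?thesis by (intro mult_right_mono) auto
    qed
    have full: "(\<Sum>e | e \<in> full_edges n \<and> S \<subseteq> e. p ^ (card e - card S)) \<le> C * real n powr \<gamma>"
      if "finite S" "\<And>W. W \<subseteq> Q \<Longrightarrow> card W = card S \<Longrightarrow>
        1 - 1 / \<mu> - (real_of_int (d W) - real (card W) / \<mu>) \<le> \<gamma>" for S \<gamma>
      using full_edges_weight[OF n that(1) p _ that(2)] weaken a by (meson less_imp_le order_trans)
    show "finite (full_edges n)" "finite (short_edges n)"
      by (rule finite_full_edges finite_short_edges)+
    show "card e = card Q" if "e \<in> full_edges n" for e using full_edges_props that by blast
    show "3 \<le> card Q" by (rule Q)
    show "finite e \<and> 2 \<le> card e \<and> card e \<le> card Q" if "e \<in> short_edges n" for e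
      using short_edges_props that by blast
    show "0 \<le> p" "1 \<le> C" by fact+
    show "0 < real n powr (1 - 1 / \<mu>)" "0 \<le> real n powr - \<delta>" using n by auto
    show "0 \<le> \<theta>" using \<theta>(1) C1 a mult_nonneg_nonneg[of C a] by linarith
    show "real (card Q) * \<theta> * (2 ^ card Q) ^ 3 \<le> 1 / 2" by (rule \<theta>)
    show "(\<Sum>e\<in>full_edges n. p ^ card e) \<le> C * real n powr (1 - 1 / \<mu>)"
    proof -
      have "(\<Sum>e | e \<in> full_edges n \<and> {} \<subseteq> e. p ^ (card e - card ({} :: int set))) \<le> C * real n powr (1 - 1 / \<mu>)"
      proof (rule full)
        fix W assume "W \<subseteq> Q" "card W = card ({} :: int set)"
        then have "W = {}" using finite_Q finite_subset by fastforce
        then show "1 - 1 / \<mu> - (real_of_int (d W) - real (card W) / \<mu>) \<le> 1 - 1 / \<mu>"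
          by (simp add: d_def)
      qed simp
      then show ?thesis by simp
    qed
    \<comment> \<open>The exponent of \<open>n\<close> is 0 here, so the degree is small only
      because of the factor \<open>a ^ (card Q - 1)\<close>, which is at most
      \<open>a\<close>.\<close>
    show "(\<Sum>e | e \<in> full_edges n \<and> v \<in> e. p ^ (card e - 1)) \<le> \<theta>" for v
    proof -
      have "(\<Sum>e | e \<in> full_edges n \<and> {v} \<subseteq> e. p ^ (card e - card {v})) \<le>
          K\<^sub>0 * a ^ (card Q - card {v}) * real n powr 0"
      proof (rule full_edges_weight[OF n _ p])
        fix W assume W: "W \<subseteq> Q" "card W = card {v}"
        then have "card W = 1" by simp
        then obtain i where "W = {i}" by (rule card_1_singletonE)
        then show "1 - 1 / \<mu> - (real_of_int (d W) - real (card W) / \<mu>) \<le> 0"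
          using d_singleton[of i] W Q(1) by auto
      qed (use a in auto)
      also have "\<dots> \<le> K\<^sub>0 * a ^ 1"
      proof -
        have "a ^ (card Q - card {v}) \<le> a ^ 1" using a Q(2) by (intro power_decreasing) auto
        then show ?thesis using n K0 by simp
      qed
      also have "\<dots> \<le> C * a" using KC a by simp
      also have "\<dots> \<le> \<theta>" by (rule \<theta>)
      finally show ?thesis by simp
    qed
    show "(\<Sum>e | e \<in> full_edges n \<and> S \<subseteq> e. p ^ (card e - 2)) \<le> C / real n powr (1 - 1 / \<mu>)"
      if S: "card S = 2" for S
    proof -
      have "(\<Sum>e | e \<in> full_edges n \<and> S \<subseteq> e. p ^ (card e - card S)) \<le> C * real n powr (- (1 - 1 / \<mu>))"
      proof (rule full)
        show "finite S" using S by (metis card.infinite zero_neq_numeral)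
        fix W assume W: "W \<subseteq> Q" "card W = card S"
        then obtain i j where "W = {i, j}" "i \<noteq> j" using S by (auto simp: card_2_iff)
        then have "d W = 2" using d_pair[of i j] W Q(1) by auto
        then show "1 - 1 / \<mu> - (real_of_int (d W) - real (card W) / \<mu>) \<le> - (1 - 1 / \<mu>)"
          using W S by simp
      qed
      then show ?thesis unfolding powr_minus_divide S by simp
    qed
    show "(\<Sum>e | e \<in> full_edges n \<and> S \<subseteq> e. p ^ (card e - card S)) \<le> C * real n powr - \<delta>"
      if S: "2 \<le> card S" "card S < card Q" for S
    proof (rule full)
      show "finite S" using S by (metis card.infinite not_numeral_le_zero)
      fix W assume W: "W \<subseteq> Q" "card W = card S"
      then have "W \<subset> Q" using S by auto
      then have "\<delta> \<le> \<phi> W" using \<delta>(2) W S by simp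
      then show "1 - 1 / \<mu> - (real_of_int (d W) - real (card W) / \<mu>) \<le> - \<delta>"
        by (simp add: \<phi>_def diff_divide_distrib)
    qed
    have union: "(\<Sum>e | e \<in> short_edges n \<and> R e. f e) \<le> C * g"
      if "g \<ge> 0" "\<And>e. f e \<ge> 0"
        "\<And>P. P \<in> patterns \<Longrightarrow> (\<Sum>e | e \<in> short_edges_of n P \<and> R e. f e) \<le> K\<^sub>0 * g"
      for R and f :: "int set \<Rightarrow> real" and g
    proof -
      have eq: "{e. e \<in> short_edges n \<and> R e} = (\<Union>P\<in>patterns. {e. e \<in> short_edges_of n P \<and> R e})"
        by (auto simp: short_edges_def)
      have fin: "finite {e. e \<in> short_edges_of n P \<and> R e}" if "P \<in> patterns" for P
        by (rule finite_subset[OF _ finite_short_edges[of n]]) (use that in \<open>auto simp: short_edges_def\<close>)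
      have "(\<Sum>e | e \<in> short_edges n \<and> R e. f e) \<le>
          (\<Sum>P\<in>patterns. \<Sum>e | e \<in> short_edges_of n P \<and> R e. f e)"
        unfolding eq using finite_patterns fin that(2) by (intro sum_UN_le) auto
      also have "\<dots> \<le> (\<Sum>P\<in>patterns. K\<^sub>0 * g)" using that(3) by (intro sum_mono)
      also have "\<dots> = real (card patterns) * K\<^sub>0 * g" by simp
      also have "\<dots> \<le> C * g" using patC that(1) by (intro mult_right_mono)
      finally show ?thesis .
    qed
    show "(\<Sum>e\<in>short_edges n. p ^ card e) \<le> C"
    proof -
      have "(\<Sum>e | e \<in> short_edges n \<and> {} \<subseteq> e. p ^ (card e - card ({} :: int set))) \<le> C * 1"
      proof (rule union)
        fix P assume P: "P \<in> patterns"
        have "(\<Sum>e | e \<in> short_edges_of n P \<and> {} \<subseteq> e. p ^ (card e - card ({} :: int set))) \<le> K\<^sub>0 * real n powr 0"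
        proof (rule short_edges_of_weight[OF P n _ p])
          fix W assume W: "W \<subseteq> core P" "card W = card ({} :: int set)"
          have "card (core P) \<ge> 2" using is_core[OF P] by (simp add: is_core_def)
          then have "finite W" using W finite_subset by (metis card.infinite not_numeral_le_zero)
          then show "- \<Psi> P W \<le> 0" using W by (simp add: \<Psi>_def)
        qed (use a in auto)
        then show "(\<Sum>e | e \<in> short_edges_of n P \<and> {} \<subseteq> e. p ^ (card e - card ({} :: int set))) \<le> K\<^sub>0 * 1"
          using n by simp
      qed (use p in auto)
      then show ?thesis by simp
    qed
    show "(\<Sum>e | e \<in> short_edges n \<and> S \<subset> e. p ^ (card e - card S)) \<le> C * real n powr - \<delta>"
      if S: "S \<noteq> {}" for S
    proof (rule union)
      fix P assume P: "P \<in> patterns"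
      have fin_core: "finite (core P)"
        using is_core[OF P] by (metis card.infinite is_core_def not_numeral_le_zero)
      show "(\<Sum>e | e \<in> short_edges_of n P \<and> S \<subset> e. p ^ (card e - card S)) \<le> K\<^sub>0 * real n powr - \<delta>"
      \<comment> \<open>Strict balance needs a proper nonempty \<open>W\<close>. Otherwise
        \<open>S\<close> is infinite or has as many elements as an edge, and no edge contains it
        properly.\<close>
      proof (cases "finite S \<and> card S < card (core P)")
        case True
        have fin: "finite (short_edges_of n P)"
          by (rule finite_subset[OF _ finite_short_edges[of n]]) (use P in \<open>auto simp: short_edges_def\<close>)
        have "(\<Sum>e | e \<in> short_edges_of n P \<and> S \<subset> e. p ^ (card e - card S)) \<le>
            (\<Sum>e | e \<in> short_edges_of n P \<and> S \<subseteq> e. p ^ (card e - card S))"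
          using fin p by (intro sum_mono2) auto
        also have "\<dots> \<le> K\<^sub>0 * real n powr - \<delta>"
        proof (rule short_edges_of_weight[OF P n _ p])
          fix W assume W: "W \<subseteq> core P" "card W = card S"
          then have "W \<subset> core P" "W \<noteq> {}" using True S by (auto simp: card_gt_0_iff)
          then show "- \<Psi> P W \<le> - \<delta>" using \<delta>(3)[OF P] by simp
        qed (use a True in auto)
        finally show ?thesis .
      next
        case False
        have "\<not> S \<subset> e" if e: "e \<in> short_edges_of n P" for e
        proof
          assume Se: "S \<subset> e"
          have "card e = card (core P)" "finite e"
            using short_edges_of_props[OF P e] finite_subset by auto
          then show False using False psubset_card_mono[of e S] Se finite_subset[of S e] by auto
        qed
        then have "{e. e \<in> short_edges_of n P \<and> S \<subset> e} = {}" by auto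
        then show ?thesis using K0 by (simp only: sum.empty) simp
      qed
    qed (use p in auto)
  qed
  then show thesis using C1 \<delta>(1) that by blast
qed

end

section \<open>From 2-colourings of the random set to the limit\<close>

theorem theorem1p3:
  fixes r m s :: nat and A :: "int mat"
  assumes "A \<in> carrier_mat r m"
    and "A \<noteq> 0\<^sub>m r m"
    and "s \<ge> 2"
    and "partition_regular A"
  shows "\<exists>c::real. c > 0 \<and>
           (\<forall>p :: nat \<Rightarrow> real.
              (\<forall>n. 0 \<le> p n \<and> p n \<le> 1) \<longrightarrow>
              (\<forall>n\<ge>1. p n \<le> c * real n powr (- 1 / max_density A)) \<longrightarrow>
              (\<lambda>n. measure_pmf.prob (binomial_subset n (p n))
                      {T. arrows T s (nontrivial_solutions A)}) \<longlonglongrightarrow> 0)"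
proof -
  have "\<exists>i<dim_row A. \<exists>j<dim_col A. A $$ (i, j) \<noteq> 0"
  proof (rule ccontr)
    assume "\<not> ?thesis"
    then have "A = 0\<^sub>m r m" using assms(1) by (intro eq_matI) auto
    then show False using assms(2) by simp
  qed
  then interpret partition_regular_matrix A using assms(4) by unfold_locales
  obtain Q where "Q \<subseteq> I" "card Q \<ge> 3" "\<phi> Q = 0" "\<And>W. W \<subset> Q \<Longrightarrow> 2 \<le> card W \<Longrightarrow> \<phi> W > 0"
    using strictly_balanced_set by metis
  then interpret strictly_balanced A Q by unfold_locales
  obtain C \<delta> where C: "C \<ge> 1" and \<delta>: "\<delta> > 0" and sparse:
    "\<And>n p a \<theta>. n \<ge> 1 \<Longrightarrow> 0 \<le> p \<Longrightarrow> p \<le> a * real n powr (- 1 / \<mu>) \<Longrightarrow> 0 < a \<Longrightarrow> a \<le> 1 \<Longrightarrow>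
      C * a \<le> \<theta> \<Longrightarrow> real (card Q) * \<theta> * (2 ^ card Q) ^ 3 \<le> 1 / 2 \<Longrightarrow>
      sparse_hypergraph (full_edges n) (short_edges n) (card Q) p C (real n powr (1 - 1 / \<mu>))
        (real n powr - \<delta>) \<theta>"
    by (rule sparse_edges) (rule that; assumption)
  \<comment> \<open>The largest degree that \<open>\<theta>_small\<close> admits. Dividing it by
    \<open>C\<close> gives \<open>a\<close>, which serves as the constant of the theorem.\<close>
  define \<theta> where "\<theta> = 1 / (2 * real (card Q) * (2 ^ card Q) ^ 3)"
  define a where "a = min 1 (\<theta> / C)"
  have "\<theta> > 0" using \<open>card Q \<ge> 3\<close> by (auto simp: \<theta>_def)
  then have a: "0 < a" "a \<le> 1" using C by (auto simp: a_def)
  have "C * a \<le> C * (\<theta> / C)" using C by (intro mult_left_mono) (auto simp: a_def)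
  then have Ca: "C * a \<le> \<theta>" using C by simp
  have \<theta>: "real (card Q) * \<theta> * (2 ^ card Q) ^ 3 \<le> 1 / 2"
    using \<open>card Q \<ge> 3\<close> by (simp add: \<theta>_def field_simps)
  define L where "L = 20 * C ^ 3 * (2 ^ card Q) ^ 6"
  have "(\<lambda>n. measure_pmf.prob (binomial_subset n (p n))
          {T. arrows T s (nontrivial_solutions A)}) \<longlonglongrightarrow> 0"
    if p: "\<forall>n. 0 \<le> p n \<and> p n \<le> 1" "\<forall>n\<ge>1. p n \<le> a * real n powr (- 1 / \<mu>)" for p :: "nat \<Rightarrow> real"
  proof -
    have bound: "measure_pmf.prob (binomial_subset n (p n)) {T. arrows T s (nontrivial_solutions A)} \<le>
        L * real n powr - \<delta>" if n: "n \<ge> 1" for n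
    proof -
      have "\<exists>e\<in>full_edges n \<union> short_edges n. e \<subseteq> T \<and> (e \<subseteq> B \<or> e \<inter> B = {})"
        if T: "T \<subseteq> {1..int n}" "arrows T s (nontrivial_solutions A)" for T B
      proof -
        \<comment> \<open>The 2-colouring given by \<open>B\<close>, filled up with empty parts to
          \<open>s\<close> colours.\<close>
        define P where "P k = (if k = 1 then T \<inter> B else if k = 2 then T - B else {})" for k :: nat
        have "disjoint_family_on P {1..s} \<and> (\<Union>i\<in>{1..s}. P i) = T"
        proof
          show "disjoint_family_on P {1..s}" by (auto simp: disjoint_family_on_def P_def)
          have "(1::nat) \<in> {1..s}" "(2::nat) \<in> {1..s}" using assms(3) by auto
          then have "P 1 \<union> P 2 \<subseteq> (\<Union>i\<in>{1..s}. P i)" by blast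
          then show "(\<Union>i\<in>{1..s}. P i) = T" by (auto simp: P_def split: if_splits)
        qed
        from T(2)[unfolded arrows_def, THEN spec, THEN mp, OF this]
        obtain k x where x: "x \<in> nontrivial_solutions A" "vec_set x \<subseteq> P k" by blast
        have "P k \<subseteq> T" by (auto simp: P_def)
        then obtain e where e: "e \<in> full_edges n \<union> short_edges n" "e \<subseteq> vec_set x"
          using edge_in_vec_set[OF x(1), of n] x(2) T(1) by (meson order_trans)
        have "e \<subseteq> T" "e \<subseteq> P k" using e x \<open>P k \<subseteq> T\<close> by auto
        moreover have "P k \<subseteq> B \<or> P k \<inter> B = {}" by (auto simp: P_def)
        ultimately show ?thesis using e(1) by blast
      qed
      then have "measure_pmf.prob (binomial_subset n (p n)) {T. arrows T s (nontrivial_solutions A)} \<le>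
          measure_pmf.prob (binomial_subset n (p n))
            {T. \<forall>B. \<exists>e\<in>full_edges n \<union> short_edges n. e \<subseteq> T \<and> (e \<subseteq> B \<or> e \<inter> B = {})}"
        using set_pmf_binomial_subset by (intro measure_pmf.finite_measure_mono_AE AE_pmfI) auto
      also have "\<dots> \<le> 20 * C ^ 3 * (2 ^ card Q) ^ 6 * real n powr - \<delta>"
      proof (rule prob_not_2_colourable_le)
        show "sparse_hypergraph (full_edges n) (short_edges n) (card Q) (p n) C
            (real n powr (1 - 1 / \<mu>)) (real n powr - \<delta>) \<theta>"
          using p n a Ca \<theta> by (intro sparse) auto
      qed (use p in auto)
      finally show ?thesis by (simp add: L_def)
    qed
    have "(\<lambda>n. real n powr - \<delta>) \<longlonglongrightarrow> 0"
      using \<delta> by (intro tendsto_neg_powr filterlim_real_sequentially) auto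
    then have lim: "(\<lambda>n. L * real n powr - \<delta>) \<longlonglongrightarrow> 0" by (rule tendsto_mult_right_zero)
    show ?thesis
      by (rule tendsto_sandwich[OF _ _ tendsto_const lim])
        (simp, rule eventually_sequentiallyI[of 1], rule bound)
  qed
  then show ?thesis using a(1) by blast
qed

end
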